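(* Let $G$ be a bridgeless graph. (1) If $G$ is triangularly connected, then $G$ admits an $S^1$-flow if and only if $G$ is not an odd wheel. (2) If $G$ contains a spanning triangle-tree, then $G$ admits an $S^1$-flow if and only if $G$ is not an odd crystal.
   Context: All graphs are finite and loopless; parallel edges are allowed unless stated otherwise. An $S^1$-flow of $G$ is a pair $(D,f)$ where $D$ is an orientation of $G$ and $f:E(G)\to S^1=\{\mathbf{x}\in\mathbb{R}^2:\|\mathbf{x}\|=1\}$ satisfies, at every vertex $v$, that the sum of $f(e)$ over edges $e$ directed out of $v$ equals the sum of $f(e)$ over edges directed into $v$. The wheel $W_k$ ($k\ge 3$) is obtained from a cycle $C_k$ by adding a new vertex adjacent to every vertex of $C_k$; it is an odd wheel if $k$ is odd. In the following definitions graphs are simple. A triangle-tree is a graph obtained from a triangle by repeatedly (zero or more times) adding a new vertex adjacent exactly to the two endpoints of an existing edge. A vertex of degree $2$ in a triangle-tree is called a leaf. A triangle-path is either a triangle or a triangle-tree with exactly two leaves; a triangle-path with leaves $u,v$ is denoted $\mathcal{P}(u,v)$. A connected graph $G$ is triangularly connected if every pair of edges of $G$, not necessarily distinct, lies in a common triangle-path (that is a subgraph of $G$). A crystal is a graph $\mathcal{P}(u,v)+uv$ obtained from a triangle-path $\mathcal{P}(u,v)$ with at least four vertices by adding a new edge joining its two leaves $u,v$. An odd crystal is a crystal in which every vertex has odd degree. A spanning triangle-tree of $G$ is a spanning subgraph of $G$ that is a triangle-tree. *)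

theory Defs
  imports "HOL-Analysis.Analysis" "Graph_Theory.Digraph"
begin

text \<open>Undirected multigraphs: an edge is a label carrying the set of its two endpoints, so parallel
  edges are different labels with the same endpoints. Values of \<open>ends\<close> outside \<open>edges\<close> are
  irrelevant.\<close>

record ('v, 'e) ugraph =
  vertices :: "'v set"
  edges :: "'e set"
  ends :: "'e \<Rightarrow> 'v set"

definition finite_loopless_graph :: "('v, 'e) ugraph \<Rightarrow> bool" where
  "finite_loopless_graph G \<longleftrightarrow> finite (vertices G) \<and> finite (edges G) \<and>
     (\<forall>e\<in>edges G. ends G e \<subseteq> vertices G \<and> card (ends G e) = 2)"

definition subgraph_of :: "('v, 'e) ugraph \<Rightarrow> ('v, 'e) ugraph \<Rightarrow> bool" where
  "subgraph_of H G \<longleftrightarrow> vertices H \<subseteq> vertices G \<and> edges H \<subseteq> edges G \<and>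
     (\<forall>e\<in>edges H. ends H e = ends G e)"

text \<open>Counting incident edges is the degree only because graphs are loopless.\<close>

definition degree_of :: "('v, 'e) ugraph \<Rightarrow> 'v \<Rightarrow> nat" where
  "degree_of G v = card {e \<in> edges G. v \<in> ends G e}"

definition adjacency :: "('v, 'e) ugraph \<Rightarrow> ('v \<times> 'v) set" where
  "adjacency G = {(u, v). \<exists>e\<in>edges G. ends G e = {u, v}}"

definition connected_graph :: "('v, 'e) ugraph \<Rightarrow> bool" where
  "connected_graph G \<longleftrightarrow> vertices G \<noteq> {} \<and>
     (\<forall>u\<in>vertices G. \<forall>v\<in>vertices G. (u, v) \<in> (adjacency G)\<^sup>*)"

definition delete_edge :: "('v, 'e) ugraph \<Rightarrow> 'e \<Rightarrow> ('v, 'e) ugraph" where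
  "delete_edge G e = G\<lparr>edges := edges G - {e}\<rparr>"

text \<open>A bridge is an edge that separates its two ends. A bridgeless graph may be disconnected.\<close>

definition is_bridge :: "('v, 'e) ugraph \<Rightarrow> 'e \<Rightarrow> bool" where
  "is_bridge G e \<longleftrightarrow> e \<in> edges G \<and>
     (\<exists>u v. ends G e = {u, v} \<and> (u, v) \<notin> (adjacency (delete_edge G e))\<^sup>*)"

definition bridgeless :: "('v, 'e) ugraph \<Rightarrow> bool" where
  "bridgeless G \<longleftrightarrow> (\<nexists>e. is_bridge G e)"


definition orientation_of :: "('v, 'e) ugraph \<Rightarrow> ('v, 'e) pre_digraph \<Rightarrow> bool" where
  "orientation_of G D \<longleftrightarrow> verts D = vertices G \<and> arcs D = edges G \<and>
     (\<forall>e\<in>edges G. {tail D e, head D e} = ends G e)"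

definition S1_flow :: "('v, 'e) ugraph \<Rightarrow> ('v, 'e) pre_digraph \<Rightarrow> ('e \<Rightarrow> real^2) \<Rightarrow> bool" where
  "S1_flow G D f \<longleftrightarrow> orientation_of G D \<and> (\<forall>e\<in>edges G. f e \<in> sphere 0 1) \<and>
     (\<forall>v\<in>vertices G. (\<Sum>e\<in>out_arcs D v. f e) = (\<Sum>e\<in>in_arcs D v. f e))"

definition admits_S1_flow :: "('v, 'e) ugraph \<Rightarrow> bool" where
  "admits_S1_flow G \<longleftrightarrow> (\<exists>D f. S1_flow G D f)"


text \<open>The classes of graphs below are closed under isomorphism; all of their members are simple,
  also when they occur as subgraphs of a graph with parallel edges.\<close>

definition is_cycle :: "nat \<Rightarrow> ('v, 'e) ugraph \<Rightarrow> bool" where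
  "is_cycle k C \<longleftrightarrow> 3 \<le> k \<and>
     (\<exists>c r. bij_betw c {..<k} (vertices C) \<and> bij_betw r {..<k} (edges C) \<and>
        (\<forall>i<k. ends C (r i) = {c i, c (Suc i mod k)}))"

definition is_wheel :: "nat \<Rightarrow> ('v, 'e) ugraph \<Rightarrow> bool" where
  "is_wheel k G \<longleftrightarrow>
     (\<exists>C h s. is_cycle k C \<and> subgraph_of C G \<and> h \<notin> vertices C \<and>
        vertices G = insert h (vertices C) \<and>
        bij_betw s (vertices C) (edges G - edges C) \<and>
        (\<forall>v\<in>vertices C. ends G (s v) = {h, v}))"

definition odd_wheel :: "('v, 'e) ugraph \<Rightarrow> bool" where
  "odd_wheel G \<longleftrightarrow> (\<exists>k. odd k \<and> is_wheel k G)"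

inductive triangle_tree :: "('v, 'e) ugraph \<Rightarrow> bool" where
  triangle: "is_cycle 3 T \<Longrightarrow> triangle_tree T"
| add_vertex: "\<lbrakk>triangle_tree T; e \<in> edges T; ends T e = {x, y}; w \<notin> vertices T;
     e1 \<notin> edges T; e2 \<notin> edges T; e1 \<noteq> e2;
     subgraph_of T T'; vertices T' = insert w (vertices T); edges T' = edges T \<union> {e1, e2};
     ends T' e1 = {w, x}; ends T' e2 = {w, y}\<rbrakk>
   \<Longrightarrow> triangle_tree T'"

definition leaves :: "('v, 'e) ugraph \<Rightarrow> 'v set" where
  "leaves T = {v \<in> vertices T. degree_of T v = 2}"

definition triangle_path :: "('v, 'e) ugraph \<Rightarrow> bool" where
  "triangle_path P \<longleftrightarrow> is_cycle 3 P \<or> (triangle_tree P \<and> card (leaves P) = 2)"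

text \<open>A graph with parallel edges is never triangularly connected, since triangle-paths are
  simple.\<close>

definition triangularly_connected :: "('v, 'e) ugraph \<Rightarrow> bool" where
  "triangularly_connected G \<longleftrightarrow> connected_graph G \<and>
     (\<forall>e\<in>edges G. \<forall>e'\<in>edges G.
        \<exists>P. triangle_path P \<and> subgraph_of P G \<and> e \<in> edges P \<and> e' \<in> edges P)"

definition crystal :: "('v, 'e) ugraph \<Rightarrow> bool" where
  "crystal G \<longleftrightarrow>
     (\<exists>P u v e. triangle_path P \<and> 4 \<le> card (vertices P) \<and> leaves P = {u, v} \<and>
        subgraph_of P G \<and> vertices G = vertices P \<and>
        e \<notin> edges P \<and> edges G = insert e (edges P) \<and> ends G e = {u, v})"

definition odd_crystal :: "('v, 'e) ugraph \<Rightarrow> bool" where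
  "odd_crystal G \<longleftrightarrow> crystal G \<and> (\<forall>v\<in>vertices G. odd (degree_of G v))"

definition spanning_triangle_tree :: "('v, 'e) ugraph \<Rightarrow> ('v, 'e) ugraph \<Rightarrow> bool" where
  "spanning_triangle_tree T G \<longleftrightarrow>
     triangle_tree T \<and> subgraph_of T G \<and> vertices T = vertices G"

end

theory Submission imports Defs begin

text \<open>Work with multisets of vertex pairs. Removing a piece of the graph is a reduction when every
  flow of the rest extends to the piece; the basic pieces are pairs of edges at a vertex that are
  split off, parallel edges, and pairs of adjacent or twin vertices of degree three, through which a
  vector passes unchanged because \<open>1\<close> is the sum of the two primitive sixth roots of unity.

  Existence is shown for every graph grown from an edge by attaching vertices to the two ends of an
  existing edge and by adding chords, unless it has at most one chord and only odd degrees. The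
  vertices attached last always admit one of the reductions, and since nearly all reductions preserve
  the parity of degrees, a reduction can only fail if the smaller graph is a two-tree with at
  most one chord and only odd degrees. Then the reduction is applied elsewhere, which ends with two copies of \<open>K4\<close>
  sharing an edge; here vectors of lengths \<open>1\<close>, \<open>sqrt 3\<close>, \<open>sqrt 3\<close> summing to zero are needed.

  Conversely, in a two-tree with one chord and odd degrees, follow the unit vector entering through
  the chord along the triangle-path: only finitely many divisions of it between the two ends of the
  current edge can occur, and none of them can be completed at the last triangle. Odd wheels are
  fans of this kind.\<close>

section \<open>Unit flows on multisets of vertex pairs\<close>

text \<open>The obstacle is rigidity at vertices of degree three: three unit vectors with sum zero
  are, up to rotation, the cube roots of unity, so odd degrees and a single chord leave hardly any
  freedom. Edge counts matter as much as parities: a second chord excludes the obstruction at once.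

  Splitting off creates parallel edges and new chords even in a simple graph. The induction, on the
  number of edges, therefore leaves the two classes of the theorem and runs over multigraphs; only
  afterwards is the single obstruction translated back. With a spanning triangle-tree it is an odd
  crystal; in a triangularly connected graph its chord lies in a triangle, which makes the two-tree
  a fan that the chord closes to an odd wheel.

  The net outflow at each vertex is prescribed and need not be zero. Every reduction thereby becomes
  a statement about the few edges that it touches, and the nonexistence proof can cut a graph along
  an edge and ask which outflows are possible on one side.\<close>

definition unit_flux :: "'v \<Rightarrow> 'v \<Rightarrow> complex \<Rightarrow> 'v \<Rightarrow> complex" where
  "unit_flux u v c = (\<lambda>w. c * (of_bool (w = u) - of_bool (w = v)))"

text \<open>\<open>\<beta>\<close> is the net outflow at each vertex, so the constant
  \<open>0\<close> stands for an S1-flow. No orientation is recorded: reversing an edge and negating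
  its vector gives the same flux.\<close>

inductive has_flow :: "'v set multiset \<Rightarrow> ('v \<Rightarrow> complex) \<Rightarrow> bool" where
  empty: "has_flow {#} (\<lambda>_. 0)"
| add: "\<lbrakk>has_flow E \<beta>; u \<noteq> v; cmod c = 1\<rbrakk>
    \<Longrightarrow> has_flow (add_mset {u, v} E) (\<lambda>w. \<beta> w + unit_flux u v c w)"

lemma has_flow_plus:
  assumes "has_flow A \<alpha>" "has_flow B \<beta>"
  shows "has_flow (A + B) (\<lambda>w. \<alpha> w + \<beta> w)"
  using assms(1)
proof induction
  case empty
  then show ?case using assms(2) by simp
next
  case (add E \<alpha> u v c)
  from has_flow.add[OF add.IH add.hyps(2,3)] show ?case
    by (simp add: algebra_simps)
qed

lemma has_flow_emptyD: "has_flow {#} \<beta> \<Longrightarrow> \<beta> = (\<lambda>_. 0)"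
  by (erule has_flow.cases) auto

lemma unit_flux_swap: "unit_flux u v c = unit_flux v u (- c)"
  by (auto simp: unit_flux_def)

text \<open>The rule \<open>add\<close> builds the edges in some order; commuting it with itself
  lets any copy of any edge be taken off, read in either direction.\<close>

lemma has_flow_removeD:
  assumes "has_flow E \<beta>" "E = add_mset {u, v} E'"
  shows "u \<noteq> v \<and> (\<exists>c \<alpha>. cmod c = 1 \<and> has_flow E' \<alpha> \<and> \<beta> = (\<lambda>w. \<alpha> w + unit_flux u v c w))"
  using assms
proof (induction arbitrary: E')
  case empty
  then show ?case by simp
next
  case (add E \<beta> a b c)
  show ?case
  proof (cases "{a, b} = {u, v}")
    case True
    then have E: "E = E'" using add.prems by simp
    from True have "a = u \<and> b = v \<or> a = v \<and> b = u" by (auto simp: doubleton_eq_iff)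
    then show ?thesis
    proof
      assume "a = u \<and> b = v" then show ?thesis using add.hyps E by blast
    next
      assume ab: "a = v \<and> b = u"
      then have "unit_flux a b c = unit_flux u v (- c)" using unit_flux_swap by metis
      then show ?thesis using add.hyps E ab
        by (intro conjI exI[of _ "- c"] exI[of _ \<beta>]) auto
    qed
  next
    case False
    then obtain E'' where E'': "E = add_mset {u, v} E''" "E' = add_mset {a, b} E''"
      using add.prems by (auto simp: add_eq_conv_ex)
    from add.IH[OF E''(1)] obtain d \<alpha> where "u \<noteq> v" "cmod d = 1" "has_flow E'' \<alpha>"
      "\<beta> = (\<lambda>w. \<alpha> w + unit_flux u v d w)" by blast
    then show ?thesis
      using has_flow.add[OF \<open>has_flow E'' \<alpha>\<close> add.hyps(2,3)] unfolding E''(2)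
      by (intro conjI exI[of _ d] exI[of _ "\<lambda>w. \<alpha> w + unit_flux a b c w"]) (auto simp: algebra_simps)
  qed
qed

lemma has_flow_add_iff:
  "has_flow (add_mset {u, v} E) \<beta> \<longleftrightarrow>
   u \<noteq> v \<and> (\<exists>c \<alpha>. cmod c = 1 \<and> has_flow E \<alpha> \<and> \<beta> = (\<lambda>w. \<alpha> w + unit_flux u v c w))"
  by (rule iffI, rule has_flow_removeD[OF _ refl]) (auto intro: has_flow.add)

lemma has_flow_elem: "has_flow E \<beta> \<Longrightarrow> e \<in># E \<Longrightarrow> \<exists>u v. e = {u, v} \<and> u \<noteq> v"
  by (induction rule: has_flow.induct) auto

lemma has_flow_plusE:
  assumes "has_flow (A + B) \<gamma>"
  obtains \<alpha> \<beta> where "has_flow A \<alpha>" "has_flow B \<beta>" "\<gamma> = (\<lambda>w. \<alpha> w + \<beta> w)"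
proof -
  have "has_flow (A + B) \<gamma> \<Longrightarrow> \<exists>\<alpha> \<beta>. has_flow A \<alpha> \<and> has_flow B \<beta> \<and> \<gamma> = (\<lambda>w. \<alpha> w + \<beta> w)"
  proof (induction A arbitrary: \<gamma>)
    case empty
    then show ?case using has_flow.empty by auto
  next
    case (add e A)
    then obtain u v where e: "e = {u, v}" using has_flow_elem[OF add.prems, of e] by auto
    from add.prems obtain c \<alpha> where c: "u \<noteq> v" "cmod c = 1" "has_flow (A + B) \<alpha>"
      "\<gamma> = (\<lambda>w. \<alpha> w + unit_flux u v c w)" unfolding e by (auto simp: has_flow_add_iff)
    from add.IH[OF c(3)] obtain \<alpha>' \<beta> where "has_flow A \<alpha>'" "has_flow B \<beta>" "\<alpha> = (\<lambda>w. \<alpha>' w + \<beta> w)"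
      by blast
    then show ?case unfolding e using c has_flow.add[OF \<open>has_flow A \<alpha>'\<close> c(1,2)]
      by (intro exI[of _ "\<lambda>w. \<alpha>' w + unit_flux u v c w"] exI[of _ \<beta>]) (auto simp: algebra_simps)
  qed
  with assms that show ?thesis by blast
qed

lemma has_flow_outside:
  "has_flow E \<beta> \<Longrightarrow> (\<And>e. e \<in># E \<Longrightarrow> w \<notin> e) \<Longrightarrow> \<beta> w = 0"
  by (induction rule: has_flow.induct) (auto simp: unit_flux_def)

text \<open>Rotating all vectors keeps their lengths. The nonexistence proof normalises the vector
  on the chord in this way.\<close>

lemma has_flow_scale: "has_flow E \<beta> \<Longrightarrow> cmod k = 1 \<Longrightarrow> has_flow E (\<lambda>w. k * \<beta> w)"
proof (induction rule: has_flow.induct)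
  case empty
  then show ?case using has_flow.empty by simp
next
  case (add E \<beta> u v c)
  then have "cmod (k * c) = 1" by (simp add: norm_mult)
  from has_flow.add[OF add.IH[OF add.prems] add.hyps(2) this] show ?case
    by (simp add: unit_flux_def algebra_simps)
qed

lemma has_flow_cong:
  "has_flow E \<beta> \<Longrightarrow> (\<And>w. \<beta> w = \<gamma> w) \<Longrightarrow> has_flow E \<gamma>"
  by (metis ext)

text \<open>The quantifier over all net outflows makes the notion local: in any surrounding graph, a
  flow through \<open>A\<close> turns into a flow through \<open>B\<close>. In the reductions
  \<open>A\<close> is the smaller piece.\<close>

definition flow_extends :: "'v set multiset \<Rightarrow> 'v set multiset \<Rightarrow> bool" where
  "flow_extends A B \<longleftrightarrow> (\<forall>\<beta>. has_flow A \<beta> \<longrightarrow> has_flow B \<beta>)"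

lemma flow_extends_replace:
  assumes "flow_extends A B" "has_flow (A + C) \<beta>" shows "has_flow (B + C) \<beta>"
  using assms(2)
proof (rule has_flow_plusE)
  fix \<alpha> \<gamma> assume "has_flow A \<alpha>" "has_flow C \<gamma>" "\<beta> = (\<lambda>w. \<alpha> w + \<gamma> w)"
  then show ?thesis using assms(1) has_flow_plus unfolding flow_extends_def by blast
qed

lemma flow_extends_use:
  assumes "flow_extends A B" "H = A + C" "G = B + C" "has_flow H \<beta>" shows "has_flow G \<beta>"
  using flow_extends_replace assms by blast

section \<open>Local replacements\<close>

definition om :: complex where "om = Complex (1/2) (sqrt 3 / 2)"

lemma cmod_om [simp]: "cmod om = 1" "cmod (1 - om) = 1"
  by (simp_all add: om_def cmod_def power_divide)

lemma om_square: "om * om = om - 1"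
  by (simp add: om_def complex_eq_iff)

lemma cmod_mult_unit [simp]:
  "cmod c = 1 \<Longrightarrow> cmod (om * c) = 1" "cmod c = 1 \<Longrightarrow> cmod ((1 - om) * c) = 1"
  by (simp_all add: norm_mult)

text \<open>The vector on \<open>yz\<close> is sent through the subdividing vertex \<open>x\<close>.
  Read backwards, this is splitting off two edges at \<open>x\<close>.\<close>

lemma flow_extends_lift:
  assumes "x \<noteq> y" "x \<noteq> z" shows "flow_extends {#{y, z}#} {#{x, y}, {x, z}#}"
  unfolding flow_extends_def
proof (intro allI impI)
  fix \<beta> :: "'a \<Rightarrow> complex" assume "has_flow {#{y, z}#} \<beta>"
  then obtain c where c: "cmod c = 1" "\<beta> = unit_flux y z c"
    by (auto simp: has_flow_add_iff dest!: has_flow_emptyD)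
  have "has_flow {#{x, y}, {x, z}#} (\<lambda>w. 0 + unit_flux x z c w + unit_flux x y (- c) w)"
    using assms c(1) by (intro has_flow.add has_flow.empty) simp_all
  then show "has_flow {#{x, y}, {x, z}#} \<beta>"
    by (rule has_flow_cong) (simp add: c unit_flux_def algebra_simps)
qed

lemma has_flow_digon:
  assumes "x \<noteq> y" "cmod a = 1" "cmod b = 1"
  shows "has_flow {#{x, y}, {x, y}#} (unit_flux x y (a + b))"
proof -
  have "has_flow {#{x, y}, {x, y}#} (\<lambda>w. 0 + unit_flux x y a w + unit_flux x y b w)"
    using assms by (intro has_flow.add has_flow.empty)
  then show ?thesis by (rule has_flow_cong) (simp add: unit_flux_def algebra_simps)
qed

lemma flow_extends_digon:
  assumes "x \<noteq> y" shows "flow_extends {#} {#{x, y}, {x, y}#}"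
  using has_flow_digon[OF assms, of 1 "-1"]
  by (auto simp: flow_extends_def unit_flux_def dest!: has_flow_emptyD)

lemma flow_extends_double: "flow_extends {#{x, y}#} {#{x, y}, {x, y}#}"
  unfolding flow_extends_def
proof (intro allI impI)
  fix \<beta> :: "'a \<Rightarrow> complex" assume "has_flow {#{x, y}#} \<beta>"
  then obtain c where c: "x \<noteq> y" "cmod c = 1" "\<beta> = unit_flux x y c"
    by (auto simp: has_flow_add_iff dest!: has_flow_emptyD)
  then show "has_flow {#{x, y}, {x, y}#} \<beta>"
    using has_flow_digon[OF c(1), of "om * c" "(1 - om) * c"]
    by (simp only: cmod_mult_unit distrib_right[symmetric]) simp
qed

text \<open>\<open>a\<close> splits \<open>c\<close> into \<open>om * c\<close> for \<open>b\<close>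
  and \<open>(1 - om) * c\<close> for \<open>x\<close>; \<open>x\<close> hands its share to
  \<open>b\<close>, where both join again. Since \<open>y = z\<close> is allowed, the same piece can
  be filled with net outflow zero.\<close>

lemma has_flow_bull:
  assumes "y \<noteq> a" "a \<noteq> b" "b \<noteq> z" "a \<noteq> x" "b \<noteq> x" "cmod c = 1"
  shows "has_flow {#{y, a}, {a, b}, {b, z}, {a, x}, {b, x}#} (unit_flux y z c)"
proof -
  have "cmod (- ((1 - om) * c)) = 1" using assms(6) by (simp only: norm_minus_cancel cmod_mult_unit)
  with assms have "has_flow {#{y, a}, {a, b}, {b, z}, {a, x}, {b, x}#}
    (\<lambda>w. 0 + unit_flux b x (- ((1 - om) * c)) w + unit_flux a x ((1 - om) * c) w + unit_flux b z c w
        + unit_flux a b (om * c) w + unit_flux y a c w)"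
    by (intro has_flow.add has_flow.empty) (simp_all only: cmod_mult_unit, auto)
  then show ?thesis by (rule has_flow_cong) (simp add: unit_flux_def algebra_simps)
qed

lemma flow_extends_bull:
  assumes "y \<noteq> a" "a \<noteq> b" "b \<noteq> z" "a \<noteq> x" "b \<noteq> x"
  shows "flow_extends {#{y, z}#} {#{y, a}, {a, b}, {b, z}, {a, x}, {b, x}#}"
  using has_flow_bull[OF assms]
  by (auto simp: flow_extends_def has_flow_add_iff dest!: has_flow_emptyD)

lemma flow_extends_K4_minus:
  assumes "y \<noteq> a" "a \<noteq> b" "b \<noteq> y" "a \<noteq> x" "b \<noteq> x"
  shows "flow_extends {#} {#{y, a}, {a, b}, {b, y}, {a, x}, {b, x}#}"
  using has_flow_bull[OF assms, of 1]
  by (auto simp: flow_extends_def unit_flux_def dest!: has_flow_emptyD)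

text \<open>The vector from \<open>z1\<close> splits at \<open>w1\<close> into two unit vectors,
  which travel through \<open>x\<close> and \<open>y\<close> and join again at
  \<open>w2\<close>.\<close>

lemma flow_extends_twins:
  assumes "z1 \<noteq> w1" "z2 \<noteq> w2" "w1 \<noteq> x" "w1 \<noteq> y" "w2 \<noteq> x" "w2 \<noteq> y"
  shows "flow_extends {#{z1, z2}#} {#{z1, w1}, {w1, x}, {w1, y}, {x, w2}, {y, w2}, {w2, z2}#}"
  unfolding flow_extends_def
proof (intro allI impI)
  fix \<beta> :: "'a \<Rightarrow> complex" assume "has_flow {#{z1, z2}#} \<beta>"
  then obtain c where c: "cmod c = 1" "\<beta> = unit_flux z1 z2 c"
    by (auto simp: has_flow_add_iff dest!: has_flow_emptyD)
  have "has_flow {#{z1, w1}, {w1, x}, {w1, y}, {x, w2}, {y, w2}, {w2, z2}#}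
    (\<lambda>w. 0 + unit_flux w2 z2 c w + unit_flux y w2 ((1 - om) * c) w + unit_flux x w2 (om * c) w
        + unit_flux w1 y ((1 - om) * c) w + unit_flux w1 x (om * c) w + unit_flux z1 w1 c w)"
    using assms c(1) by (intro has_flow.add has_flow.empty) (simp_all only: cmod_mult_unit, auto)
  then show "has_flow {#{z1, w1}, {w1, x}, {w1, y}, {x, w2}, {y, w2}, {w2, z2}#} \<beta>"
    by (rule has_flow_cong) (simp add: c unit_flux_def algebra_simps)
qed

text \<open>The two degree-three vertices \<open>a\<close>, \<open>b\<close> may also pass a vector of length \<open>sqrt 3\<close> from
  \<open>x\<close> to \<open>y\<close>; the direction is arbitrary, which is what the cube roots of unity alone cannot do.\<close>

lemma has_flow_K4_minus:
  assumes "y \<noteq> a" "a \<noteq> b" "b \<noteq> y" "a \<noteq> x" "b \<noteq> x" "cmod s = sqrt 3"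
  shows "has_flow {#{y, a}, {a, b}, {b, y}, {a, x}, {b, x}#} (unit_flux x y s)"
proof -
  \<comment> \<open>As \<open>1 + om\<close> has length \<open>sqrt 3\<close>, \<open>c\<close> is a
    unit vector. \<open>x\<close> sends \<open>c\<close> to \<open>b\<close> and
    \<open>om * c\<close> to \<open>a\<close>; \<open>b\<close> passes \<open>(1 - om) * c\<close>
    on to \<open>a\<close>; then \<open>y\<close> receives \<open>c\<close> from \<open>a\<close>
    and \<open>om * c\<close> from \<open>b\<close>.\<close>
  define c where "c = s / (1 + om)"
  have n: "cmod (1 + om) = sqrt 3" by (simp add: om_def cmod_def power_divide field_simps)
  then have nz: "1 + om \<noteq> 0" by auto
  have c: "cmod c = 1" "s = (1 + om) * c"
    using nz n assms(6) by (simp_all add: c_def norm_divide)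
  have "has_flow {#{y, a}, {a, b}, {b, y}, {a, x}, {b, x}#}
    (\<lambda>w. 0 + unit_flux b x (- c) w + unit_flux a x (- (om * c)) w + unit_flux b y (om * c) w
        + unit_flux a b (- ((1 - om) * c)) w + unit_flux y a (- c) w)"
    using assms c(1)
    by (intro has_flow.add has_flow.empty) (simp_all only: cmod_mult_unit norm_minus_cancel, auto)
  then show ?thesis by (rule has_flow_cong) (simp add: c(2) unit_flux_def algebra_simps)
qed

section \<open>Two-trees with chords\<close>

definition mset_deg :: "'v set multiset \<Rightarrow> 'v \<Rightarrow> nat" where
  "mset_deg E v = size (filter_mset (\<lambda>e. v \<in> e) E)"

lemma mset_deg_simps [simp]:
  "mset_deg {#} v = 0"
  "mset_deg (add_mset e E) v = of_bool (v \<in> e) + mset_deg E v"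
  "mset_deg (A + B) v = mset_deg A v + mset_deg B v"
  by (simp_all add: mset_deg_def)

lemma mset_deg_eq_0_iff: "mset_deg E v = 0 \<longleftrightarrow> (\<forall>e\<in>#E. v \<notin> e)"
  by (induction E) auto

definition pairs :: "'v set \<Rightarrow> 'v set multiset \<Rightarrow> bool" where
  "pairs V E \<longleftrightarrow> (\<forall>e\<in>#E. \<exists>a b. e = {a, b} \<and> a \<in> V \<and> b \<in> V \<and> a \<noteq> b)"

lemma pairs_simps [simp]:
  "pairs V {#}"
  "pairs V (A + B) \<longleftrightarrow> pairs V A \<and> pairs V B"
  "pairs V (add_mset e E) \<longleftrightarrow> (\<exists>a b. e = {a, b} \<and> a \<in> V \<and> b \<in> V \<and> a \<noteq> b) \<and> pairs V E"
  by (auto simp: pairs_def)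

lemma pairs_mono: "pairs V E \<Longrightarrow> V \<subseteq> W \<Longrightarrow> pairs W E"
  unfolding pairs_def by (meson in_mono)

lemma mset_deg_outside: "pairs V E \<Longrightarrow> v \<notin> V \<Longrightarrow> mset_deg E v = 0"
  by (auto simp: mset_deg_eq_0_iff pairs_def)

definition glue :: "'v \<Rightarrow> 'v \<Rightarrow> 'v \<Rightarrow> 'v set multiset \<Rightarrow> 'v set multiset" where
  "glue w x y E = add_mset {w, x} (add_mset {w, y} E)"

lemma glue_commute: "glue w x y (glue w' x' y' E) = glue w' x' y' (glue w x y E)"
  by (simp add: glue_def add_mset_commute)

lemma glue_swap: "glue w x y E = glue w y x E"
  by (simp add: glue_def add_mset_commute)

lemma glue_cong: "{u, v} = {x, y} \<Longrightarrow> glue w u v E = glue w x y E"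
  by (metis glue_swap doubleton_eq_iff)

lemma glue_add_mset: "glue w x y (add_mset e E) = add_mset e (glue w x y E)"
  by (simp add: glue_def add_mset_commute)

lemma glue_plus: "glue w x y E + N = glue w x y (E + N)"
  by (simp add: glue_def)

lemma size_glue [simp]: "size (glue w x y E) = size E + 2"
  by (simp add: glue_def)

lemma glue_mem [simp]: "e \<in># glue w x y E \<longleftrightarrow> e = {w, x} \<or> e = {w, y} \<or> e \<in># E"
  by (auto simp: glue_def)

lemma mset_deg_glue: "mset_deg (glue w x y E) v = of_bool (v = w \<or> v = x) + of_bool (v = w \<or> v = y) + mset_deg E v"
  by (simp add: glue_def)

text \<open>Chords may be added at any time, also parallel to an edge, and later vertices may hang
  on them. This freedom keeps the smaller graphs of the reductions, which contain new chords, inside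
  the class.\<close>

inductive chorded :: "'v set \<Rightarrow> 'v set multiset \<Rightarrow> bool" where
  base: "a \<noteq> b \<Longrightarrow> chorded {a, b} {#{a, b}#}"
| attach: "\<lbrakk>chorded V E; {x, y} \<in># E; w \<notin> V\<rbrakk> \<Longrightarrow> chorded (insert w V) (glue w x y E)"
| chord: "\<lbrakk>chorded V E; a \<in> V; b \<in> V; a \<noteq> b\<rbrakk> \<Longrightarrow> chorded V (add_mset {a, b} E)"

text \<open>The parameter \<open>r\<close> is the edge from which the construction starts; taking
  off vertices in reverse order never destroys it.\<close>

inductive two_tree :: "'v set \<Rightarrow> 'v set \<Rightarrow> 'v set multiset \<Rightarrow> bool" for r where
  base: "\<lbrakk>a \<noteq> b; r = {a, b}\<rbrakk> \<Longrightarrow> two_tree r r {#r#}"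
| attach: "\<lbrakk>two_tree r V E; {x, y} \<in># E; w \<notin> V\<rbrakk> \<Longrightarrow> two_tree r (insert w V) (glue w x y E)"

lemma chorded_finite: "chorded V E \<Longrightarrow> finite V"
  by (induction rule: chorded.induct) auto

lemma chorded_pairs: "chorded V E \<Longrightarrow> pairs V E"
proof (induction rule: chorded.induct)
  case (attach V E x y w)
  then obtain a b where "{x, y} = {a, b}" "a \<in> V" "b \<in> V" unfolding pairs_def by metis
  then have "x \<in> V" "y \<in> V" by (auto simp: doubleton_eq_iff)
  with attach show ?case by (auto simp: glue_def intro: pairs_mono[of V])
qed auto

lemma chorded_edgeD:
  assumes "chorded V E" "{x, y} \<in># E" shows "x \<in> V" "y \<in> V" "x \<noteq> y"
proof -
  obtain a b where "{x, y} = {a, b}" "a \<in> V" "b \<in> V" "a \<noteq> b"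
    using chorded_pairs[OF assms(1)] assms(2) unfolding pairs_def by metis
  then show "x \<in> V" "y \<in> V" "x \<noteq> y" by (auto simp: doubleton_eq_iff)
qed

lemma chorded_plus: "chorded V E \<Longrightarrow> pairs V N \<Longrightarrow> chorded V (E + N)"
  by (induction N) (auto intro: chorded.chord)

lemma chorded_card: "chorded V E \<Longrightarrow> 2 \<le> card V"
proof (induction rule: chorded.induct)
  case (attach V E x y w)
  then show ?case using chorded_finite[OF attach.hyps(1)] by simp
qed auto

lemma chorded_size: "chorded V E \<Longrightarrow> 2 * card V \<le> size E + 3"
proof (induction rule: chorded.induct)
  case (attach V E x y w)
  then show ?case using chorded_finite[OF attach.hyps(1)] by simp
qed auto

lemma two_tree_chorded: "two_tree r V E \<Longrightarrow> chorded V E"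
  by (induction rule: two_tree.induct) (auto intro: chorded.intros)

lemma two_tree_size: "two_tree r V E \<Longrightarrow> size E + 3 = 2 * card V"
proof (induction rule: two_tree.induct)
  case (attach V E x y w)
  then show ?case using chorded_finite[OF two_tree_chorded[OF attach.hyps(1)]] by simp
qed auto

lemma two_tree_root: "two_tree r V E \<Longrightarrow> r \<subseteq> V \<and> r \<in># E"
  by (induction rule: two_tree.induct) auto

lemma chorded_two_tree: "chorded V E \<Longrightarrow> size E + 3 \<le> 2 * card V \<Longrightarrow> \<exists>r. two_tree r V E"
proof (induction rule: chorded.induct)
  case (base a b)
  then show ?case by (auto intro: two_tree.base)
next
  case (attach V E x y w)
  then show ?case using chorded_finite[OF attach.hyps(1)] by (auto intro: two_tree.attach)
next
  case (chord V E a b)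
  then show ?case using chorded_size[OF chord.hyps(1)] by simp
qed

text \<open>The triangle \<open>wpq\<close> may as well start with \<open>wp\<close> and attach
  \<open>q\<close>; all other attachments commute with that of \<open>w\<close>.\<close>

lemma two_tree_adjacent_root:
  "two_tree {p, q} V E \<Longrightarrow> w \<notin> V \<Longrightarrow> p \<noteq> q \<Longrightarrow> two_tree {w, p} (insert w V) (glue w p q E)"
proof (induction rule: two_tree.induct)
  case (base a b)
  have "two_tree {w, p} (insert q {w, p}) (glue q w p {#{w, p}#})"
    using base by (rule_tac two_tree.attach, rule_tac two_tree.base) auto
  then show ?case by (simp add: glue_def insert_commute add_mset_commute)
next
  case (attach V E x y u)
  then have "two_tree {w, p} (insert u (insert w V)) (glue u x y (glue w p q E))"
    by (rule_tac two_tree.attach) auto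
  then show ?case by (simp add: glue_commute insert_commute)
qed

lemma two_tree_reroot: "two_tree r V E \<Longrightarrow> e \<in># E \<Longrightarrow> two_tree e V E"
proof (induction arbitrary: e rule: two_tree.induct)
  case (base a b)
  then show ?case by (auto intro: two_tree.base)
next
  case (attach V E x y w)
  have xy: "x \<noteq> y" using chorded_edgeD two_tree_chorded attach.hyps by metis
  have "two_tree {x, y} V E" using attach by blast
  consider "e = {w, x}" | "e = {w, y}" | "e \<in># E" using attach.prems by auto
  then show ?case
  proof cases
    case 1
    then show ?thesis using two_tree_adjacent_root \<open>two_tree {x, y} V E\<close> attach.hyps(3) xy by metis
  next
    case 2
    have "two_tree {y, x} V E" using \<open>two_tree {x, y} V E\<close> by (simp add: insert_commute)
    then show ?thesis using two_tree_adjacent_root[of y x V E w] attach.hyps(3) xy 2 glue_swap by metis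
  next
    case 3
    then show ?thesis using attach by (auto intro: two_tree.attach)
  qed
qed

text \<open>Rerooted at \<open>e\<close>, the construction ends with a vertex off
  \<open>e\<close>.\<close>

lemma two_tree_leaf_avoiding:
  assumes "two_tree r V E" "3 \<le> card V" "e \<in># E"
  obtains w p q V0 E0 where "V = insert w V0" "E = glue w p q E0" "w \<notin> V0" "{p, q} \<in># E0" "two_tree e V0 E0"
    "w \<notin> e" "p \<in> V0" "q \<in> V0" "p \<noteq> q" "card V = Suc (card V0)"
  using two_tree_reroot[OF assms(1,3)]
proof cases
  case (base a b)
  then show ?thesis using assms(2) by (auto simp: card_insert_if split: if_splits)
next
  case (attach V0 E0 x y w)
  then show ?thesis using that[of w V0 x y E0] two_tree_root chorded_edgeD[OF two_tree_chorded[OF attach(3)]]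
    chorded_finite[OF two_tree_chorded[OF attach(3)]] by (metis card_insert_disjoint in_mono)
qed

section \<open>Degrees and parities in two-trees\<close>

lemma two_tree_mdeg_ge2: "two_tree r V E \<Longrightarrow> 3 \<le> card V \<Longrightarrow> v \<in> V \<Longrightarrow> 2 \<le> mset_deg E v"
proof (induction arbitrary: v rule: two_tree.induct)
  case (base a b)
  then show ?case by (auto simp: card_insert_if split: if_splits)
next
  case (attach V E x y w)
  note c = two_tree_chorded[OF attach.hyps(1)]
  show ?case
  proof (cases "v = w")
    case True
    then show ?thesis by (simp add: mset_deg_glue)
  next
    case False
    then have v: "v \<in> V" using attach.prems by auto
    show ?thesis
    proof (cases "3 \<le> card V")
      case True
      then show ?thesis using attach.IH[OF True v] by (simp add: mset_deg_glue)
    next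
      case f: False
      then have "card V = 2" using chorded_card[OF c] by simp
      moreover have "{x, y} \<subseteq> V" "card {x, y} = 2" using chorded_edgeD[OF c attach.hyps(2)] by auto
      ultimately have "{x, y} = V" using chorded_finite[OF c] by (metis card_subset_eq)
      then have vxy: "v = x \<or> v = y" using v by auto
      have "mset_deg E v \<noteq> 0" using attach.hyps(2) vxy unfolding mset_deg_eq_0_iff by auto
      then show ?thesis using vxy False by (auto simp: mset_deg_glue)
    qed
  qed
qed

lemma two_tree_leaf_avoiding_mset_deg:
  assumes "two_tree r V E" "3 \<le> card V" "e \<in># E"
  shows "\<exists>w\<in>V. w \<notin> e \<and> mset_deg E w = 2"
proof -
  obtain w p q V0 E0 where *: "V = insert w V0" "E = glue w p q E0" "w \<notin> V0" "{p, q} \<in># E0"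
    "two_tree e V0 E0" "w \<notin> e" "p \<in> V0" "q \<in> V0" "p \<noteq> q" "card V = Suc (card V0)"
    by (rule two_tree_leaf_avoiding[OF assms])
  have "mset_deg E0 w = 0" using * mset_deg_outside chorded_pairs two_tree_chorded by metis
  then show ?thesis using * by (auto simp: mset_deg_glue)
qed

lemma two_tree_some_even:
  assumes "two_tree r V E" "3 \<le> card V" shows "\<exists>v\<in>V. even (mset_deg E v)"
  using two_tree_leaf_avoiding_mset_deg[OF assms, of r] two_tree_root[OF assms(1)] by force

text \<open>A leaf off the edge \<open>xy\<close> keeps degree two; on two vertices the doubled edge
  itself gives degree two. Hence doubling an edge of a two-tree never produces the
  obstruction.\<close>

lemma two_tree_doubled_edge_even:
  assumes "two_tree r V E" "{x, y} \<in># E"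
  shows "\<exists>v\<in>V. even (mset_deg (add_mset {x, y} E) v)"
proof (cases "3 \<le> card V")
  case True
  from two_tree_leaf_avoiding_mset_deg[OF assms(1) True assms(2)] show ?thesis by force
next
  case False
  from assms(1) show ?thesis
  proof cases
    case (base a b)
    then show ?thesis using assms by auto
  next
    case (attach V' E' u v w)
    then show ?thesis using False chorded_card[OF two_tree_chorded[OF attach(3)]] chorded_finite[OF two_tree_chorded[OF attach(3)]]
      by simp
  qed
qed

subsection \<open>How such a graph can end\<close>

text \<open>The possible positions of the last vertices, up to reordering attachments: none, one on
  a base with two vertices, two on a common edge, a chain of two, or a centre \<open>x\<close> with
  one vertex on each of its two edges. The predicate \<open>Q\<close> on the base is a parameter
  because the analysis serves \<open>chorded\<close> and also two-trees whose root must be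
  kept.\<close>

inductive end_shape :: "('v set \<Rightarrow> 'v set multiset \<Rightarrow> bool) \<Rightarrow> 'v set \<Rightarrow> 'v set multiset \<Rightarrow> bool" for Q where
  two: "\<lbrakk>Q V E; card V = 2\<rbrakk> \<Longrightarrow> end_shape Q V E"
| tri: "\<lbrakk>Q V E; card V = 2; {x, y} \<in># E; w \<notin> V\<rbrakk> \<Longrightarrow> end_shape Q (insert w V) (glue w x y E)"
| twins: "\<lbrakk>Q V E; {x, y} \<in># E; w1 \<notin> V; w2 \<notin> V; w1 \<noteq> w2\<rbrakk>
    \<Longrightarrow> end_shape Q (insert w2 (insert w1 V)) (glue w2 x y (glue w1 x y E))"
| tail: "\<lbrakk>Q V E; {y, p} \<in># E; x \<notin> V; w \<notin> V; x \<noteq> w\<rbrakk>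
    \<Longrightarrow> end_shape Q (insert w (insert x V)) (glue w x y (glue x y p E))"
| fork: "\<lbrakk>Q V E; {y, p} \<in># E; x \<notin> V; w1 \<notin> V; w2 \<notin> V; x \<noteq> w1; x \<noteq> w2; w1 \<noteq> w2\<rbrakk>
    \<Longrightarrow> end_shape Q (insert w2 (insert w1 (insert x V))) (glue w2 x p (glue w1 x y (glue x y p E)))"

lemma end_shape_glue_new:
  assumes glue: "\<And>V E x y w. Q V E \<Longrightarrow> {x, y} \<in># E \<Longrightarrow> w \<notin> V \<Longrightarrow> Q (insert w V) (glue w x y E)"
  assumes "Q V E" "{x, y} \<in># E" "w1 \<notin> V" "w \<notin> V" "w \<noteq> w1" "{u, v} = {w1, x} \<or> {u, v} = {w1, y}"
  shows "end_shape Q (insert w (insert w1 V)) (glue w u v (glue w1 x y E))"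
  using assms(7)
proof
  assume "{u, v} = {w1, x}"
  then have "glue w u v (glue w1 x y E) = glue w w1 x (glue w1 x y E)" by (rule glue_cong)
  then show ?thesis using end_shape.tail[of Q V E x y w1 w] assms by auto
next
  assume "{u, v} = {w1, y}"
  then have "glue w u v (glue w1 x y E) = glue w w1 y (glue w1 y x E)" using glue_cong glue_swap by metis
  then show ?thesis using end_shape.tail[of Q V E y x w1 w] assms by (auto simp: insert_commute)
qed

text \<open>A vertex hung on an edge of the base can be attached before the end vertices. Hung on an
  edge of the end, it enlarges the shape, or else some of the old end vertices are counted to the
  base.\<close>

lemma end_shape_glue:
  assumes glue: "\<And>V E x y w. Q V E \<Longrightarrow> {x, y} \<in># E \<Longrightarrow> w \<notin> V \<Longrightarrow> Q (insert w V) (glue w x y E)"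
  assumes cl: "\<And>V E. Q V E \<Longrightarrow> chorded V E"
  assumes "end_shape Q V E" "{u, v} \<in># E" "w \<notin> V"
  shows "end_shape Q (insert w V) (glue w u v E)"
  using assms(3-5)
proof cases
  case two
  then show ?thesis using end_shape.tri assms by metis
next
  case (tri V0 E0 x y w1)
  have w: "w \<notin> V0" "w \<noteq> w1" using tri assms by auto
  consider "{u, v} \<in># E0" | "{u, v} = {w1, x} \<or> {u, v} = {w1, y}" using assms(4) tri by auto
  then show ?thesis
  proof cases
    case 1
    have "{u, v} \<subseteq> V0" "{x, y} \<subseteq> V0" "u \<noteq> v" "x \<noteq> y" using chorded_edgeD cl tri 1 by (metis bot.extremum insert_subset)+
    then have "{u, v} = V0" "{x, y} = V0" using tri chorded_finite[OF cl[OF tri(3)]] by (metis card_2_iff card_subset_eq)+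
    then have "glue w u v E = glue w x y E" by (intro glue_cong) auto
    then show ?thesis using end_shape.twins[of Q V0 E0 x y w1 w] tri w by auto
  next
    case 2
    then show ?thesis using end_shape_glue_new[where Q = Q, OF glue] tri w by metis
  qed
next
  case (twins V0 E0 x y w1 w2)
  have w: "w \<notin> V0" "w \<noteq> w1" "w \<noteq> w2" using twins assms by auto
  note Q1 = glue[OF twins(3,4,5)] and Q2 = glue[OF twins(3,4,6)]
  consider "{u, v} \<in># E0" | "{u, v} = {w1, x} \<or> {u, v} = {w1, y}" | "{u, v} = {w2, x} \<or> {u, v} = {w2, y}"
    using assms(4) twins by auto
  then show ?thesis
  proof cases
    case 1
    from end_shape.twins[where Q = Q, OF glue[OF twins(3) 1 w(1)], of x y w1 w2] show ?thesis
      using twins w by (simp add: glue_commute[of w] insert_commute)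
  next
    case 2
    from end_shape_glue_new[where Q = Q, OF glue Q2 _ _ _ w(2) 2] show ?thesis using twins w
      by (simp add: glue_commute[of w1] insert_commute)
  next
    case 3
    from end_shape_glue_new[where Q = Q, OF glue Q1 _ _ _ w(3) 3] show ?thesis using twins w by simp
  qed
next
  case (tail V0 E0 y p x w1)
  have w: "w \<notin> V0" "w \<noteq> w1" "w \<noteq> x" using tail assms by auto
  note Q1 = glue[OF tail(3,4,5)]
  consider "{u, v} \<in># E0" | "{u, v} = {w1, x} \<or> {u, v} = {w1, y}" | "{u, v} = {x, y}" | "{u, v} = {x, p}"
    using assms(4) tail by auto
  then show ?thesis
  proof cases
    case 1
    from end_shape.tail[where Q = Q, OF glue[OF tail(3) 1 w(1)], of y p x w1] show ?thesis
      using tail w by (simp add: glue_commute[of w] insert_commute)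
  next
    case 2
    from end_shape_glue_new[where Q = Q, OF glue Q1 _ _ _ w(2) 2] show ?thesis using tail w by simp
  next
    case 3
    from end_shape.twins[where Q = Q, OF Q1, of x y w1 w] show ?thesis using tail w glue_cong[OF 3] by simp
  next
    case 4
    from end_shape.fork[where Q = Q, OF tail(3), of y p x w1 w] show ?thesis using tail w glue_cong[OF 4] by simp
  qed
next
  case (fork V0 E0 y p x w1 w2)
  have w: "w \<notin> V0" "w \<noteq> w1" "w \<noteq> x" "w \<noteq> w2" using fork assms by auto
  note Q0 = glue[OF fork(3,4,5)]
  have Q1: "Q (insert w1 (insert x V0)) (glue w1 x y (glue x y p E0))" using fork by (intro glue Q0) auto
  have Q2: "Q (insert w2 (insert x V0)) (glue w2 x p (glue x y p E0))" using fork by (intro glue Q0) auto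
  consider "{u, v} \<in># E0" | "{u, v} = {w1, x} \<or> {u, v} = {w1, y}"  | "{u, v} = {w2, x} \<or> {u, v} = {w2, p}"
     | "{u, v} = {x, y}" | "{u, v} = {x, p}"
    using assms(4) fork by auto
  then show ?thesis
  proof cases
    case 1
    from end_shape.fork[where Q = Q, OF glue[OF fork(3) 1 w(1)], of y p x w1 w2] show ?thesis
      using fork w by (simp add: glue_commute[of w] insert_commute)
  next
    case 2
    from end_shape_glue_new[where Q = Q, OF glue Q2 _ _ _ w(2) 2] show ?thesis using fork w
      by (simp add: glue_commute[of w1] insert_commute)
  next
    case 3
    from end_shape_glue_new[where Q = Q, OF glue Q1 _ _ _ w(4) 3] show ?thesis using fork w by simp
  next
    case 4
    from end_shape.twins[where Q = Q, OF Q2, of x y w1 w] show ?thesis using fork w glue_cong[OF 4]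
      by (simp add: glue_commute[of w1] insert_commute)
  next
    case 5
    from end_shape.twins[where Q = Q, OF Q1, of x p w2 w] show ?thesis using fork w glue_cong[OF 5] by simp
  qed
qed

lemma two_tree_end_shape: "two_tree r V E \<Longrightarrow> end_shape (two_tree r) V E"
proof (induction rule: two_tree.induct)
  case (base a b)
  then show ?case by (intro end_shape.two two_tree.base) auto
next
  case (attach V E x y w)
  then show ?case by (intro end_shape_glue) (auto intro: two_tree.attach two_tree_chorded)
qed

lemma end_shape_chorded:
  assumes "end_shape chorded V E" shows "chorded V E"
  using assms by cases (auto intro!: chorded.attach)

text \<open>The vertex \<open>w\<close> hangs on an edge that can be spared: without
  \<open>ab\<close> the base is still \<open>chorded\<close>.\<close>

inductive chord_end :: "'v set \<Rightarrow> 'v set multiset \<Rightarrow> bool" where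
  "\<lbrakk>chorded V E; a \<in> V; b \<in> V; a \<noteq> b; w \<notin> V\<rbrakk> \<Longrightarrow> chord_end (insert w V) (glue w a b (add_mset {a, b} E))"

text \<open>Chords are set aside in \<open>N\<close> until a vertex is hung on one of them. Up to
  then the end looks as in a two-tree; when it happens, the chord and the new vertex form a
  \<open>chord_end\<close>.\<close>

lemma chorded_end_cases:
  "chorded V E \<Longrightarrow> \<exists>C N. E = C + N \<and> pairs V N \<and> (end_shape chorded V C \<or> chord_end V C)"
proof (induction rule: chorded.induct)
  case (base a b)
  then have "end_shape chorded {a, b} {#{a, b}#}" by (intro end_shape.two chorded.base) auto
  then show ?case by (intro exI[of _ "{#{a, b}#}"] exI[of _ "{#}"]) auto
next
  case (chord V E a b)
  then obtain C N where "E = C + N" "pairs V N" "end_shape chorded V C \<or> chord_end V C" by metis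
  then show ?case using chord by (intro exI[of _ C] exI[of _ "add_mset {a, b} N"]) auto
next
  case (attach V E u v w)
  then obtain C N where E: "E = C + N" and N: "pairs V N" and C: "end_shape chorded V C \<or> chord_end V C" by metis
  have cC: "chorded V C" using C
  proof
    assume "chord_end V C" then show ?thesis by cases (auto intro!: chorded.intros)
  qed (rule end_shape_chorded)
  have N': "pairs (insert w V) N" using N by (rule pairs_mono) auto
  show ?case
  proof (cases "{u, v} \<in># C")
    case True
    have "end_shape chorded (insert w V) (glue w u v C) \<or> chord_end (insert w V) (glue w u v C)"
      using C
    proof
      assume "end_shape chorded V C"
      then show ?thesis using end_shape_glue[of chorded V C u v w] True attach.hyps chorded.attach by blast
    next
      assume "chord_end V C"
      then show ?thesis
      proof cases
        case (1 V0 E0 a b w')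
        have w: "w \<notin> V0" "w \<noteq> w'" using 1 attach by auto
        have c0: "chorded V0 (add_mset {a, b} E0)" using 1 by (intro chorded.chord) auto
        consider "{u, v} \<in># E0" | "{u, v} = {w', a} \<or> {u, v} = {w', b}" | "{u, v} = {a, b}"
          using True 1 by auto
        then show ?thesis
        proof cases
          case c1: 1
          from chord_end.intros[OF chorded.attach[OF 1(3) c1 w(1)], of a b w'] show ?thesis
            using 1 w by (simp add: glue_commute[of w] glue_add_mset insert_commute)
        next
          case 2
          from end_shape_glue_new[where Q = chorded, OF chorded.attach c0 _ _ _ w(2) 2] show ?thesis using 1 w by simp
        next
          case 3
          from end_shape.twins[of chorded, OF c0, of a b w' w] show ?thesis using 1 w glue_cong[OF 3] by simp
        qed
      qed
    qed
    then show ?thesis unfolding E using N' by (intro exI[of _ "glue w u v C"] exI[of _ N]) (auto simp: glue_plus)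
  next
    case False
    then obtain N0 where N0: "N = add_mset {u, v} N0" using attach E by (meson mset_add union_iff)
    have "chorded V (C + N0)" using cC N N0 by (intro chorded_plus) auto
    moreover have "u \<in> V" "v \<in> V" "u \<noteq> v" using chorded_edgeD[OF attach.hyps(1,2)] by auto
    ultimately have "chord_end (insert w V) (glue w u v (add_mset {u, v} (C + N0)))"
      using attach.hyps(3) by (intro chord_end.intros)
    then show ?thesis unfolding E N0 by (intro exI[of _ "glue w u v (add_mset {u, v} (C + N0))"] exI[of _ "{#}"]) auto
  qed
qed

section \<open>Reductions\<close>

text \<open>A two-tree on \<open>n\<close> vertices has \<open>2 n - 3\<close> edges, so the first condition allows at most one chord.\<close>

definition exceptional :: "'v set \<Rightarrow> 'v set multiset \<Rightarrow> bool" where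
  "exceptional V E \<longleftrightarrow> size E + 2 \<le> 2 * card V \<and> (\<forall>v\<in>V. odd (mset_deg E v))"

text \<open>The induction hypothesis in a form that the reductions can cite. The type argument fixes
  the vertex type, which otherwise occurs only under quantifiers.\<close>

definition flows_below :: "'v itself \<Rightarrow> nat \<Rightarrow> bool" where
  "flows_below _ n \<longleftrightarrow> (\<forall>V E. size E < n \<longrightarrow> chorded (V :: 'v set) E \<longrightarrow> \<not> exceptional V E \<longrightarrow> has_flow E (\<lambda>_. 0))"

lemma flows_belowD:
  "flows_below TYPE('v) n \<Longrightarrow> size E < n \<Longrightarrow> chorded (V :: 'v set) E \<Longrightarrow> \<not> exceptional V E \<Longrightarrow> has_flow E (\<lambda>_. 0)"
  unfolding flows_below_def by blast

text \<open>The last rule cannot be \<open>attach\<close>, whose new vertex has the even degree two;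
  and before a final chord the edge count is that of a two-tree.\<close>

lemma exceptional_cases:
  assumes "chorded V E" "exceptional V E"
  obtains (edge) a b where "a \<noteq> b" "V = {a, b}" "E = {#{a, b}#}"
  | (tree) r T a b where "two_tree r V T" "E = add_mset {a, b} T" "a \<in> V" "b \<in> V" "a \<noteq> b"
  using assms(1)
proof cases
  case (base a b)
  then show ?thesis using edge by blast
next
  case (attach V0 E0 x y w)
  have "mset_deg E0 w = 0" using attach chorded_pairs mset_deg_outside by metis
  then have "mset_deg E w = 2" using attach by (simp add: mset_deg_glue)
  then show ?thesis using assms(2) attach unfolding exceptional_def by (metis even_numeral insertI1)
next
  case (chord E0 a b)
  then have "size E0 + 3 \<le> 2 * card V" using assms(2) by (simp add: exceptional_def)
  then obtain r where "two_tree r V E0" using chorded_two_tree chord by blast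
  then show ?thesis using tree chord by blast
qed

text \<open>By counting, such an exceptional graph would be a two-tree whose only chord is parallel
  to an edge of it, and then some degree is even.\<close>

lemma doubled_edge_not_exceptional:
  assumes "chorded V E" "{x, y} \<in># E" shows "\<not> exceptional V (add_mset {x, y} E + N)"
proof
  assume e: "exceptional V (add_mset {x, y} E + N)"
  then have "size E + 3 + size N \<le> 2 * card V" by (simp add: exceptional_def)
  then have "size N = 0" and le: "size E + 3 \<le> 2 * card V" using chorded_size[OF assms(1)] by linarith+
  then have N: "N = {#}" by simp
  obtain r where "two_tree r V E" using chorded_two_tree[OF assms(1) le] by blast
  from two_tree_doubled_edge_even[OF this assms(2)] show False using e N by (auto simp: exceptional_def)
qed

lemma pairs_extract:
  assumes "pairs V N" "mset_deg N w \<noteq> 0"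
  obtains z N0 where "N = add_mset {w, z} N0" "z \<in> V" "z \<noteq> w"
proof -
  obtain e where e: "e \<in># N" "w \<in> e" using assms(2) unfolding mset_deg_eq_0_iff by metis
  obtain a b where ab: "e = {a, b}" "a \<in> V" "b \<in> V" "a \<noteq> b" using e assms(1) unfolding pairs_def by metis
  obtain N0 where N0: "N = add_mset e N0" using e by (metis mset_add)
  show ?thesis
  proof (cases "w = a")
    case True
    then show ?thesis using that[of b N0] ab N0 by auto
  next
    case False
    then show ?thesis using that[of a N0] ab N0 e by (auto simp: insert_commute)
  qed
qed

lemma pairs_shrink:
  assumes "pairs (insert w V) N" "mset_deg N w = 0" shows "pairs V N"
  using assms unfolding pairs_def mset_deg_eq_0_iff by (metis insertE insertCI)

text \<open>Deleting one or both of two parallel edges leads to different parities at their ends, so one of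
  the two smaller graphs is not exceptional. Other reductions below come in pairs for the same reason.\<close>

lemma parallel_reduce:
  fixes e :: "'v set"
  assumes "flows_below TYPE('v) (size E)" "chorded V C" "E = add_mset e (add_mset e C)" "pairs V {#e#}"
  shows "has_flow E (\<lambda>_. 0)"
proof -
  obtain a b where e: "e = {a, b}" "a \<in> V" "b \<in> V" "a \<noteq> b" using assms(4) by auto
  show ?thesis
  proof (cases "exceptional V C")
    case False
    then have "has_flow C (\<lambda>_. 0)" using assms flows_belowD[OF assms(1)] by auto
    then show ?thesis using flow_extends_use[OF flow_extends_digon[OF e(4)], of C C E] assms(3) e by auto
  next
    case True
    have "chorded V (add_mset e C)" using e assms(2) by (auto intro: chorded.chord)
    moreover have "\<not> exceptional V (add_mset e C)" using True e by (auto simp: exceptional_def)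
    ultimately have "has_flow (add_mset e C) (\<lambda>_. 0)" using assms flows_belowD[OF assms(1)] by auto
    then show ?thesis using flow_extends_use[OF flow_extends_double[of a b], of "add_mset e C" C E] assms(3) e by auto
  qed
qed

text \<open>Splitting off two edges at \<open>t\<close> lowers the degree of \<open>t\<close> by
  two, keeps all other degrees and loses one edge. The last assumption provides three chords or an
  even degree, and either one keeps the smaller graph from being exceptional.\<close>

lemma lift_reduce:
  fixes t :: 'v
  assumes "flows_below TYPE('v) (size E)" "chorded V C" "E = C + N" "N = add_mset {t, z1} (add_mset {t, z2} N0)"
    "pairs V N" "2 * card V \<le> size E \<or> (\<exists>v\<in>V. even (mset_deg E v))"
  shows "has_flow E (\<lambda>_. 0)"
proof -
  have tz: "t \<in> V" "z1 \<in> V" "z2 \<in> V" "t \<noteq> z1" "t \<noteq> z2" and N0: "pairs V N0"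
    using assms(4,5) by (auto simp: doubleton_eq_iff)
  have c0: "chorded V (C + N0)" using assms(2) N0 by (rule chorded_plus)
  show ?thesis
  proof (cases "z1 = z2")
    case True
    show ?thesis using parallel_reduce[OF assms(1) c0, of "{t, z1}"] assms(3,4) tz True by auto
  next
    case False
    have "chorded V (add_mset {z1, z2} (C + N0))" using c0 tz False by (auto intro: chorded.chord)
    moreover have "\<not> exceptional V (add_mset {z1, z2} (C + N0))"
    proof -
      have "mset_deg E v = mset_deg (add_mset {z1, z2} (C + N0)) v + 2 * of_bool (v = t)" for v
        using assms(3,4) tz False by auto
      then show ?thesis using assms(3,4,6) unfolding exceptional_def by (metis (no_types, lifting) Suc_1 add_2_eq_Suc' dvd_triv_left even_add not_less_eq_eq size_add_mset union_mset_add_mset_right)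
    qed
    ultimately have "has_flow (add_mset {z1, z2} (C + N0)) (\<lambda>_. 0)" using assms flows_belowD[OF assms(1)] by auto
    then show ?thesis
      using flow_extends_use[OF flow_extends_lift[OF tz(4,5)], of "add_mset {z1, z2} (C + N0)" "C + N0" E] assms(3,4)
      by auto
  qed
qed

text \<open>Splitting off \<open>w\<close> doubles \<open>xy\<close>, which never gives an
  exceptional graph. This settles a vertex \<open>w\<close> without extra edges and, after doubling
  an edge, one whose single extra edge is parallel to \<open>wx\<close> or \<open>wy\<close>. Two
  extra edges at \<open>w\<close> can be split off. A minimal counterexample is left with one extra
  edge, to some other vertex.\<close>

lemma leaf_reduce:
  fixes w :: 'v
  assumes below: "flows_below TYPE('v) (size E)" and E: "E = glue w x y C + N" and C: "chorded V C" "{x, y} \<in># C"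
    and w: "w \<notin> V" and N: "pairs (insert w V) N" and nf: "\<not> has_flow E (\<lambda>_. 0)"
  obtains z N0 where "N = add_mset {w, z} N0" "pairs V N0" "z \<in> V" "z \<noteq> x" "z \<noteq> y"
proof -
  note xy = chorded_edgeD[OF C]
  have wxy: "w \<noteq> x" "w \<noteq> y" using xy w by auto
  have wC: "mset_deg C w = 0" using C w chorded_pairs mset_deg_outside by metis
  have "mset_deg N w = 0 \<or> mset_deg N w = 1 \<or> mset_deg N w \<ge> 2" by linarith
  then show ?thesis
  proof (elim disjE)
    assume "mset_deg N w = 0"
    then have NV: "pairs V N" using N pairs_shrink by metis
    have "chorded V (add_mset {x, y} C + N)" using C xy NV by (intro chorded_plus chorded.chord)
    then have "has_flow (add_mset {x, y} C + N) (\<lambda>_. 0)"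
      using doubled_edge_not_exceptional[OF C, of N] flows_belowD[OF below] E by auto
    then have "has_flow E (\<lambda>_. 0)"
      using flow_extends_use[OF flow_extends_lift[OF wxy], of "add_mset {x, y} C + N" "C + N" E] E
      by (simp add: glue_def)
    with nf show ?thesis by blast
  next
    assume m: "mset_deg N w \<ge> 2"
    obtain z1 N1 where 1: "N = add_mset {w, z1} N1" "z1 \<in> insert w V" "z1 \<noteq> w"
      using m pairs_extract[OF N, of w] by (metis not_numeral_le_zero)
    have "mset_deg N1 w \<noteq> 0" using m 1 by auto
    then obtain z2 N2 where 2: "N1 = add_mset {w, z2} N2" "z2 \<in> insert w V" "z2 \<noteq> w"
      using pairs_extract[of "insert w V" N1 w] N 1 by auto
    \<comment> \<open>If these two extra edges are all of \<open>N\<close>, then \<open>w\<close>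
      has the even degree four; any further edge makes three chords.\<close>
    have "2 * card (insert w V) \<le> size E \<or> (\<exists>v\<in>insert w V. even (mset_deg E v))"
    proof (cases "N2 = {#}")
      case True
      then have "mset_deg E w = 4" using E 1 2 wC by (simp add: mset_deg_glue)
      then show ?thesis by auto
    next
      case False
      then have "size N2 \<ge> 1" by (metis One_nat_def Suc_leI nonempty_has_size)
      then show ?thesis using chorded_size[OF C(1)] chorded_finite[OF C(1)] w E 1 2 by auto
    qed
    then have "has_flow E (\<lambda>_. 0)"
      using lift_reduce[OF below chorded.attach[OF C w] E _ N] 1 2 by blast
    with nf show ?thesis by blast
  next
    assume m: "mset_deg N w = 1"
    obtain z N0 where 1: "N = add_mset {w, z} N0" "z \<in> insert w V" "z \<noteq> w"
      using m pairs_extract[OF N, of w] by (metis zero_neq_one)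
    then have "mset_deg N0 w = 0" using m by auto
    then have N0: "pairs V N0" using N 1 pairs_shrink by auto
    have "chorded V (add_mset {x, y} C + N0)" using C xy N0 by (intro chorded_plus chorded.chord)
    then have f: "has_flow (add_mset {x, y} C + N0) (\<lambda>_. 0)"
      using doubled_edge_not_exceptional[OF C, of N0] flows_belowD[OF below] E 1 by auto
    have f: "has_flow (glue w x y C + N0) (\<lambda>_. 0)"
      using flow_extends_use[OF flow_extends_lift[OF wxy] _ _ f, of "C + N0"]
      by (simp add: glue_def)
    have "z \<noteq> x"
    proof
      assume "z = x"
      then have "has_flow E (\<lambda>_. 0)"
        using flow_extends_use[OF flow_extends_double[of w x] _ _ f, of "add_mset {w, y} (C + N0)" E] E 1
        by (simp add: glue_def)
      with nf show False by blast
    qed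
    moreover have "z \<noteq> y"
    proof
      assume "z = y"
      then have "has_flow E (\<lambda>_. 0)"
        using flow_extends_use[OF flow_extends_double[of w y] _ _ f, of "add_mset {w, x} (C + N0)" E] E 1
        by (simp add: glue_def add_mset_commute)
      with nf show False by blast
    qed
    ultimately show ?thesis using that 1 N0 by blast
  qed
qed

text \<open>Together with an edge \<open>xy\<close> of \<open>E\<close> this is a copy of
  \<open>K4\<close> that shares only \<open>xy\<close> with the rest.\<close>

definition hang :: "'v \<Rightarrow> 'v \<Rightarrow> 'v \<Rightarrow> 'v \<Rightarrow> 'v set multiset \<Rightarrow> 'v set multiset" where
  "hang a b x y E = add_mset {a, b} (glue b x y (glue a x y E))"

lemma hang_alt: "hang a b x y E = {#{y, a}, {a, b}, {b, y}, {a, x}, {b, x}#} + E"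
  by (simp add: hang_def glue_def insert_commute add_mset_commute)

lemma hang_swap: "hang a b x y E = hang b a x y E" "hang a b x y E = hang a b y x E"
  by (simp_all add: hang_def glue_def insert_commute add_mset_commute)

lemma hang_cong: "{u, v} = {x, y} \<Longrightarrow> hang a b u v E = hang a b x y E"
  by (metis hang_swap(2) doubleton_eq_iff)

lemma size_hang [simp]: "size (hang a b x y E) = size E + 5"
  by (simp add: hang_def)

lemma has_flow_hang:
  assumes "has_flow E (\<lambda>_. 0)" "a \<noteq> b" "a \<noteq> x" "a \<noteq> y" "b \<noteq> x" "b \<noteq> y"
  shows "has_flow (hang a b x y E) (\<lambda>_. 0)"
  using flow_extends_use[OF flow_extends_K4_minus[of y a b x] _ hang_alt, of E E] assms by auto

lemma has_flow_hang_flux: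
  assumes "has_flow E \<beta>" "a \<noteq> b" "a \<noteq> x" "a \<noteq> y" "b \<noteq> x" "b \<noteq> y" "cmod s = sqrt 3"
  shows "has_flow (hang a b x y E) (\<lambda>w. unit_flux x y s w + \<beta> w)"
  unfolding hang_alt using assms by (intro has_flow_plus has_flow_K4_minus) auto

lemma chorded_hang:
  assumes "chorded V E" "{x, y} \<in># E" "a \<notin> V" "b \<notin> V" "a \<noteq> b"
  shows "chorded (insert b (insert a V)) (hang a b x y E)"
  unfolding hang_def using assms by (intro chorded.chord chorded.attach) auto

text \<open>A vector of length \<open>sqrt 3\<close> whose sum with its conjugate is
  \<open>-1\<close> has real part \<open>-1/2\<close>, so its imaginary part squares to
  \<open>3 - 1/4 = 11/4\<close>.\<close>

lemma sqrt11: "(sqrt 11 / 2)\<^sup>2 + 1/4 = (3::real)"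
  by (simp add: power_divide)

text \<open>Two copies of \<open>K4\<close> sharing an edge: the vectors carried by the three parts of this graph have
  lengths \<open>1\<close>, \<open>sqrt 3\<close> and \<open>sqrt 3\<close>, and they can be turned independently.\<close>

lemma has_flow_two_K4:
  assumes "x \<noteq> y" "a \<noteq> b" "c \<noteq> d" "{a, b, c, d} \<inter> {x, y} = {}"
  shows "has_flow (hang a b x y (hang c d x y {#{x, y}#})) (\<lambda>_. 0)"
proof -
  define s where "s = Complex (-1/2) (sqrt 11 / 2)"
  have s: "cmod s = sqrt 3" "cmod (cnj s) = sqrt 3"
    using sqrt11 by (simp_all add: s_def cmod_def power_divide)
  have sum: "s + cnj s = - 1" by (simp add: s_def complex_eq_iff)
  have "has_flow {#{x, y}#} (\<lambda>w. 0 + unit_flux x y 1 w)"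
    using assms(1) by (intro has_flow.add has_flow.empty) auto
  then have "has_flow (hang c d x y {#{x, y}#}) (\<lambda>w. unit_flux x y (cnj s) w + (0 + unit_flux x y 1 w))"
    using assms s by (rule_tac has_flow_hang_flux) auto
  then have "has_flow (hang a b x y (hang c d x y {#{x, y}#}))
      (\<lambda>w. unit_flux x y s w + (unit_flux x y (cnj s) w + (0 + unit_flux x y 1 w)))"
    using assms s by (rule_tac has_flow_hang_flux) auto
  moreover have "unit_flux x y s w + (unit_flux x y (cnj s) w + (0 + unit_flux x y 1 w)) = 0" for w
  proof -
    have "unit_flux x y s w + (unit_flux x y (cnj s) w + (0 + unit_flux x y 1 w)) = unit_flux x y (s + cnj s + 1) w"
      by (simp add: unit_flux_def algebra_simps)
    then show ?thesis by (simp add: sum unit_flux_def)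
  qed
  ultimately show ?thesis by (rule has_flow_cong)
qed

section \<open>Two-trees with one chord and all degrees odd\<close>

lemma two_tree_odd_facts:
  assumes "two_tree r V T" "c \<in> V" "d \<in> V" "c \<noteq> d" "\<forall>v\<in>V. odd (mset_deg (add_mset {c, d} T) v)"
  shows "{c, d} \<notin># T" "3 \<le> card V" "\<And>v. v \<in> V \<Longrightarrow> even (mset_deg T v) \<longleftrightarrow> v = c \<or> v = d"
proof -
  show ncd: "{c, d} \<notin># T" using two_tree_doubled_edge_even[OF assms(1)] assms(5) by metis
  show "3 \<le> card V"
  proof (rule ccontr)
    assume "\<not> 3 \<le> card V"
    then have "card V = 2" using chorded_card[OF two_tree_chorded[OF assms(1)]] by simp
    moreover have "r \<subseteq> V" "card r = 2" "{c, d} \<subseteq> V" "card {c, d} = 2"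
      using two_tree_root[OF assms(1)] chorded_pairs[OF two_tree_chorded[OF assms(1)]] assms by (auto simp: pairs_def)
    ultimately have "r = {c, d}" using chorded_finite[OF two_tree_chorded[OF assms(1)]] by (metis card_subset_eq)
    then show False using ncd two_tree_root[OF assms(1)] by metis
  qed
  show "\<And>v. v \<in> V \<Longrightarrow> even (mset_deg T v) \<longleftrightarrow> v = c \<or> v = d"
    using assms(5) by fastforce
qed

lemma two_tree_card2:
  assumes "two_tree r V T" "card V = 2" shows "V = r" "T = {#r#}"
proof -
  have "size T = 1" using two_tree_size[OF assms(1)] assms(2) by simp
  then show "T = {#r#}" using two_tree_root[OF assms(1)] by (metis size_1_singleton_mset single_eq_single singletonD set_mset_single)
  have "card r = 2" using two_tree_root[OF assms(1)] chorded_pairs[OF two_tree_chorded[OF assms(1)]] by (auto simp: pairs_def)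
  then show "V = r" using two_tree_root[OF assms(1)] assms(2) chorded_finite[OF two_tree_chorded[OF assms(1)]] by (metis card_subset_eq)
qed

text \<open>A leaf of the two-tree has even degree there, so it is an end of the chord. Among the
  end shapes over the root \<open>xy\<close> this excludes the triangle, where the chord would be
  parallel to an edge, and the fork, whose centre has degree four and would be a third even vertex.
  Twins, and a tail with the chord to \<open>p\<close>, leave a base with odd degrees only, which is
  the root edge; any other tail is a bull.\<close>

lemma odd_chord_shape:
  assumes T: "two_tree {x, y} V T" and cd: "c \<in> V" "d \<in> V" "c \<noteq> d"
    and odd: "\<forall>v\<in>V. odd (mset_deg (add_mset {c, d} T) v)"
  obtains (small) a b where "a \<noteq> b" "{a, b} \<inter> {x, y} = {}" "add_mset {c, d} T = hang a b x y {#{x, y}#}"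
    "{c, d} = {a, b} \<or> {c, d} \<inter> {x, y} \<noteq> {}"
  | (bull) T0 V0 x' y' p w z where "two_tree {x, y} V0 T0" "{y', p} \<in># T0" "x' \<notin> V0" "w \<notin> V0" "x' \<noteq> w"
     "z \<in> V0" "z \<noteq> p" "z \<noteq> y'" "{c, d} = {w, z}" "T = glue w x' y' (glue x' y' p T0)"
     "V = insert w (insert x' V0)" 
proof -
  note facts = two_tree_odd_facts[OF T cd odd]
  have outside: "mset_deg T0 v = 0" if "two_tree {x, y} V0 T0" "v \<notin> V0" for V0 T0 and v :: 'a
    using that two_tree_chorded chorded_pairs mset_deg_outside by metis
  \<comment> \<open>A two-tree with three or more vertices has a leaf, so odd degrees throughout
    leave only the root edge.\<close>
  have V0_card2: "V0 = {x, y} \<and> T0 = {#{x, y}#}" if "two_tree {x, y} V0 T0" "\<And>v. v \<in> V0 \<Longrightarrow> odd (mset_deg T0 v)" for V0 T0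
  proof -
    have "card V0 = 2" using two_tree_some_even[OF that(1)] that(2) chorded_card[OF two_tree_chorded[OF that(1)]] by fastforce
    then show ?thesis using two_tree_card2[OF that(1)] by auto
  qed
  show ?thesis
    using two_tree_end_shape[OF T]
  proof cases
    case two
    then show ?thesis using facts(2) by simp
  next
    case (tri V0 T0 u v w)
    have "mset_deg T w = 2" using tri outside[of V0 T0 w] by (simp add: mset_deg_glue)
    then have "w = c \<or> w = d" using facts(3)[of w] tri by auto
    then obtain z where z: "{c, d} = {w, z}" "z \<in> V0" using cd tri by (auto simp: insert_commute)
    have "V0 = {u, v}" using two_tree_card2[OF tri(3,4)] tri(5) by auto
    then have "{w, z} \<in># T" using z tri by auto
    then show ?thesis using facts(1) z by simp
  next
    case (twins V0 T0 u v w1 w2)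
    have uv: "u \<in> V0" "v \<in> V0" "u \<noteq> v" using chorded_edgeD[OF two_tree_chorded[OF twins(3)] twins(4)] by auto
    have "mset_deg T w1 = 2" "mset_deg T w2 = 2"
      using twins outside[OF twins(3)] uv by (auto simp: mset_deg_glue)
    then have "w1 = c \<or> w1 = d" "w2 = c \<or> w2 = d" using facts(3)[of w1] facts(3)[of w2] twins by auto
    then have cdw: "{c, d} = {w1, w2}" using twins by auto
    have "odd (mset_deg T0 k)" if "k \<in> V0" for k
    proof -
      have "k \<noteq> w1" "k \<noteq> w2" "k \<in> V" using that twins by auto
      moreover from this(1,2) have "mset_deg (add_mset {c, d} T) k = mset_deg T0 k + 2 * of_bool (k = u \<or> k = v)"
        unfolding cdw twins(2) using uv(3) by (simp add: mset_deg_glue)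
      ultimately show ?thesis using bspec[OF odd, of k] by simp
    qed
    from V0_card2[OF twins(3) this] have V0: "V0 = {x, y}" "T0 = {#{x, y}#}" by auto
    then have "{u, v} = {x, y}" using twins by auto
    then have "add_mset {c, d} T = hang w1 w2 x y {#{x, y}#}"
      using twins cdw V0 hang_cong by (metis hang_def)
    then show ?thesis using small[of w1 w2] twins V0 cdw by auto
  next
    case (tail V0 T0 y' p x' w)
    have yp: "y' \<in> V0" "p \<in> V0" "y' \<noteq> p" using chorded_edgeD[OF two_tree_chorded[OF tail(3)] tail(4)] by auto
    have mw: "mset_deg T w = 2" "mset_deg T x' = 3"
      using tail outside[OF tail(3)] yp by (auto simp: mset_deg_glue)
    then have "w = c \<or> w = d" "x' \<noteq> c" "x' \<noteq> d" using facts(3)[of w] facts(3)[of x'] tail by auto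
    then obtain z where z: "{c, d} = {w, z}" "z \<in> V0" using cd tail by (auto simp: insert_commute)
    have zy: "z \<noteq> y'" using facts(1) z tail by auto
    show ?thesis
    proof (cases "z = p")
      case False
      then show ?thesis using bull tail z zy by blast
    next
      case True
      have "odd (mset_deg T0 k)" if "k \<in> V0" for k
      proof -
        have "k \<noteq> w" "k \<noteq> x'" "k \<in> V" using that tail by auto
        moreover from this(1,2) have "mset_deg (add_mset {c, d} T) k = mset_deg T0 k + 2 * of_bool (k = y' \<or> k = p)"
          unfolding z(1) tail(2) True using yp(3) by (auto simp add: mset_deg_glue)
        ultimately show ?thesis using bspec[OF odd, of k] by simp
      qed
      from V0_card2[OF tail(3) this] have V0: "V0 = {x, y}" "T0 = {#{x, y}#}" by auto
      then have yp': "{y', p} = {x, y}" using tail by auto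
      have "add_mset {c, d} T = hang w x' y' p {#{x, y}#}"
        using tail z True V0 by (simp add: hang_def glue_def insert_commute add_mset_commute)
      then have "add_mset {c, d} T = hang w x' x y {#{x, y}#}" using hang_cong[OF yp'] by metis
      then show ?thesis using small[of w x'] tail V0 z True yp by auto
    qed
  next
    case (fork V0 T0 y' p x' w1 w2)
    have yp: "y' \<in> V0" "p \<in> V0" "y' \<noteq> p" using chorded_edgeD[OF two_tree_chorded[OF fork(3)] fork(4)] by auto
    have "mset_deg T w1 = 2" "mset_deg T w2 = 2" "mset_deg T x' = 4"
      using fork outside[OF fork(3)] yp by (auto simp: mset_deg_glue)
    then show ?thesis using facts(3)[of w1] facts(3)[of w2] facts(3)[of x'] fork by auto
  qed
qed

lemma glue_neighbour:
  assumes "chorded V E" "w \<notin> V" "{w, y} \<in># glue w a b E" "a \<noteq> w" "b \<noteq> w"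
  shows "y = a \<or> y = b"
proof -
  have "{w, y} \<notin># E" using chorded_edgeD(1)[OF assms(1)] assms(2) by metis
  then show ?thesis using assms(3-5) by (auto simp: doubleton_eq_iff)
qed

text \<open>From the end \<open>v\<close> of the triangle-path, the next two vertices \<open>x\<close> and \<open>p\<close> have degree three and a
  common neighbour \<open>y\<close>, so they form a bull that can be removed.\<close>

lemma odd_chord_flux:
  assumes "two_tree r V T" "u \<in> V" "v \<in> V" "u \<noteq> v" "\<forall>k\<in>V. odd (mset_deg (add_mset {u, v} T) k)" "cmod s = sqrt 3"
  shows "has_flow T (unit_flux u v s)"
  using assms(1-5)
proof (induction "card V" arbitrary: r V T rule: less_induct)
  case less
  note facts = two_tree_odd_facts[OF less.prems]
  have outside: "mset_deg T0 k = 0" if "two_tree e V0 T0" "k \<notin> V0" for e V0 T0 and k :: 'a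
    using that two_tree_chorded chorded_pairs mset_deg_outside by metis
  have "mset_deg T u \<noteq> 0" using two_tree_mdeg_ge2[OF less.prems(1) facts(2) less.prems(2)] by simp
  then obtain e where e: "e \<in># T" "u \<in> e" unfolding mset_deg_eq_0_iff by metis
  obtain v' x y V' T' where 1: "V = insert v' V'" "T = glue v' x y T'" "v' \<notin> V'" "{x, y} \<in># T'" "two_tree e V' T'"
    "v' \<notin> e" "x \<in> V'" "y \<in> V'" "x \<noteq> y" "card V = Suc (card V')"
    by (rule two_tree_leaf_avoiding[OF less.prems(1) facts(2) e(1)])
  have "mset_deg T v' = 2" using 1 outside[OF 1(5,3)] by (auto simp: mset_deg_glue)
  then have "v' = v" using facts(3)[of v'] 1 e by auto
  note 1 = 1[unfolded this]
  have uV': "u \<in> V'" using less.prems 1 by auto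
  have uxy: "u \<noteq> x" "u \<noteq> y" using facts(1) 1 by (auto simp: insert_commute)
  have cV': "3 \<le> card V'"
  proof -
    have "card {u, x, y} \<le> card V'" using uV' 1 chorded_finite[OF two_tree_chorded[OF 1(5)]] by (intro card_mono) auto
    then show ?thesis using uxy 1 by simp
  qed
  \<comment> \<open>Parity forces the next leaf to be \<open>x\<close> or \<open>y\<close>;
    \<open>goal\<close> calls it \<open>x\<close>, and the other case follows by exchanging the
    names.\<close>
  have goal: ?case if x: "V = insert v V'" "T = glue v x y T'" "v \<notin> V'" "{x, y} \<in># T'" "two_tree e V' T'"
    "V' = insert x V0" "T' = glue x y p T0" "x \<notin> V0" "{y, p} \<in># T0" "two_tree e V0 T0" "x \<noteq> y" "u \<noteq> x" "u \<noteq> y"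
    "card V = Suc (card V')" "card V' = Suc (card V0)"
    for x y p V0 T0
  proof -
    have yp: "y \<in> V0" "p \<in> V0" "y \<noteq> p" using chorded_edgeD[OF two_tree_chorded[OF x(10)] x(9)] by auto
    have vn: "v \<noteq> x" "v \<noteq> y" "v \<noteq> p" "v \<notin> V0" "x \<noteq> p" using x yp by auto
    have uV0: "u \<in> V0" using uV' x by auto
    show ?case
    proof (cases "3 \<le> card V0")
      case False
      then have "card V0 = 2" using chorded_card[OF two_tree_chorded[OF x(10)]] by simp
      then have V0: "V0 = e" "T0 = {#e#}" using two_tree_card2[OF x(10)] by auto
      then have ye: "e = {y, p}" using x(9) by auto
      then have up: "u = p" using uV0 V0 x by auto
      have "T = {#{v, x}, {x, y}, {y, v}, {x, u}, {y, u}#}"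
        using x V0 up ye by (simp add: glue_def insert_commute add_mset_commute)
      then show ?thesis using has_flow_K4_minus[of v x y u s] assms(6) vn x yp by auto
    next
      case True
      obtain p' y' q V1 T1 where 2: "V0 = insert p' V1" "T0 = glue p' y' q T1" "p' \<notin> V1" "{y', q} \<in># T1" "two_tree e V1 T1"
        "p' \<notin> e" "y' \<in> V1" "q \<in> V1" "y' \<noteq> q" "card V0 = Suc (card V1)"
        by (rule two_tree_leaf_avoiding[OF x(10) True]) (use two_tree_root[OF x(10)] in auto)
      have p'2: "mset_deg T0 p' = 2" using 2 outside[OF 2(5,3)] by (auto simp: mset_deg_glue)
      have p'n: "p' \<noteq> v" "p' \<noteq> x" "p' \<noteq> u" "p' \<in> V" using 2 vn x e by auto
      have "mset_deg T p' = 2 + 2 * of_bool (p' = y) + of_bool (p' = p)"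
        using p'2 p'n x yp by (auto simp: mset_deg_glue)
      then have "p' = p" using facts(3)[OF p'n(4)] p'n by (auto split: if_splits)
      note 2 = 2[unfolded this]
      have "{p, y} \<in># glue p y' q T1" using x(9) 2(2) by (metis insert_commute)
      from glue_neighbour[OF two_tree_chorded[OF 2(5)] 2(3) this] have "y = y' \<or> y = q" using 2(3,7,8) by metis
      then obtain q' where q': "T0 = glue p y q' T1" "{y, q'} \<in># T1" "q' \<in> V1" "y \<in> V1" "y \<noteq> q'"
        using 2(2,4,7-9) by (metis glue_swap insert_commute)
      \<comment> \<open>The bull with edges \<open>vx\<close>, \<open>xp\<close>,
        \<open>pq'\<close>, \<open>xy\<close>, \<open>py\<close> is replaced by the edge
        \<open>vq'\<close>. Only \<open>y\<close> changes its degree among the remaining vertices,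
        by two, so the shorter two-tree still satisfies the parity hypothesis.\<close>
      define T'' where "T'' = glue v y q' T1"
      have t'': "two_tree e (insert v V1) T''" unfolding T''_def using 2 q' vn by (intro two_tree.attach) auto
      have "has_flow T'' (unit_flux u v s)"
      proof (rule less.hyps[OF _ t''])
        have f: "finite V1" using chorded_finite[OF two_tree_chorded[OF 2(5)]] .
        show "card (insert v V1) < card V" using x 2 f vn by simp
        show "u \<in> insert v V1" using uV0 2 e p'n \<open>p' = p\<close> by auto
        show "\<forall>k\<in>insert v V1. odd (mset_deg (add_mset {u, v} T'') k)"
        proof
        fix k assume k: "k \<in> insert v V1"
        have kn: "k \<noteq> x" "k \<noteq> p" using k vn x 2 p'n \<open>p' = p\<close> by auto
        have "mset_deg (add_mset {u, v} T) k = mset_deg (add_mset {u, v} T'') k + 2 * of_bool (k = y)"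
          using kn vn yp q' x(2,7,11) 2(1) unfolding T''_def by (auto simp: mset_deg_glue)
        moreover have "k \<in> V" using k x(1,6) 2(1) by auto
        ultimately show "odd (mset_deg (add_mset {u, v} T'') k)" using bspec[OF less.prems(5), of k] by simp
        qed
      qed (use less.prems in auto)
      then show ?thesis
        using flow_extends_use[OF flow_extends_bull[of v x p q' y], of T'' "add_mset {v, y} T1" T] x q' vn yp 2
        by (auto simp: T''_def glue_def insert_commute add_mset_commute)
    qed
  qed
  obtain w a b V0 T0 where 2: "V' = insert w V0" "T' = glue w a b T0" "w \<notin> V0" "{a, b} \<in># T0" "two_tree e V0 T0"
    "w \<notin> e" "a \<in> V0" "b \<in> V0" "a \<noteq> b" "card V' = Suc (card V0)"
    by (rule two_tree_leaf_avoiding[OF 1(5) cV']) (use two_tree_root[OF 1(5)] in auto)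
  have "mset_deg T' w = 2" using 2 outside[OF 2(5,3)] by (auto simp: mset_deg_glue)
  moreover have wn: "w \<noteq> v" "w \<noteq> u" "w \<in> V" using 1 2 e by auto
  ultimately have "mset_deg T w = 2 + of_bool (w = x \<or> w = y)" using 1 by (auto simp: mset_deg_glue)
  then have "w = x \<or> w = y" using facts(3)[OF wn(3)] wn by (auto split: if_splits)
  then show ?case
  proof
    assume w: "w = x"
    then have "{w, y} \<in># glue w a b T0" using 1(4) 2(2) by metis
    from glue_neighbour[OF two_tree_chorded[OF 2(5)] 2(3) this] have "y = a \<or> y = b" using 2(3,7,8) by metis
    then obtain p where "T' = glue x y p T0" "{y, p} \<in># T0" using 2(2,4) w by (metis glue_swap insert_commute)
    then show ?thesis using 1 2 w uxy by (intro goal[of x y V0 p T0]) auto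
  next
    assume w: "w = y"
    then have "{w, x} \<in># glue w a b T0" using 1(4) 2(2) by (metis insert_commute)
    from glue_neighbour[OF two_tree_chorded[OF 2(5)] 2(3) this] have "x = a \<or> x = b" using 2(3,7,8) by metis
    then obtain p where "T' = glue y x p T0" "{x, p} \<in># T0" using 2(2,4) w by (metis glue_swap insert_commute)
    then show ?thesis using 1 2 w uxy by (intro goal[of y x V0 p T0]) (auto simp: glue_swap insert_commute)
  qed
qed

text \<open>The hung piece can be filled with net outflow zero over a flow of \<open>F\<close>. If
  \<open>F\<close> is exceptional, it is not a single edge, for then \<open>G\<close> would be
  \<open>K4\<close>. So \<open>F\<close> is a two-tree with a chord, and the hung piece either
  passes a vector of length \<open>sqrt 3\<close> or is kept while a bull of \<open>F\<close> is
  removed.\<close>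

lemma hang_reduce:
  fixes a :: 'v
  assumes below: "flows_below TYPE('v) (size G)" and G: "G = hang a b x y F" and F: "chorded V F" "{x, y} \<in># F"
    and ab: "a \<notin> V" "b \<notin> V" "a \<noteq> b" and nexc: "\<not> exceptional (insert b (insert a V)) G"
  shows "has_flow G (\<lambda>_. 0)"
proof (cases "exceptional V F")
  case False
  then have "has_flow F (\<lambda>_. 0)" using flows_belowD[OF below _ F(1)] G by simp
  then show ?thesis unfolding G using ab chorded_edgeD[OF F] by (intro has_flow_hang) auto
next
  case True
  have xy: "x \<in> V" "y \<in> V" "x \<noteq> y" using chorded_edgeD[OF F] by auto
  have abn: "a \<noteq> x" "a \<noteq> y" "b \<noteq> x" "b \<noteq> y" using ab xy by auto
  from F(1) True show ?thesis
  proof (cases rule: exceptional_cases)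
    case (edge c d)
    then have "{x, y} = {c, d}" using F by auto
    then have F': "F = {#{x, y}#}" "V = {x, y}" using edge by auto
    have "exceptional (insert b (insert a V)) G" unfolding exceptional_def G F' hang_def
      using ab abn xy by (auto simp: mset_deg_glue)
    then show ?thesis using nexc by blast
  next
    case (tree r T c d)
    have odd: "\<forall>v\<in>V. odd (mset_deg (add_mset {c, d} T) v)" using True tree by (auto simp: exceptional_def)
    show ?thesis
    proof (cases "{x, y} \<in># T")
      case False
      \<comment> \<open>The chord is \<open>xy\<close> itself: the edge \<open>xy\<close>, the
        two-tree \<open>T\<close> and the hung piece carry \<open>1\<close>, \<open>s\<close> and
        \<open>cnj s\<close> from \<open>x\<close> to \<open>y\<close>.\<close>
      then have cd: "{c, d} = {x, y}" using F tree by auto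
      then have "c = x \<and> d = y \<or> c = y \<and> d = x" by (auto simp: doubleton_eq_iff)
      then have odd': "\<forall>v\<in>V. odd (mset_deg (add_mset {x, y} T) v)" using odd cd by simp
      define s where "s = Complex (-1/2) (sqrt 11 / 2)"
      have s: "cmod s = sqrt 3" "cmod (cnj s) = sqrt 3"
        using sqrt11 by (simp_all add: s_def cmod_def power_divide)
      have sum: "s + cnj s = - 1" by (simp add: s_def complex_eq_iff)
      have "has_flow T (unit_flux x y s)" using odd_chord_flux[OF tree(1) xy odd' s(1)] .
      then have "has_flow F (\<lambda>w. unit_flux x y s w + unit_flux x y 1 w)"
        unfolding tree(2) cd using xy by (rule_tac has_flow.add) auto
      then have "has_flow G (\<lambda>w. unit_flux x y (cnj s) w + (unit_flux x y s w + unit_flux x y 1 w))"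
        unfolding G using ab abn s by (rule_tac has_flow_hang_flux) auto
      moreover have "unit_flux x y (cnj s) w + (unit_flux x y s w + unit_flux x y 1 w) = 0" for w
      proof -
        have "unit_flux x y (cnj s) w + (unit_flux x y s w + unit_flux x y 1 w) = unit_flux x y (s + cnj s + 1) w"
          by (simp add: unit_flux_def algebra_simps)
        then show ?thesis by (simp add: sum unit_flux_def)
      qed
      ultimately show ?thesis by (rule has_flow_cong)
    next
      case xyT: True
      have T: "two_tree {x, y} V T" using two_tree_reroot[OF tree(1) xyT] .
      from T tree(3-5) odd show ?thesis
      proof (cases rule: odd_chord_shape)
        case (small a' b')
        then show ?thesis unfolding G tree(2) small(3) using has_flow_two_K4[of x y a b a' b'] xy ab abn small by auto
      next
        case (bull T0 V0 x' y' p w z)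
        have yp: "y' \<in> V0" "p \<in> V0" "y' \<noteq> p" using chorded_edgeD[OF two_tree_chorded[OF bull(1)] bull(2)] by auto
        \<comment> \<open>The bull at \<open>x'\<close> and \<open>w\<close> becomes the edge
          \<open>pz\<close>. With \<open>ab\<close> and \<open>pz\<close> there are two chords, too
          many for an exceptional graph.\<close>
        define H where "H = hang a b x y (add_mset {p, z} T0)"
        have "{x, y} \<in># T0" using two_tree_root[OF bull(1)] by simp
        then have cH: "chorded (insert b (insert a V0)) H" unfolding H_def using bull ab yp
          by (intro chorded_hang chorded.chord two_tree_chorded) auto
        have fin: "finite V0" using chorded_finite[OF two_tree_chorded[OF bull(1)]] .
        have "\<not> exceptional (insert b (insert a V0)) H" using ab bull(11) fin two_tree_size[OF bull(1)]
          by (simp add: exceptional_def H_def)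
        then have "has_flow H (\<lambda>_. 0)" using flows_belowD[OF below _ cH] G tree bull by (simp add: H_def)
        moreover have "p \<noteq> x'" "x' \<noteq> w" "w \<noteq> z" "x' \<noteq> y'" "w \<noteq> y'" using bull yp by auto
        ultimately show ?thesis
          using flow_extends_use[OF flow_extends_bull[of p x' w z y'], of H "hang a b x y T0" G]
          unfolding G tree(2) H_def bull(9,10) hang_alt
          by (simp add: glue_def insert_commute add_mset_commute)
      qed
    qed
  qed
qed

text \<open>Here the twins cannot be traded for the edge \<open>z1 z2\<close>, since
  \<open>T\<close> with that chord is exceptional. Its own end, seen from \<open>xy\<close>, shows
  that \<open>G\<close> is two copies of \<open>K4\<close> sharing \<open>xy\<close>, or that a bull
  at two vertices of \<open>T\<close> can be removed.\<close>

lemma twins_reduce: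
  fixes w1 :: 'v
  assumes below: "flows_below TYPE('v) (size G)"
    and G: "G = add_mset {w1, z1} (add_mset {w2, z2} (glue w2 x y (glue w1 x y T)))"
    and T: "two_tree r V T" "{x, y} \<in># T" and w: "w1 \<notin> V" "w2 \<notin> V" "w1 \<noteq> w2"
    and z: "z1 \<in> V" "z2 \<in> V" "z1 \<noteq> z2" "z1 \<notin> {x, y}" "z2 \<notin> {x, y}"
    and odd: "\<forall>v\<in>V. odd (mset_deg (add_mset {z1, z2} T) v)"
  shows "has_flow G (\<lambda>_. 0)"
proof -
  have xy: "x \<in> V" "y \<in> V" "x \<noteq> y" using chorded_edgeD[OF two_tree_chorded T(2)] T by auto
  have T': "two_tree {x, y} V T" using two_tree_reroot T by metis
  from T' z(1-3) odd show ?thesis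
  proof (cases rule: odd_chord_shape)
    case (small a b)
    have zab: "{z1, z2} = {a, b}" using small z by auto
    have card: "z1 \<noteq> w1" "z1 \<noteq> w2" "z2 \<noteq> w1" "z2 \<noteq> w2" "w1 \<noteq> x" "w1 \<noteq> y" "w2 \<noteq> x" "w2 \<noteq> y"
      using w z xy by auto
    have "add_mset {z1, z2} T = add_mset {z1, z2} (glue z2 x y (glue z1 x y {#{x, y}#}))"
      using small(3) zab hang_swap(1) unfolding hang_def by (metis doubleton_eq_iff)
    then have "T = glue z2 x y (glue z1 x y {#{x, y}#})" by simp
    then have "G = hang w1 z1 x y (hang w2 z2 x y {#{x, y}#})"
      unfolding G by (simp add: hang_def glue_def insert_commute add_mset_commute)
    then show ?thesis using has_flow_two_K4[of x y w1 z1 w2 z2] xy card z by auto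
  next
    case (bull T0 V0 x' y' p u z)
    have yp: "y' \<in> V0" "p \<in> V0" "y' \<noteq> p" using chorded_edgeD[OF two_tree_chorded[OF bull(1)] bull(2)] by auto
    have goal: ?thesis if G: "G = add_mset {w1, u} (add_mset {w2, z} (glue w2 x y (glue w1 x y T)))"
       and w: "w1 \<notin> V" "w2 \<notin> V" "w1 \<noteq> w2" for w1 w2
    proof -
      \<comment> \<open>In \<open>G\<close> the leaf \<open>u\<close> of \<open>T\<close> has its
        third edge to \<open>w1\<close>, where the chord would have led to \<open>z\<close>. So the
        bull at \<open>x'\<close> and \<open>u\<close> is replaced by \<open>p w1\<close>, and the
        chords \<open>p w1\<close> and \<open>w2 z\<close> remain.\<close>
      define H where "H = add_mset {p, w1} (add_mset {w2, z} (glue w2 x y (glue w1 x y T0)))"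
      have "{x, y} \<in># T0" using two_tree_root[OF bull(1)] by simp
      moreover have wn: "w1 \<notin> V0" "w2 \<notin> V0" "p \<noteq> w1" "w2 \<noteq> z" using w bull(11) yp bull by auto
      ultimately have cH: "chorded (insert w2 (insert w1 V0)) H" unfolding H_def using bull w yp
        by (intro chorded.chord chorded.attach two_tree_chorded) auto
      have fin: "finite V0" using chorded_finite[OF two_tree_chorded[OF bull(1)]] .
      have "\<not> exceptional (insert w2 (insert w1 V0)) H" using w wn fin two_tree_size[OF bull(1)]
        by (simp add: exceptional_def H_def)
      then have "has_flow H (\<lambda>_. 0)" using flows_belowD[OF below _ cH] G bull by (simp add: H_def)
      moreover have "p \<noteq> x'" "x' \<noteq> u" "u \<noteq> w1" "x' \<noteq> y'" "u \<noteq> y'" using bull yp w by auto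
      ultimately show ?thesis
        using flow_extends_use[OF flow_extends_bull[of p x' u w1 y'], of H "add_mset {w2, z} (glue w2 x y (glue w1 x y T0))" G]
        unfolding G H_def bull(10)
        by (simp add: glue_def insert_commute add_mset_commute)
    qed
    from bull(9) have "z1 = u \<and> z2 = z \<or> z1 = z \<and> z2 = u" by (simp add: doubleton_eq_iff)
    then show ?thesis
    proof
      assume "z1 = u \<and> z2 = z"
      then show ?thesis using goal[of w1 w2] G w by simp
    next
      assume "z1 = z \<and> z2 = u"
      then show ?thesis using goal[of w2 w1] G w by (simp add: glue_commute add_mset_commute)
    qed
  qed
qed

section \<open>Existence of flows\<close>

lemma pairs_Int:
  assumes "pairs A N" "pairs B N" shows "pairs (A \<inter> B) N"
  unfolding pairs_def
proof
  fix e assume "e \<in># N"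
  obtain a b where 1: "e = {a, b}" "a \<in> A" "b \<in> A" "a \<noteq> b" using assms(1) \<open>e \<in># N\<close> unfolding pairs_def by metis
  obtain c d where 2: "e = {c, d}" "c \<in> B" "d \<in> B" using assms(2) \<open>e \<in># N\<close> unfolding pairs_def by metis
  have "a \<in> B \<and> b \<in> B" using 1 2 by (metis doubleton_eq_iff)
  then show "\<exists>a b. e = {a, b} \<and> a \<in> A \<inter> B \<and> b \<in> A \<inter> B \<and> a \<noteq> b" using 1 by blast
qed

lemma two_leaves_extras:
  assumes "N = add_mset {w2, z2} N2" "N = add_mset {w1, z1} N1" "{w1, z1} \<noteq> {w2, z2}"
    "pairs (insert w1 V) N2" "pairs (insert w2 V) N1" "w1 \<noteq> w2"
  obtains N3 where "N = add_mset {w1, z1} (add_mset {w2, z2} N3)" "pairs V N3"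
proof -
  have "add_mset {w2, z2} N2 = add_mset {w1, z1} N1" using assms(1,2) by metis
  then have "\<exists>K. N2 = add_mset {w1, z1} K \<and> N1 = add_mset {w2, z2} K"
    unfolding add_eq_conv_ex using assms(3) by (elim disjE conjE) simp_all
  then obtain N3 where N3: "N2 = add_mset {w1, z1} N3" "N1 = add_mset {w2, z2} N3" by (elim exE conjE)
  have "pairs (insert w1 V \<inter> insert w2 V) N3" using assms(4,5) N3 by (intro pairs_Int) auto
  then have "pairs V N3" by (rule pairs_mono) (use assms(6) in auto)
  then show ?thesis using that N3 assms(2) by simp
qed

text \<open>The vector arriving at \<open>w\<close> from \<open>z\<close> reaches \<open>a\<close>
  in two unit parts, one along \<open>wa\<close> and one along \<open>wb\<close> and
  \<open>ba\<close>.\<close>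

lemma flow_extends_chord:
  assumes "w \<noteq> z" "w \<noteq> a" "w \<noteq> b" "a \<noteq> b"
  shows "flow_extends {#{z, a}#} {#{w, z}, {w, a}, {w, b}, {a, b}#}"
  unfolding flow_extends_def
proof (intro allI impI)
  fix \<beta> :: "'a \<Rightarrow> complex" assume 0: "has_flow {#{z, a}#} \<beta>"
  have "has_flow {#{w, z}, {w, a}#} \<beta>"
    by (rule flow_extends_use[OF flow_extends_lift[OF assms(1,2)] _ _ 0, of "{#}"]) auto
  then have "has_flow {#{w, z}, {w, a}, {w, a}#} \<beta>"
    by (rule_tac flow_extends_use[OF flow_extends_double[of w a], of "{#{w, z}, {w, a}#}" "{#{w, z}#}"]) auto
  then show "has_flow {#{w, z}, {w, a}, {w, b}, {a, b}#} \<beta>"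
    using assms by (rule_tac flow_extends_use[OF flow_extends_lift[of b w a], of "{#{w, z}, {w, a}, {w, a}#}" "{#{w, z}, {w, a}#}"])
      (auto simp: insert_commute add_mset_commute)
qed

lemma multi_edge_flow:
  assumes "\<forall>e\<in>#E. e = {a, b}" "a \<noteq> b" "2 \<le> size E" shows "has_flow E (\<lambda>_. 0)"
  using assms(1,3)
proof (induction E)
  case empty
  then show ?case by simp
next
  case (add e E)
  have e: "e = {a, b}" using add.prems by simp
  have "E \<noteq> {#}" using add.prems by auto
  then obtain f E' where "E = add_mset f E'" by (metis multiset_cases)
  then have E': "E = add_mset {a, b} E'" using add.prems by auto
  show ?case
  proof (cases "E' = {#}")
    case True
    then show ?thesis
      using flow_extends_use[OF flow_extends_digon[OF assms(2)], of "{#}" "{#}"] has_flow.empty E' e by auto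
  next
    case False
    then have "2 \<le> size E" using E' by (metis One_nat_def Suc_1 Suc_le_mono Suc_leI nonempty_has_size size_add_mset)
    then have "has_flow E (\<lambda>_. 0)" using add by simp
    then show ?thesis using flow_extends_use[OF flow_extends_double[of a b], of E E' "add_mset e E"] E' e by auto
  qed
qed

section \<open>Ends that a minimal counterexample cannot have\<close>

context
  fixes V :: "'v set" and E :: "'v set multiset"
  assumes below: "flows_below TYPE('v) (size E)" and nexc: "\<not> exceptional V E" and nf: "\<not> has_flow E (\<lambda>_. 0)"
begin

lemma no_chord_end:
  assumes V: "V = insert w V0" and E: "E = glue w a b (add_mset {a, b} C) + N" and N: "pairs V N"
    and C: "chorded V0 C" "a \<in> V0" "b \<in> V0" "a \<noteq> b" "w \<notin> V0"
  shows False
proof -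
  have "chorded V0 (add_mset {a, b} C)" using C by (auto intro: chorded.chord)
  from leaf_reduce[OF below E this _ C(5) _ nf] obtain z N0 where
    z: "N = add_mset {w, z} N0" "pairs V0 N0" "z \<in> V0" "z \<noteq> a" "z \<noteq> b" using N V by auto
  have wn: "w \<noteq> z" "w \<noteq> a" "w \<noteq> b" using C z by auto
  \<comment> \<open>the triangle \<open>wab\<close> can send the vector arriving from \<open>z\<close> to either end of the chord\<close>
  define H where "H u = add_mset {z, u} (C + N0)" for u
  have cH: "chorded V0 (H a)" "chorded V0 (H b)" unfolding H_def using C z by (auto intro!: chorded.chord chorded_plus)
  have "mset_deg (H a) a = Suc (mset_deg (H b) a)" using z C unfolding H_def by auto
  then have "\<not> exceptional V0 (H a) \<or> \<not> exceptional V0 (H b)" unfolding exceptional_def using C by (metis even_Suc)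
  then have "has_flow (H a) (\<lambda>_. 0) \<or> has_flow (H b) (\<lambda>_. 0)"
    using flows_belowD[OF below _ cH(1)] flows_belowD[OF below _ cH(2)] E z by (auto simp: H_def)
  then have "has_flow E (\<lambda>_. 0)"
  proof
    assume "has_flow (H a) (\<lambda>_. 0)"
    then show ?thesis using flow_extends_use[OF flow_extends_chord[of w z a b], of "H a" "C + N0" E] wn C E z
      by (simp add: H_def glue_def add_mset_commute)
  next
    assume "has_flow (H b) (\<lambda>_. 0)"
    then show ?thesis using flow_extends_use[OF flow_extends_chord[of w z b a], of "H b" "C + N0" E] wn C E z
      by (simp add: H_def glue_def add_mset_commute insert_commute)
  qed
  with nf show False by blast
qed

text \<open>Each twin has exactly one extra edge. If it joins the twins, they form a
  \<open>hang\<close>; if both extra edges meet in one vertex, they are split off there; otherwise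
  the twins pass the vector of a new edge \<open>z1 z2\<close>, and \<open>twins_reduce\<close>
  takes over when that edge makes the rest exceptional.\<close>

lemma no_twins_end:
  assumes V: "V = insert w2 (insert w1 V0)" and E: "E = glue w2 x y (glue w1 x y C) + N" and N: "pairs V N"
    and C: "chorded V0 C" "{x, y} \<in># C" and w: "w1 \<notin> V0" "w2 \<notin> V0" "w1 \<noteq> w2"
  shows False
proof -
  note xy = chorded_edgeD[OF C] and fin = chorded_finite[OF C(1)]
  obtain z2 N2 where 2: "N = add_mset {w2, z2} N2" "pairs (insert w1 V0) N2" "z2 \<in> insert w1 V0" "z2 \<noteq> x" "z2 \<noteq> y"
    using leaf_reduce[OF below E chorded.attach[OF C w(1)] _ _ _ nf] C w N V by auto
  have "E = glue w1 x y (glue w2 x y C) + N" using E glue_commute by metis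
  from leaf_reduce[OF below this chorded.attach[OF C w(2)] _ _ _ nf] obtain z1 N1 where
    1: "N = add_mset {w1, z1} N1" "pairs (insert w2 V0) N1" "z1 \<in> insert w2 V0" "z1 \<noteq> x" "z1 \<noteq> y"
    using C w N V by (auto simp: insert_commute)
  have "mset_deg N w1 = 1" using mset_deg_outside[OF 1(2), of w1] w unfolding 1(1) by auto
  moreover have "mset_deg N w2 = 1" using mset_deg_outside[OF 2(2), of w2] w unfolding 2(1) by auto
  ultimately have d: "mset_deg N w1 = 1" "mset_deg N w2 = 1" by auto
  show False
  proof (cases "z2 = w1")
    case True
    then have "mset_deg N2 w1 = 0" using d 2 by simp
    then have "pairs V0 N2" using 2 pairs_shrink by metis
    then have c: "chorded V0 (C + N2)" using C chorded_plus by metis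
    have "E = hang w1 w2 x y (C + N2)" using E 2 True by (simp add: hang_def glue_plus insert_commute)
    from hang_reduce[OF below this c _ w] nexc nf V C show False by auto
  next
    case False
    then have z2: "z2 \<in> V0" using 2 by auto
    have ne: "{w1, z1} \<noteq> {w2, z2}"
    proof
      assume "{w1, z1} = {w2, z2}"
      then show False using False w z2 by (auto simp: doubleton_eq_iff)
    qed
    obtain N3 where N3: "N = add_mset {w1, z1} (add_mset {w2, z2} N3)" "pairs V0 N3"
      using two_leaves_extras[OF 2(1) 1(1) ne 2(2) 1(2) w(3)] by metis
    have "z1 \<noteq> w2" using d N3 w by auto
    then have z1: "z1 \<in> V0" using 1 by auto
    have c0: "2 * card V0 \<le> size C + 3" using chorded_size C by metis
    have cV: "card V = card V0 + 2" using V w fin by simp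
    have sE: "size E = size C + 6 + size N3" using E N3 by simp
    show False
    proof (cases "z1 = z2")
      case True
      \<comment> \<open>With only two chords, \<open>C\<close> is a two-tree and has an even vertex.
        It stays even in \<open>E\<close>, because outside the twins all degrees change by two or
        not at all.\<close>
      have "2 * card V \<le> size E \<or> (\<exists>v\<in>V. even (mset_deg E v))"
      proof (cases "2 * card V \<le> size E")
        case False
        then have s: "size N3 = 0" "size C + 3 \<le> 2 * card V0" using c0 cV sE by linarith+
        then obtain r where r: "two_tree r V0 C" using chorded_two_tree C by metis
        have "card {x, y, z1} \<le> card V0" using xy z1 fin by (intro card_mono) auto
        then have "3 \<le> card V0" using xy 1 by simp
        from two_tree_some_even[OF r this] obtain v where v: "v \<in> V0" "even (mset_deg C v)" by metis
        have "v \<noteq> w1" "v \<noteq> w2" using v w by auto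
        then have "mset_deg E v = mset_deg C v + 2 * of_bool (v = x) + 2 * of_bool (v = y) + 2 * of_bool (v = z1)"
          using E N3 s True by (simp add: mset_deg_glue)
        then show ?thesis using v V by (intro disjI2 bexI[of _ v]) auto
      qed simp
      moreover have "chorded V (glue w2 x y (glue w1 x y C))" unfolding V using C w by (intro chorded.attach) auto
      moreover have "N = add_mset {z1, w1} (add_mset {z1, w2} N3)" using N3 True by (simp add: insert_commute)
      ultimately show False using lift_reduce[OF below _ E _ N] nf by metis
    next
      case zz: False
      define H where "H = add_mset {z1, z2} (C + N3)"
      have cH: "chorded V0 H" unfolding H_def using C z1 z2 zz N3 by (intro chorded.chord chorded_plus) auto
      show False
      proof (cases "exceptional V0 H")
        case False
        then have "has_flow H (\<lambda>_. 0)" using flows_belowD[OF below _ cH] sE by (simp add: H_def)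
        moreover have "z1 \<noteq> w1" "z2 \<noteq> w2" "w1 \<noteq> x" "w1 \<noteq> y" "w2 \<noteq> x" "w2 \<noteq> y" using w xy z1 z2 by auto
        ultimately have "has_flow E (\<lambda>_. 0)"
          using flow_extends_use[OF flow_extends_twins[of z1 w1 z2 w2 x y], of H "C + N3" E] E N3
          by (simp add: H_def glue_def insert_commute add_mset_commute)
        with nf show False by blast
      next
        case True
        then have "size C + 1 + size N3 + 2 \<le> 2 * card V0" by (simp add: exceptional_def H_def)
        then have "size N3 = 0" "size C + 3 \<le> 2 * card V0" using c0 by linarith+
        then obtain r where r: "two_tree r V0 C" and N30: "N3 = {#}" using chorded_two_tree C by auto
        have "E = add_mset {w1, z1} (add_mset {w2, z2} (glue w2 x y (glue w1 x y C)))" using E N3 N30 by simp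
        from twins_reduce[OF below this r C(2) w z1 z2 zz] True 1 2 nf show False
          by (auto simp: exceptional_def H_def N30)
      qed
    qed
  qed
qed

text \<open>The leaf \<open>w\<close> has one extra edge, so the extra edges at \<open>x\<close>
  decide. With none, \<open>x\<close> and \<open>w\<close> are a bull, or a \<open>hang\<close> if
  \<open>z = p\<close>; with one, \<open>x\<close> is split off or a parallel edge is treated; two
  are split off.\<close>

lemma no_tail_end:
  assumes V: "V = insert w (insert x V0)" and E: "E = glue w x y (glue x y p C) + N" and N: "pairs V N"
    and C: "chorded V0 C" "{y, p} \<in># C" and w: "x \<notin> V0" "w \<notin> V0" "x \<noteq> w"
  shows False
proof -
  note yp = chorded_edgeD[OF C] and fin = chorded_finite[OF C(1)]
  obtain z N1 where 1: "N = add_mset {w, z} N1" "pairs (insert x V0) N1" "z \<in> insert x V0" "z \<noteq> x" "z \<noteq> y"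
    using leaf_reduce[OF below E chorded.attach[OF C w(1)] _ _ _ nf] C w N V by auto
  then have z: "z \<in> V0" by auto
  have ne: "w \<noteq> z" "w \<noteq> y" "w \<noteq> p" "x \<noteq> y" "x \<noteq> p" "x \<noteq> z" using w z yp by auto
  have c0: "2 * card V0 \<le> size C + 3" using chorded_size C by metis
  have cV: "card V = card V0 + 2" using V w fin by simp
  have sE: "size E = size C + 5 + size N1" using E 1 by simp
  have dC: "mset_deg C x = 0" "mset_deg C w = 0" using C w chorded_pairs mset_deg_outside by metis+
  have dN: "mset_deg N1 w = 0" using 1 w mset_deg_outside by (metis insertE)
  show False
  proof (cases "mset_deg N1 x = 0")
    case True
    then have N1: "pairs V0 N1" using 1 pairs_shrink by metis
    then have c: "chorded V0 (C + N1)" using C chorded_plus by metis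
    show False
    proof (cases "z = p")
      case zp: True
      have "E = hang x w y p (C + N1)" using E 1 zp
        by (simp add: hang_def glue_def insert_commute add_mset_commute)
      from hang_reduce[OF below this c _ w] nexc nf V C show False by auto
    next
      case zp: False
      define H where "H = add_mset {p, z} (C + N1)"
      have cH: "chorded V0 H" unfolding H_def using c yp z zp by (rule_tac chorded.chord) auto
      \<comment> \<open>Inserting the bull keeps the parities in \<open>V0\<close>, gives
        \<open>x\<close> and \<open>w\<close> degree three and uses as many edges as two
        attachments, so an exceptional \<open>H\<close> would make \<open>E\<close>
        exceptional.\<close>
      have "\<not> exceptional V0 H"
      proof
        assume e: "exceptional V0 H"
        have "odd (mset_deg E v)" if "v \<in> V" for v
        proof (cases "v \<in> V0")
          case True
          then have "v \<noteq> x" "v \<noteq> w" using w by auto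
          then have "mset_deg E v = mset_deg H v + 2 * of_bool (v = y)"
            using ne zp 1 yp unfolding E H_def by (auto simp: mset_deg_glue)
          then show ?thesis using e True by (simp add: exceptional_def)
        next
          case False
          then have "v = x \<or> v = w" using that V by auto
          then show ?thesis using ne w dC dN True 1 unfolding E by (auto simp: mset_deg_glue)
        qed
        then have "exceptional V E" using e sE cV unfolding exceptional_def H_def by auto
        with nexc show False by blast
      qed
      then have "has_flow H (\<lambda>_. 0)" using flows_belowD[OF below _ cH] sE by (simp add: H_def)
      then have "has_flow E (\<lambda>_. 0)"
        using flow_extends_use[OF flow_extends_bull[of p x w z y], of H "C + N1" E] E 1 ne w
        by (simp add: H_def glue_def insert_commute add_mset_commute)
      with nf show False by blast
    qed
  next
    case False
    then obtain z' N2 where 2: "N1 = add_mset {x, z'} N2" "z' \<in> insert x V0" "z' \<noteq> x"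
      using pairs_extract[OF 1(2), of x] by metis
    then have z': "z' \<in> V0" by auto
    show False
    proof (cases "mset_deg N2 x = 0")
      case False
      moreover have "pairs (insert x V0) N2" using 1(2) unfolding 2(1) by simp
      ultimately obtain z'' N3 where 3: "N2 = add_mset {x, z''} N3" by (metis pairs_extract)
      have "chorded V (glue w x y (glue x y p C))" unfolding V using C w by (intro chorded.attach) auto
      moreover have "N = add_mset {x, z'} (add_mset {x, z''} (add_mset {w, z} N3))"
        using 1(1) 2(1) 3 by (simp add: add_mset_commute)
      moreover have "2 * card V \<le> size E" using c0 cV sE 2(1) 3 by simp
      ultimately show False using lift_reduce[OF below _ E _ N] nf by metis
    next
      case True
      then have N2: "pairs V0 N2" using 1(2) 2 pairs_shrink by auto
      have c1: "chorded (insert w V0) (add_mset {w, z} (glue w y p C + N2))"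
        using C w z ne N2 by (intro chorded.chord chorded_plus chorded.attach) (auto intro: pairs_mono)
      show False
      proof (cases "z' = y")
        case False
        \<comment> \<open>All four edges at \<open>x\<close> are split off, in the pairs
          \<open>xw\<close>, \<open>xp\<close> and \<open>xy\<close>, \<open>xz'\<close>. The chords
          \<open>yz'\<close> and \<open>wz\<close> prevent \<open>H\<close> from being
          exceptional.\<close>
        define H where "H = add_mset {y, z'} (add_mset {w, z} (glue w y p C + N2))"
        have cH: "chorded (insert w V0) H" unfolding H_def using c1 yp z' False by (rule_tac chorded.chord) auto
        have "\<not> exceptional (insert w V0) H" using fin w c0 by (simp add: exceptional_def H_def)
        then have "has_flow H (\<lambda>_. 0)" using flows_belowD[OF below _ cH] sE 2 by (simp add: H_def)
        then have "has_flow (add_mset {x, w} (add_mset {x, p} (add_mset {y, z'} (add_mset {w, z} (add_mset {w, y} (C + N2)))))) (\<lambda>_. 0)"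
          using flow_extends_use[OF flow_extends_lift[of x w p], of H "add_mset {y, z'} (add_mset {w, z} (add_mset {w, y} (C + N2)))"] ne w
          by (simp add: H_def glue_def add_mset_commute)
        then have "has_flow E (\<lambda>_. 0)"
          using flow_extends_use[OF flow_extends_lift[of x y z'], of _ "add_mset {x, w} (add_mset {x, p} (add_mset {w, z} (add_mset {w, y} (C + N2))))" E] ne 2 E 1
          by (simp add: glue_def insert_commute add_mset_commute)
        with nf show False by blast
      next
        case zy: True
        \<comment> \<open>\<open>H1\<close> lacks one of the two parallel edges \<open>xy\<close>;
          \<open>H2\<close> lacks both and has \<open>x\<close> split off between \<open>w\<close>
          and \<open>p\<close>. The degrees of \<open>y\<close> differ by one, so they are not both
          exceptional.\<close>
        define H1 where "H1 = glue w x y (glue x y p C) + add_mset {w, z} N2"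
        define H2 where "H2 = add_mset {w, z} (glue w y p C + N2)"
        have cH1: "chorded V H1" unfolding H1_def V using C w z ne N2
          by (intro chorded_plus chorded.attach) (auto intro: pairs_mono)
        have "mset_deg H1 y = Suc (mset_deg H2 y)" unfolding H1_def H2_def using ne yp by (auto simp: mset_deg_glue)
        then have "\<not> exceptional V H1 \<or> \<not> exceptional (insert w V0) H2" unfolding exceptional_def using yp V by (metis even_Suc insertCI)
        then have "has_flow E (\<lambda>_. 0)"
        proof
          assume "\<not> exceptional V H1"
          then have "has_flow H1 (\<lambda>_. 0)" using flows_belowD[OF below _ cH1] sE 2 by (simp add: H1_def)
          then show ?thesis
            using flow_extends_use[OF flow_extends_double[of x y], of H1 "add_mset {w, x} (add_mset {w, y} (add_mset {x, p} (add_mset {w, z} (C + N2))))" E] E 1 2 zy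
            by (simp add: H1_def glue_def insert_commute add_mset_commute)
        next
          assume "\<not> exceptional (insert w V0) H2"
          then have "has_flow H2 (\<lambda>_. 0)" using flows_belowD[OF below, of H2] c1 sE 2 by (simp add: H2_def)
          then have "has_flow (add_mset {x, w} (add_mset {x, p} (add_mset {w, z} (add_mset {w, y} (C + N2))))) (\<lambda>_. 0)"
            using flow_extends_use[OF flow_extends_lift[of x w p], of H2 "add_mset {w, z} (add_mset {w, y} (C + N2))"] ne w
            by (simp add: H2_def glue_def add_mset_commute)
          then show ?thesis
            using flow_extends_use[OF flow_extends_digon[of x y] _ _, of _ "add_mset {x, w} (add_mset {x, p} (add_mset {w, z} (add_mset {w, y} (C + N2))))" E] ne 2 E 1 zy
            by (simp add: glue_def insert_commute add_mset_commute)
        qed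
        with nf show False by blast
      qed
    qed
  qed
qed

text \<open>If the leaves are adjacent, they form a bull over \<open>x\<close> whose removal doubles
  \<open>yp\<close>, which is never exceptional. Otherwise they contribute two chords, and so much
  room is left that only the number of extra edges at \<open>x\<close> matters.\<close>

lemma no_fork_end:
  assumes V: "V = insert w2 (insert w1 (insert x V0))" and E: "E = glue w2 x p (glue w1 x y (glue x y p C)) + N"
    and N: "pairs V N" and C: "chorded V0 C" "{y, p} \<in># C"
    and w: "x \<notin> V0" "w1 \<notin> V0" "w2 \<notin> V0" "x \<noteq> w1" "x \<noteq> w2" "w1 \<noteq> w2"
  shows False
proof -
  note yp = chorded_edgeD[OF C] and fin = chorded_finite[OF C(1)]
  note c1 = chorded.attach[OF C w(1)]
  have c2: "chorded (insert w1 (insert x V0)) (glue w1 x y (glue x y p C))" "chorded (insert w2 (insert x V0)) (glue w2 x p (glue x y p C))"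
    using w by (auto intro!: chorded.attach[OF c1])
  obtain z2 N2 where 2: "N = add_mset {w2, z2} N2" "pairs (insert w1 (insert x V0)) N2" "z2 \<in> insert w1 (insert x V0)" "z2 \<noteq> x" "z2 \<noteq> p"
    using leaf_reduce[OF below E c2(1) _ _ _ nf] w N V by auto
  have "E = glue w1 x y (glue w2 x p (glue x y p C)) + N" using E glue_commute by metis
  from leaf_reduce[OF below this c2(2) _ _ _ nf] obtain z1 N1 where
    1: "N = add_mset {w1, z1} N1" "pairs (insert w2 (insert x V0)) N1" "z1 \<in> insert w2 (insert x V0)" "z1 \<noteq> x" "z1 \<noteq> y"
    using w N V by (auto simp: insert_commute)
  have "mset_deg N w1 = 1" using mset_deg_outside[OF 1(2), of w1] w unfolding 1(1) by auto
  moreover have "mset_deg N w2 = 1" using mset_deg_outside[OF 2(2), of w2] w unfolding 2(1) by auto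
  ultimately have d: "mset_deg N w1 = 1" "mset_deg N w2 = 1" by auto
  show False
  proof (cases "z2 = w1")
    case True
    then have "mset_deg N2 w1 = 0" using d 2 by simp
    then have N2: "pairs (insert x V0) N2" using 2 pairs_shrink by metis
    define H where "H = add_mset {y, p} (glue x y p C) + N2"
    have yp1: "{y, p} \<in># glue x y p C" using C by simp
    have cH: "chorded (insert x V0) H" unfolding H_def using c1 yp N2 by (intro chorded_plus chorded.chord) auto
    have "\<not> exceptional (insert x V0) H" unfolding H_def by (rule doubled_edge_not_exceptional[OF c1 yp1])
    then have "has_flow H (\<lambda>_. 0)" using flows_belowD[OF below _ cH] E 2 by (simp add: H_def)
    moreover have "y \<noteq> w1" "w1 \<noteq> w2" "w2 \<noteq> p" "w1 \<noteq> x" "w2 \<noteq> x" using yp w by auto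
    ultimately have "has_flow E (\<lambda>_. 0)"
      using flow_extends_use[OF flow_extends_bull[of y w1 w2 p x], of H "glue x y p C + N2" E] E 2 True
      by (simp add: H_def glue_def insert_commute add_mset_commute)
    with nf show False by blast
  next
    case False
    then have z2: "z2 \<in> V0" using 2 by auto
    have ne: "{w1, z1} \<noteq> {w2, z2}"
    proof
      assume "{w1, z1} = {w2, z2}"
      then show False using False w z2 by (auto simp: doubleton_eq_iff)
    qed
    obtain N3 where N3: "N = add_mset {w1, z1} (add_mset {w2, z2} N3)" "pairs (insert x V0) N3"
      using two_leaves_extras[OF 2(1) 1(1) ne 2(2) 1(2) w(6)] by metis
    have "z1 \<noteq> w2" using d N3 w by auto
    then have z1: "z1 \<in> V0" using 1 by auto
    have c0: "2 * card V0 \<le> size C + 3" using chorded_size C by metis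
    have cV: "card V = card V0 + 3" using V w fin by simp
    have sE: "size E = size C + 8 + size N3" using E N3 by simp
    have cE: "chorded V (glue w2 x p (glue w1 x y (glue x y p C)))" unfolding V using c2 w by (rule_tac chorded.attach) auto
    have wn: "w1 \<noteq> x" "w2 \<noteq> x" "w1 \<noteq> y" "w1 \<noteq> p" "w2 \<noteq> y" "w2 \<noteq> p" "x \<noteq> y" "x \<noteq> p"
      "z1 \<noteq> w1" "z2 \<noteq> w2" "z1 \<noteq> w2" "z2 \<noteq> w1" using w yp z1 z2 by auto
    show False
    proof (cases "mset_deg N3 x = 0")
      case True
      then have N3': "pairs V0 N3" using N3 pairs_shrink by metis
      \<comment> \<open>The four edges at \<open>x\<close> are split off in the pairs
        \<open>xw1\<close>, \<open>xp\<close> and \<open>xw2\<close>, \<open>xy\<close>. This turns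
        \<open>w1\<close> and \<open>w2\<close> into twins on \<open>yp\<close>, with the chords
        \<open>w1 z1\<close> and \<open>w2 z2\<close>.\<close>
      define H where "H = glue w2 y p (glue w1 y p C) + add_mset {w1, z1} (add_mset {w2, z2} N3)"
      have cH: "chorded (insert w2 (insert w1 V0)) H" unfolding H_def using C w N3' z1 z2 wn
        by (intro chorded_plus chorded.attach) (auto intro: pairs_mono)
      have "\<not> exceptional (insert w2 (insert w1 V0)) H" using fin w c0 by (simp add: exceptional_def H_def)
      then have "has_flow H (\<lambda>_. 0)" using flows_belowD[OF below _ cH] sE by (simp add: H_def)
      then have "has_flow (add_mset {x, w1} (add_mset {x, p} (glue w2 y p (add_mset {w1, y} (C + add_mset {w1, z1} (add_mset {w2, z2} N3)))))) (\<lambda>_. 0)"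
        using flow_extends_use[OF flow_extends_lift[of x w1 p], of H "glue w2 y p (add_mset {w1, y} (C + add_mset {w1, z1} (add_mset {w2, z2} N3)))"] wn
        by (simp add: H_def glue_def add_mset_commute)
      then have "has_flow E (\<lambda>_. 0)"
        using flow_extends_use[OF flow_extends_lift[of x w2 y], of _ "add_mset {x, w1} (add_mset {x, p} (add_mset {w2, p} (add_mset {w1, y} (C + add_mset {w1, z1} (add_mset {w2, z2} N3)))))" E] wn E N3
        by (simp add: glue_def insert_commute add_mset_commute)
      with nf show False by blast
    next
      case False
      then obtain z3 N4 where 4: "N3 = add_mset {x, z3} N4" "z3 \<in> insert x V0" "z3 \<noteq> x"
        using pairs_extract[OF N3(2), of x] by metis
      then have z3: "z3 \<in> V0" by auto
      show False
      proof (cases "mset_deg N4 x = 0")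
        case False
        moreover have "pairs (insert x V0) N4" using N3(2) unfolding 4(1) by simp
        ultimately obtain z4 N5 where 5: "N4 = add_mset {x, z4} N5" by (metis pairs_extract)
        have "N = add_mset {x, z3} (add_mset {x, z4} (add_mset {w1, z1} (add_mset {w2, z2} N5)))"
          using N3(1) 4(1) 5 by (simp add: add_mset_commute)
        moreover have "2 * card V \<le> size E" using c0 cV sE 4(1) 5 by simp
        ultimately show False using lift_reduce[OF below cE E _ N] nf by metis
      next
        case True
        then have N4: "pairs V0 N4" using N3 4 pairs_shrink by auto
        show False
        proof (cases "z1 = z3")
          case True
          have "N = add_mset {z1, w1} (add_mset {z1, x} (add_mset {w2, z2} N4))"
            using N3(1) 4(1) True by (simp add: add_mset_commute insert_commute)
          moreover have "2 * card V \<le> size E" using c0 cV sE 4(1) by simp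
          ultimately show False using lift_reduce[OF below cE E _ N] nf by metis
        next
          case zz: False
          \<comment> \<open>The edge \<open>z1 z3\<close> grows into the bull at \<open>w1\<close>
            and \<open>x\<close> over \<open>y\<close>; the edge \<open>z2 p\<close> is led through
            \<open>w2\<close>, from where its vector reaches \<open>p\<close> both directly and
            through \<open>x\<close>.\<close>
          define H where "H = add_mset {z1, z3} (add_mset {z2, p} (C + N4))"
          have cH: "chorded V0 H" unfolding H_def using C N4 z1 z2 z3 zz yp 2 by (intro chorded.chord chorded_plus) auto
          have "\<not> exceptional V0 H" using c0 by (simp add: exceptional_def H_def)
          then have "has_flow H (\<lambda>_. 0)" using flows_belowD[OF below _ cH] sE 4 by (simp add: H_def)
          then have "has_flow (add_mset {z2, p} ({#{z1, w1}, {w1, x}, {x, z3}, {w1, y}, {x, y}#} + (C + N4))) (\<lambda>_. 0)"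
            using flow_extends_use[OF flow_extends_bull[of z1 w1 x z3 y], of H "add_mset {z2, p} (C + N4)"] wn 4
            by (simp add: H_def add_mset_commute)
          then have "has_flow (add_mset {w2, z2} (add_mset {w2, p} ({#{z1, w1}, {w1, x}, {x, z3}, {w1, y}, {x, y}#} + (C + N4)))) (\<lambda>_. 0)"
            using flow_extends_use[OF flow_extends_lift[of w2 z2 p], of _ "{#{z1, w1}, {w1, x}, {x, z3}, {w1, y}, {x, y}#} + (C + N4)"] wn
            by (simp add: add_mset_commute)
          then have "has_flow (add_mset {w2, z2} (add_mset {w2, p} (add_mset {w2, p} ({#{z1, w1}, {w1, x}, {x, z3}, {w1, y}, {x, y}#} + (C + N4))))) (\<lambda>_. 0)"
            using flow_extends_use[OF flow_extends_double[of w2 p], of _ "add_mset {w2, z2} ({#{z1, w1}, {w1, x}, {x, z3}, {w1, y}, {x, y}#} + (C + N4))"] wn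
            by (simp add: add_mset_commute)
          then have "has_flow E (\<lambda>_. 0)"
            using flow_extends_use[OF flow_extends_lift[of x w2 p], of _ "add_mset {w2, z2} (add_mset {w2, p} ({#{z1, w1}, {w1, x}, {x, z3}, {w1, y}, {x, y}#} + (C + N4)))" E] wn E N3 4
            by (simp add: glue_def insert_commute add_mset_commute)
          with nf show False by blast
        qed
      qed
    qed
  qed
qed

lemma no_two_vertices:
  assumes "chorded V E" "card V = 2" shows False
proof -
  obtain a b where ab: "V = {a, b}" "a \<noteq> b" using assms(2) by (auto simp: card_2_iff)
  have e: "\<forall>e\<in>#E. e = {a, b}" using chorded_pairs[OF assms(1)] ab unfolding pairs_def by auto
  have "2 \<le> size E"
  proof (rule ccontr)
    assume "\<not> 2 \<le> size E"
    then have "size E = 1" using chorded_size[OF assms(1)] assms(2) by linarith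
    then obtain f where "E = {#f#}" using size_1_singleton_mset by metis
    then have "E = {#{a, b}#}" using e by auto
    then have "exceptional V E" using ab by (simp add: exceptional_def)
    with nexc show False by blast
  qed
  with multi_edge_flow[OF e ab(2)] nf show False by blast
qed

lemma no_triangle_end:
  assumes V: "V = insert w V0" and E: "E = glue w x y C + N" and N: "pairs V N"
    and C: "chorded V0 C" "{x, y} \<in># C" "card V0 = 2" "w \<notin> V0"
  shows False
proof -
  obtain z where "z \<in> V0" "z \<noteq> x" "z \<noteq> y"
    using leaf_reduce[OF below E C(1,2,4) _ nf] N V by auto
  moreover have "{x, y} = V0" using chorded_edgeD[OF C(1,2)] C(3) chorded_finite[OF C(1)] by (metis bot.extremum card_2_iff card_subset_eq insert_subset)
  ultimately show False by auto
qed

end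

theorem chorded_has_flow: "chorded V E \<Longrightarrow> \<not> exceptional V E \<Longrightarrow> has_flow E (\<lambda>_. 0)"
proof (induction "size E" arbitrary: V E rule: less_induct)
  case less
  have below: "flows_below TYPE('a) (size E)" unfolding flows_below_def using less.hyps by metis
  show ?case
  proof (rule ccontr)
    assume nf: "\<not> has_flow E (\<lambda>_. 0)"
    note ctx = below less.prems(2) nf
    obtain C N where E: "E = C + N" and N: "pairs V N" and C: "end_shape chorded V C \<or> chord_end V C"
      using chorded_end_cases[OF less.prems(1)] by metis
    from C show False
    proof
      assume "chord_end V C"
      then show False
      proof cases
        case (1 V0 C0 a b w)
        then show False using no_chord_end[OF ctx 1(1) _ N] E by auto
      qed
    next
      assume "end_shape chorded V C"
      then show False
      proof cases
        case two
        then show False using no_two_vertices[OF ctx less.prems(1)] by blast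
      next
        case (tri V0 C0 x y w)
        then show False using no_triangle_end[OF ctx tri(1) _ N] E by auto
      next
        case (twins V0 C0 x y w1 w2)
        then show False using no_twins_end[OF ctx twins(1) _ N] E by auto
      next
        case (tail V0 C0 y p x w)
        then show False using no_tail_end[OF ctx tail(1) _ N] E by auto
      next
        case (fork V0 C0 y p x w1 w2)
        then show False using no_fork_end[OF ctx fork(1) _ N] E by auto
      qed
    qed
  qed
qed

section \<open>Odd crystals have no flow\<close>

lemma cmod_eq_1_iff: "cmod z = 1 \<longleftrightarrow> (Re z)\<^sup>2 + (Im z)\<^sup>2 = 1"
  by (simp add: cmod_def)

lemma unit_split_one:
  assumes "cmod t = 1" "cmod (1 - t) = 1" shows "t = om \<or> t = 1 - om"
proof -
  have 1: "(Re t)\<^sup>2 + (Im t)\<^sup>2 = 1" "(1 - Re t)\<^sup>2 + (Im t)\<^sup>2 = 1"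
    using assms by (simp_all add: cmod_eq_1_iff)
  then have r: "Re t = 1/2" by (simp add: power2_eq_square algebra_simps)
  have "(Im t)\<^sup>2 = 3 / 4" using 1(1) unfolding r by (simp add: power2_eq_square)
  then have "(Im t)\<^sup>2 = (sqrt 3 / 2)\<^sup>2" by (simp add: power_divide)
  then have "Im t = sqrt 3 / 2 \<or> Im t = - (sqrt 3 / 2)" using power2_eq_iff by blast
  then show ?thesis using r by (auto simp: om_def complex_eq_iff)
qed

lemma unit_split_unit:
  assumes "cmod p = 1" "cmod q = 1" "p + q = s" "cmod s = 1"
  shows "q = om * s \<or> q = (1 - om) * s"
proof -
  have s: "s \<noteq> 0" using assms(4) by auto
  have "1 - q / s = p / s" using s assms(3) by (simp add: field_simps)
  then have "cmod (q / s) = 1" "cmod (1 - q / s) = 1" using assms by (simp_all add: norm_divide)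
  from unit_split_one[OF this] show ?thesis using s by (auto simp: field_simps)
qed

lemma unit_split_two:
  assumes "cmod p = 1" "cmod q = 1" "p + q = 2" shows "q = 1"
proof -
  have "p = 2 - q" using assms(3) by (simp add: algebra_simps)
  then have 1: "(2 - Re q)\<^sup>2 + (Im q)\<^sup>2 = 1" "(Re q)\<^sup>2 + (Im q)\<^sup>2 = 1"
    using assms by (simp_all add: cmod_eq_1_iff)
  then have "Re q = 1" by (simp add: power2_eq_square algebra_simps)
  with 1 show ?thesis by (simp add: complex_eq_iff)
qed

text \<open>Cut the graph along an edge \<open>ab\<close> of the triangle-path, and let one unit enter the removed part
  through the chord. These are the amounts that can leave it at \<open>a\<close>, the rest leaving at \<open>b\<close>,
  when \<open>a\<close> has an even number of edges left: \<open>even_states\<close> if \<open>b\<close> has an even number left, too,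
  and \<open>odd_states\<close> otherwise.\<close>

definition even_states :: "complex set" where "even_states = {om, 1 - om, - 1, 2}"
definition odd_states :: "complex set" where "odd_states = {1, - om, om - 1}"

lemma om_products:
  "om * om = om - 1" "om * (1 - om) = 1" "(1 - om) * om = 1" "(1 - om) * (1 - om) = - om"
  by (simp_all add: algebra_simps om_square)

text \<open>A sum \<open>t\<close> of length one forces \<open>q\<close> to be \<open>om * t\<close>
  or \<open>(1 - om) * t\<close>, and the sum \<open>2\<close> forces \<open>q = 1\<close>.\<close>

lemma even_states_split:
  assumes "cmod p = 1" "cmod q = 1" "p + q \<in> even_states" shows "q \<in> odd_states"
proof (cases "p + q = 2")
  case True
  then show ?thesis using unit_split_two assms by (auto simp: odd_states_def)
next
  case False
  then have s: "p + q = om \<or> p + q = 1 - om \<or> p + q = - 1" using assms(3) by (auto simp: even_states_def)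
  obtain t where t: "p + q = t" by blast
  have "cmod t = 1" using s t by auto
  from unit_split_unit[OF assms(1,2) t this] s[unfolded t] show ?thesis
    unfolding odd_states_def by (elim disjE) (simp_all only: om_products mult_minus_right, simp_all)
qed

lemma odd_states_split:
  assumes "cmod p = 1" "cmod q = 1" "p + q \<in> odd_states" shows "q \<in> even_states"
proof -
  have s: "p + q = 1 \<or> p + q = - om \<or> p + q = - (1 - om)" using assms(3) by (auto simp: odd_states_def)
  obtain t where t: "p + q = t" by blast
  have "cmod t = 1" using s[unfolded t] by (metis cmod_om norm_minus_cancel norm_one)
  from unit_split_unit[OF assms(1,2) t this] s[unfolded t] show ?thesis
    unfolding even_states_def by (elim disjE) (simp_all only: om_products mult_minus_right, simp_all)
qed

text \<open>This exchanges the ends of the cut edge and explains the state \<open>2\<close>: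
  splitting an odd state yields only \<open>om\<close>, \<open>1 - om\<close> and \<open>-1\<close>,
  and \<open>2\<close> is the complement of \<open>-1\<close>.\<close>

lemma even_states_compl: "A \<in> even_states \<Longrightarrow> 1 - A \<in> even_states"
  by (auto simp: even_states_def)

text \<open>The complements \<open>0\<close>, \<open>1 + om\<close> and \<open>2 - om\<close> have
  lengths \<open>0\<close>, \<open>sqrt 3\<close> and \<open>sqrt 3\<close>, but the last edge of
  the triangle-path would have to carry one of them.\<close>

lemma odd_states_not_unit: "A \<in> odd_states \<Longrightarrow> cmod (1 - A) \<noteq> 1"
  by (auto simp: odd_states_def om_def cmod_eq_1_iff power2_eq_square)

text \<open>\<open>T\<close> is what remains behind the cut edge \<open>ab\<close>, fed with
  \<open>A\<close> at \<open>a\<close> and \<open>1 - A\<close> at \<open>b\<close> and drained at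
  the far chord end \<open>v\<close>. The parities single out the next leaf, and removing it leads
  to the next cut edge.\<close>

lemma no_flow_state:
  assumes "two_tree r V T" "{a, b} \<in># T" "v \<in> V" "v \<noteq> a" "v \<noteq> b" "mset_deg T v = 2"
    "\<forall>k\<in>V - {a, b, v}. odd (mset_deg T k)" "even (mset_deg T a)"
    "A \<in> (if even (mset_deg T b) then even_states else odd_states)"
    "has_flow T (\<lambda>k. A * of_bool (k = a) + (1 - A) * of_bool (k = b) - of_bool (k = v))"
  shows False
  using assms
proof (induction "card V" arbitrary: r V T a b A rule: less_induct)
  case less
  note cT = two_tree_chorded[OF less.prems(1)]
  note ab = chorded_edgeD[OF cT less.prems(2)]
  have outside: "mset_deg T0 k = 0" if "two_tree e V0 T0" "k \<notin> V0" for e V0 T0 and k :: 'a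
    using that two_tree_chorded chorded_pairs mset_deg_outside by metis
  have "card {a, b, v} \<le> card V" using ab less.prems(3) chorded_finite[OF cT] by (intro card_mono) auto
  then have c3: "3 \<le> card V" using ab less.prems by auto
  have "mset_deg T v \<noteq> 0" using less.prems by simp
  then obtain e where e: "e \<in># T" "v \<in> e" unfolding mset_deg_eq_0_iff by metis
  obtain w p q V0 T0 where 1: "V = insert w V0" "T = glue w p q T0" "w \<notin> V0" "{p, q} \<in># T0" "two_tree e V0 T0"
    "w \<notin> e" "p \<in> V0" "q \<in> V0" "p \<noteq> q" "card V = Suc (card V0)"
    by (rule two_tree_leaf_avoiding[OF less.prems(1) c3 e(1)])
  have w2: "mset_deg T w = 2" using 1 outside[OF 1(5,3)] by (auto simp: mset_deg_glue)
  have wv: "w \<noteq> v" using e 1 by auto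
  \<comment> \<open>The leaf \<open>w\<close> has even degree and is not \<open>v\<close>, so it is
    \<open>a\<close> or \<open>b\<close>; \<open>step\<close> removes it under the name
    \<open>a\<close>.\<close>
  have step: False if ab': "{a, b} \<in># T" "v \<noteq> a" "v \<noteq> b" "\<forall>k\<in>V - {a, b, v}. odd (mset_deg T k)"
    and A: "A \<in> (if even (mset_deg T b) then even_states else odd_states)"
    and fl: "has_flow T (\<lambda>k. A * of_bool (k = a) + (1 - A) * of_bool (k = b) - of_bool (k = v))"
    and wa: "w = a" for a b A
  proof -
    note 1 = 1[unfolded wa]
    have "{a, b} \<in># glue a p q T0" using ab'(1) 1(2) by metis
    from glue_neighbour[OF two_tree_chorded[OF 1(5)] 1(3) this] have "b = p \<or> b = q" using 1(3,7,8) by metis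
    then obtain c where c: "T = glue a b c T0" "{b, c} \<in># T0" using 1(2,4) by (metis glue_swap insert_commute)
    note bc = chorded_edgeD[OF two_tree_chorded[OF 1(5)] c(2)]
    have an: "a \<noteq> b" "a \<noteq> c" using bc 1 by auto
    obtain c1 \<alpha>1 where f1: "cmod c1 = 1" "has_flow (add_mset {a, c} T0) \<alpha>1"
      "(\<lambda>k. A * of_bool (k = a) + (1 - A) * of_bool (k = b) - of_bool (k = v)) = (\<lambda>w. \<alpha>1 w + unit_flux a b c1 w)"
      using fl unfolding c glue_def has_flow_add_iff by metis
    obtain c2 \<alpha> where f2: "cmod c2 = 1" "has_flow T0 \<alpha>" "\<alpha>1 = (\<lambda>w. \<alpha> w + unit_flux a c c2 w)"
      using f1(2) unfolding has_flow_add_iff by metis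
    have eq: "A * of_bool (k = a) + (1 - A) * of_bool (k = b) - of_bool (k = v)
      = \<alpha> k + unit_flux a c c2 k + unit_flux a b c1 k" for k
      using fun_cong[OF f1(3), of k] f2(3) by simp
    have "mset_deg T0 a = 0" using outside[OF 1(5,3)] .
    then have "\<alpha> a = 0" using has_flow_outside[OF f2(2)] unfolding mset_deg_eq_0_iff by metis
    then have sum: "c1 + c2 = A" using eq[of a] an ab' by (simp add: unit_flux_def)
    have \<alpha>: "\<alpha> k = c2 * of_bool (k = c) + (1 - c2) * of_bool (k = b) - of_bool (k = v)" for k
      using eq[of k] sum[symmetric] an by (simp add: unit_flux_def algebra_simps)
    \<comment> \<open>For \<open>c = v\<close> only the edge \<open>bv\<close> is left, and it would
      carry \<open>1 - c2\<close>, which is not a unit vector. Otherwise \<open>cb\<close> is the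
      next cut edge; removing \<open>a\<close> flips the parity at \<open>b\<close>, which is why
      even and odd states alternate.\<close>
    show False
    proof (cases "c = v")
      case True
      have "mset_deg T0 v = 1" using less.prems(6) c True an ab' by (simp add: mset_deg_glue)
      then have "\<not> 3 \<le> card V0" using two_tree_mdeg_ge2[OF 1(5), of v] bc True by auto
      then have "card V0 = 2" using chorded_card[OF two_tree_chorded[OF 1(5)]] by simp
      then have "T0 = {#e#}" using two_tree_card2[OF 1(5)] by auto
      then have T0: "T0 = {#{b, v}#}" using c True by auto
      then obtain g where g: "cmod g = 1" "\<alpha> = unit_flux b v g"
        using f2(2) by (auto simp: has_flow_add_iff dest!: has_flow_emptyD)
      have "mset_deg T b = 2" using c(1) T0 True an ab'(3) by (simp add: mset_deg_glue)
      then have "c1 + c2 \<in> even_states" using A sum by simp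
      then have "c2 \<in> odd_states" using even_states_split f1 f2 by blast
      moreover have "1 - c2 = g" using \<alpha>[of b] g bc True ab' by (simp add: unit_flux_def)
      ultimately show False using odd_states_not_unit g by blast
    next
      case False
      have cV: "c \<in> V - {a, b, v}" using bc False an 1 by auto
      have dc: "even (mset_deg T0 c)" using bspec[OF ab'(4) cV] c an bc by (auto simp: mset_deg_glue)
      have db: "mset_deg T b = Suc (mset_deg T0 b)" using c an bc by (auto simp: mset_deg_glue)
      show False
      proof (rule less.hyps[OF _ 1(5)])
        show "card V0 < card V" using 1 by simp
        show "{c, b} \<in># T0" using c by (simp add: insert_commute)
        show "v \<in> V0" using less.prems(3) 1 ab' by auto
        show "v \<noteq> c" "v \<noteq> b" "even (mset_deg T0 c)" using False ab' dc by auto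
        show "mset_deg T0 v = 2" using less.prems(6) c False ab' by (auto simp: mset_deg_glue)
        show "\<forall>k\<in>V0 - {c, b, v}. odd (mset_deg T0 k)"
        proof
          fix k assume k: "k \<in> V0 - {c, b, v}"
          then have kn: "k \<noteq> a" "k \<noteq> b" "k \<noteq> c" "k \<in> V - {a, b, v}" using 1 by auto
          have "mset_deg T k = mset_deg T0 k" using kn c by (simp add: mset_deg_glue)
          then show "odd (mset_deg T0 k)" using bspec[OF ab'(4) kn(4)] by simp
        qed
        show "c2 \<in> (if even (mset_deg T0 b) then even_states else odd_states)"
          using A db sum[symmetric] even_states_split[of c1 c2] odd_states_split[of c1 c2] f1(1) f2(1)
          by (auto split: if_splits)
        show "has_flow T0 (\<lambda>k. c2 * of_bool (k = c) + (1 - c2) * of_bool (k = b) - of_bool (k = v))"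
          using f2(2) \<alpha> by (rule has_flow_cong)
      qed
    qed
  qed
  have "w = a \<or> w = b" using less.prems(7) w2 wv 1 by (metis Diff_iff even_numeral insertE insertI1 singletonD)
  then show False
  proof
    assume "w = a"
    then show False using step[of a b A] less.prems by blast
  next
    assume w: "w = b"
    \<comment> \<open>The leaf \<open>b\<close> has even degree, like \<open>a\<close>, so the two
      can be exchanged with \<open>1 - A\<close> in place of \<open>A\<close>.\<close>
    then have A: "A \<in> even_states" using less.prems(9) w2 by simp
    show False
    proof (rule step[of b a "1 - A"])
      show "{b, a} \<in># T" using less.prems(2) by (simp add: insert_commute)
      show "v \<noteq> b" "v \<noteq> a" "w = b" using less.prems w by auto
      show "\<forall>k\<in>V - {b, a, v}. odd (mset_deg T k)" using less.prems(7) by auto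
      show "1 - A \<in> (if even (mset_deg T a) then even_states else odd_states)"
        using even_states_compl[OF A] less.prems(8) by simp
      show "has_flow T (\<lambda>k. (1 - A) * of_bool (k = b) + (1 - (1 - A)) * of_bool (k = a) - of_bool (k = v))"
        using less.prems(10) by (rule has_flow_cong) simp
    qed
  qed
qed

text \<open>Rooted at an edge through \<open>v\<close>, the two-tree ends in a leaf other than
  \<open>v\<close>; its degree is even, so it is the chord end \<open>u\<close>.\<close>

lemma odd_chord_leaf:
  assumes "two_tree r V T" "u \<in> V" "v \<in> V" "u \<noteq> v" "\<forall>k\<in>V. odd (mset_deg (add_mset {u, v} T) k)"
  obtains a b e V0 T0 where "V = insert u V0" "T = glue u a b T0" "u \<notin> V0" "{a, b} \<in># T0" "two_tree e V0 T0"
    "v \<notin> {a, b}" "v \<in> V0" "mset_deg T u = 2" "card V = Suc (card V0)"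
proof -
  note facts = two_tree_odd_facts[OF assms]
  have "mset_deg T v \<noteq> 0" using two_tree_mdeg_ge2[OF assms(1) facts(2) assms(3)] by simp
  then obtain e where e: "e \<in># T" "v \<in> e" unfolding mset_deg_eq_0_iff by metis
  obtain w a b V0 T0 where 1: "V = insert w V0" "T = glue w a b T0" "w \<notin> V0" "{a, b} \<in># T0" "two_tree e V0 T0"
    "w \<notin> e" "a \<in> V0" "b \<in> V0" "a \<noteq> b" "card V = Suc (card V0)"
    by (rule two_tree_leaf_avoiding[OF assms(1) facts(2) e(1)])
  have "mset_deg T0 w = 0" using 1 two_tree_chorded chorded_pairs mset_deg_outside by metis
  then have w2: "mset_deg T w = 2" using 1 by (auto simp: mset_deg_glue)
  then have "w = u" using facts(3)[of w] 1(1,6) e by auto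
  note 1 = 1[unfolded this] and w2 = w2[unfolded this]
  have "v \<notin> {a, b}" using facts(1) 1(2) by auto
  moreover have "v \<in> V0" using assms 1 by auto
  ultimately show ?thesis using that 1 w2 by metis
qed

lemma odd_chord_no_flow:
  assumes "two_tree r V T" "u \<in> V" "v \<in> V" "u \<noteq> v" "\<forall>k\<in>V. odd (mset_deg (add_mset {u, v} T) k)"
  shows "\<not> has_flow (add_mset {u, v} T) (\<lambda>_. 0)"
proof
  assume fl: "has_flow (add_mset {u, v} T) (\<lambda>_. 0)"
  note facts = two_tree_odd_facts[OF assms]
  obtain a b e V0 T0 where 1: "V = insert u V0" "T = glue u a b T0" "u \<notin> V0" "{a, b} \<in># T0" "two_tree e V0 T0"
    "v \<notin> {a, b}" "v \<in> V0" "mset_deg T u = 2" "card V = Suc (card V0)"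
    by (rule odd_chord_leaf[OF assms])
  have odd': "\<forall>k\<in>V. odd (mset_deg (add_mset {v, u} T) k)" using assms(5) by (simp add: insert_commute)
  have v2: "mset_deg T v = 2" using odd_chord_leaf[OF assms(1,3,2) assms(4)[symmetric] odd'] by metis
  note ab = chorded_edgeD[OF two_tree_chorded[OF 1(5)] 1(4)]
  obtain c3 \<alpha>3 where f3: "cmod c3 = 1" "has_flow (add_mset {u, a} (add_mset {u, b} T0)) \<alpha>3"
    "(\<lambda>_. 0) = (\<lambda>w. \<alpha>3 w + unit_flux u v c3 w)"
    using fl unfolding 1(2) glue_def has_flow_add_iff[of u v] by metis
  obtain c1 \<alpha>1 where f1: "cmod c1 = 1" "has_flow (add_mset {u, b} T0) \<alpha>1" "\<alpha>3 = (\<lambda>w. \<alpha>1 w + unit_flux u a c1 w)"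
    using f3(2) unfolding has_flow_add_iff[of u a] by metis
  obtain c2 \<alpha> where f2: "cmod c2 = 1" "has_flow T0 \<alpha>" "\<alpha>1 = (\<lambda>w. \<alpha> w + unit_flux u b c2 w)"
    using f1(2) unfolding has_flow_add_iff by metis
  have eq: "\<alpha> k + unit_flux u b c2 k + unit_flux u a c1 k + unit_flux u v c3 k = 0" for k
    using fun_cong[OF f3(3), of k] f1(3) f2(3) by simp
  have un: "u \<noteq> a" "u \<noteq> b" using ab 1 by auto
  have "mset_deg T0 u = 0" using 1 two_tree_chorded chorded_pairs mset_deg_outside by metis
  then have "\<alpha> u = 0" using has_flow_outside[OF f2(2)] unfolding mset_deg_eq_0_iff by metis
  then have sum0: "c1 + c2 + c3 = 0" using eq[of u] un assms(4) by (simp add: unit_flux_def algebra_simps)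
  then have sum: "c2 = - c1 - c3" by (simp add: algebra_simps eq_neg_iff_add_eq_0)
  have c3: "c3 \<noteq> 0" using f3(1) by auto
  \<comment> \<open>After division by \<open>- c3\<close> the chord brings one unit to
    \<open>u\<close>, of which \<open>A\<close> goes to \<open>a\<close> and \<open>1 - A\<close> to
    \<open>b\<close>. Both are unit vectors, so \<open>A\<close> is \<open>om\<close> or
    \<open>1 - om\<close>, an even state.\<close>
  define A where "A = - (c1 / c3)"
  have "1 - A = - (c2 / c3)" using c3 by (simp add: A_def sum field_simps)
  then have A: "cmod A = 1" "cmod (1 - A) = 1" using f1 f2 f3 by (simp_all add: A_def norm_divide)
  have \<alpha>: "- (1 / c3) * \<alpha> k = A * of_bool (k = a) + (1 - A) * of_bool (k = b) - of_bool (k = v)" for k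
  proof -
    have "\<alpha> k = c1 * of_bool (k = a) + c2 * of_bool (k = b) + c3 * of_bool (k = v)"
    proof -
      have "\<alpha> k = - (unit_flux u b c2 k + unit_flux u a c1 k + unit_flux u v c3 k)"
        using eq[of k] by (simp only: eq_neg_iff_add_eq_0 add.assoc)
      also have "\<dots> = c1 * of_bool (k = a) + c2 * of_bool (k = b) + c3 * of_bool (k = v)
          - (c1 + c2 + c3) * of_bool (k = u)"
        by (simp add: unit_flux_def algebra_simps)
      finally show ?thesis by (simp only: sum0 mult_zero_left diff_zero)
    qed
    then show ?thesis unfolding \<open>1 - A = - (c2 / c3)\<close> unfolding A_def using c3 by (simp add: field_simps)
  qed
  have "cmod (- (1 / c3)) = 1" using f3(1) by (simp add: norm_divide)
  from has_flow_scale[OF f2(2) this]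
  have fl0: "has_flow T0 (\<lambda>k. A * of_bool (k = a) + (1 - A) * of_bool (k = b) - of_bool (k = v))"
    using \<alpha> by (rule has_flow_cong)
  have deg: "mset_deg T k = mset_deg T0 k + of_bool (k = a \<or> k = b)" if "k \<in> V0" for k
    using that 1 ab by (auto simp: mset_deg_glue)
  have ev: "even (mset_deg T0 a)" "even (mset_deg T0 b)" using facts(3)[of a] facts(3)[of b] ab deg 1 un by auto
  show False
  proof (rule no_flow_state[OF 1(5,4,7) _ _ _ _ ev(1) _ fl0])
    show "v \<noteq> a" "v \<noteq> b" using 1 by auto
    show "mset_deg T0 v = 2" using v2 deg[OF 1(7)] 1(6) by auto
    show "A \<in> (if even (mset_deg T0 b) then even_states else odd_states)"
      using ev unit_split_one[OF A] by (auto simp: even_states_def)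
    show "\<forall>k\<in>V0 - {a, b, v}. odd (mset_deg T0 k)"
    proof
      fix k assume k: "k \<in> V0 - {a, b, v}"
      then have "k \<in> V" "k \<noteq> u" using 1 by auto
      then show "odd (mset_deg T0 k)" using facts(3)[of k] k deg[of k] by auto
    qed
  qed
qed

section \<open>Fans\<close>

fun fan :: "'v \<Rightarrow> 'v list \<Rightarrow> 'v set multiset" where
  "fan c [] = {#}"
| "fan c [x] = {#{c, x}#}"
| "fan c (x # y # xs) = glue x c y (fan c (y # xs))"

lemma spoke_in_fan: "{c, x} \<in># fan c (x # xs)"
  by (cases xs) (auto simp: insert_commute)

lemma two_tree_fan: "rs \<noteq> [] \<Longrightarrow> distinct (c # rs) \<Longrightarrow> two_tree {c, last rs} (insert c (set rs)) (fan c rs)"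
proof (induction c rs rule: fan.induct)
  case (2 c x)
  then show ?case using two_tree.base[of c x "{c, x}"] by simp
next
  case (3 c x y xs)
  then have "two_tree {c, last (y # xs)} (insert c (set (y # xs))) (fan c (y # xs))" by simp
  moreover have "x \<notin> insert c (set (y # xs))" using 3 by auto
  ultimately have "two_tree {c, last (y # xs)} (insert x (insert c (set (y # xs)))) (glue x c y (fan c (y # xs)))"
    using two_tree.attach spoke_in_fan by metis
  moreover have "last (x # y # xs) = last (y # xs)"
    "insert c (set (x # y # xs)) = insert x (insert c (set (y # xs)))" by auto
  ultimately show ?case by (simp only: fan.simps)
qed auto

lemma mset_deg_fan_hub: "c \<notin> set rs \<Longrightarrow> mset_deg (fan c rs) c = length rs"
  by (induction c rs rule: fan.induct) (auto simp: mset_deg_glue)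

lemma mset_deg_fan_rim:
  "distinct (c # rs) \<Longrightarrow> x \<in> set rs \<Longrightarrow> mset_deg (fan c rs) x = 1 + of_bool (x \<noteq> hd rs) + of_bool (x \<noteq> last rs)"
proof (induction c rs rule: fan.induct)
  case (3 c a b xs)
  show ?case
  proof (cases "x = a")
    case True
    have "mset_deg (fan c (b # xs)) a = 0"
      using two_tree_fan[of "b # xs" c] 3 two_tree_chorded chorded_pairs mset_deg_outside True
      by (metis distinct.simps(2) insertE list.discI list.set_intros(1) set_ConsD distinct_length_2_or_more)
    moreover have "a \<noteq> last (b # xs)"
      using 3 last_in_set[of "b # xs"] by (metis distinct.simps(2) list.discI list.set_intros(2))
    ultimately show ?thesis using 3 True by (simp add: mset_deg_glue)
  next
    case False
    then have "mset_deg (fan c (b # xs)) x = 1 + of_bool (x \<noteq> b) + of_bool (x \<noteq> last (b # xs))" using 3 by auto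
    then show ?thesis using 3 False by (auto simp: mset_deg_glue)
  qed
qed auto

lemma fan_snoc: "fan c (xs @ [x, y]) = add_mset {x, y} (add_mset {c, y} (fan c (xs @ [x])))"
  by (induction xs rule: induct_list012) (simp_all add: glue_def insert_commute add_mset_commute)

lemma fan_map_upt:
  "fan c (map f [0..<Suc n]) =
   image_mset (\<lambda>i. {f i, f (Suc i)}) (mset_set {..<n}) + image_mset (\<lambda>i. {c, f i}) (mset_set {..<Suc n})"
proof (induction n)
  case (Suc n)
  have "map f [0..<Suc (Suc n)] = map f [0..<n] @ [f n, f (Suc n)]" by simp
  then show ?case using Suc fan_snoc[of c "map f [0..<n]" "f n" "f (Suc n)"]
    by (simp add: lessThan_Suc)
qed (simp add: lessThan_Suc)

text \<open>Rooted at \<open>vc\<close>, the leaf that comes off is \<open>u\<close>, since all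
  other candidates have degree at least three. Its neighbour \<open>x\<close> on the rim becomes the
  new leaf at \<open>c\<close>, so the rim is read off vertex by vertex.\<close>

lemma two_tree_is_fan:
  assumes "two_tree r V T" "3 \<le> card V" "u \<in> V" "v \<in> V" "u \<noteq> v" "mset_deg T u = 2" "mset_deg T v = 2"
    "{u, c} \<in># T" "{v, c} \<in># T" "\<forall>k\<in>V - {u, v, c}. 3 \<le> mset_deg T k"
  shows "\<exists>rs. distinct (c # rs) \<and> insert c (set rs) = V \<and> rs \<noteq> [] \<and> hd rs = u \<and> last rs = v \<and> T = fan c rs"
  using assms
proof (induction "card V" arbitrary: r V T u rule: less_induct)
  case less
  note cT = two_tree_chorded[OF less.prems(1)]
  have outside: "mset_deg T0 k = 0" if "two_tree e V0 T0" "k \<notin> V0" for e V0 T0 and k :: 'a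
    using that two_tree_chorded chorded_pairs mset_deg_outside by metis
  note uc = chorded_edgeD[OF cT less.prems(8)] and vc = chorded_edgeD[OF cT less.prems(9)]
  obtain w p q V0 T0 where 1: "V = insert w V0" "T = glue w p q T0" "w \<notin> V0" "{p, q} \<in># T0" "two_tree {v, c} V0 T0"
    "w \<notin> {v, c}" "p \<in> V0" "q \<in> V0" "p \<noteq> q" "card V = Suc (card V0)"
    by (rule two_tree_leaf_avoiding[OF less.prems(1,2,9)])
  have "mset_deg T w = 2" using 1 outside[OF 1(5,3)] by (auto simp: mset_deg_glue)
  then have "w = u" using bspec[OF less.prems(10), of w] 1 by auto
  note 1 = 1[unfolded this]
  have "{u, c} \<in># glue u p q T0" using less.prems(8) 1(2) by metis
  from glue_neighbour[OF two_tree_chorded[OF 1(5)] 1(3) this] have "c = p \<or> c = q" using 1(3,7,8) by metis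
  then obtain x where x: "T = glue u c x T0" "{c, x} \<in># T0" using 1(2,4) by (metis glue_swap insert_commute)
  note cx = chorded_edgeD[OF two_tree_chorded[OF 1(5)] x(2)]
  have un: "u \<noteq> c" "u \<noteq> x" using cx 1 by auto
  have vV0: "v \<in> V0" using 1 less.prems by auto
  show ?case
  proof (cases "3 \<le> card V0")
    case False
    then have "card V0 = 2" using chorded_card[OF two_tree_chorded[OF 1(5)]] by simp
    then have V0: "V0 = {v, c}" "T0 = {#{v, c}#}" using two_tree_card2[OF 1(5)] by auto
    then have "x = v" using cx by auto
    then have "T = fan c [u, v]" using x V0 by (simp add: insert_commute)
    then show ?thesis using 1 V0 un vc less.prems(5) by (intro exI[of _ "[u, v]"]) auto
  next
    case True
    have xv: "x \<noteq> v"
    proof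
      assume "x = v"
      then have "mset_deg T0 v = 1" using less.prems(5,7) x vc by (auto simp: mset_deg_glue)
      then show False using two_tree_mdeg_ge2[OF 1(5) True vV0] by simp
    qed
    obtain w where w: "w \<in> V0" "w \<notin> {v, c}" "mset_deg T0 w = 2"
      using two_tree_leaf_avoiding_mset_deg[OF 1(5) True] two_tree_root[OF 1(5)] by metis
    \<comment> \<open>Apart from \<open>c\<close>, removing \<open>u\<close> lowers only the degree
      of \<open>x\<close>, and the other vertices off \<open>v\<close> and \<open>c\<close> have
      degree at least three.\<close>
    have "w = x"
    proof (rule ccontr)
      assume "w \<noteq> x"
      moreover have "w \<noteq> u" using w 1 by auto
      ultimately have "mset_deg T w = 2" using w x by (auto simp: mset_deg_glue)
      then show False using bspec[OF less.prems(10), of w] w 1 \<open>w \<noteq> u\<close> by auto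
    qed
    then have x2: "mset_deg T0 x = 2" using w by simp
    have "\<exists>rs. distinct (c # rs) \<and> insert c (set rs) = V0 \<and> rs \<noteq> [] \<and> hd rs = x \<and> last rs = v \<and> T0 = fan c rs"
    proof (rule less.hyps[OF _ 1(5) True])
      show "card V0 < card V" using 1 by simp
      show "{v, c} \<in># T0" using two_tree_root[OF 1(5)] by simp
      show "{x, c} \<in># T0" using x by (simp add: insert_commute)
      show "mset_deg T0 v = 2" using less.prems(5,7) x xv vc by (auto simp: mset_deg_glue)
      show "\<forall>k\<in>V0 - {x, v, c}. 3 \<le> mset_deg T0 k"
      proof
        fix k assume k: "k \<in> V0 - {x, v, c}"
        then have kn: "k \<noteq> u" "k \<in> V - {u, v, c}" using 1 by auto
        have "mset_deg T k = mset_deg T0 k" using kn k x by (simp add: mset_deg_glue)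
        then show "3 \<le> mset_deg T0 k" using bspec[OF less.prems(10) kn(2)] by simp
      qed
    qed (use cx vV0 xv x2 in auto)
    then obtain rs where rs: "distinct (c # rs)" "insert c (set rs) = V0" "rs \<noteq> []" "hd rs = x" "last rs = v" "T0 = fan c rs"
      by (elim exE conjE)
    obtain rs' where rs': "rs = x # rs'" using rs(3,4) by (metis list.collapse)
    have "T = fan c (u # rs)" using x(1) rs(6) rs' by simp
    then show ?thesis using rs rs' 1(1,3) un by (intro exI[of _ "u # rs"]) auto
  qed
qed

section \<open>From graphs to multisets\<close>

definition end_mset :: "('v, 'e) ugraph \<Rightarrow> 'v set multiset" where
  "end_mset G = image_mset (ends G) (mset_set (edges G))"

lemma mset_deg_image: "finite X \<Longrightarrow> mset_deg (image_mset f (mset_set X)) v = card {e \<in> X. v \<in> f e}"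
  by (simp add: mset_deg_def filter_mset_image_mset flip: size_mset_set)

lemma degree_of_mset_deg: "finite (edges G) \<Longrightarrow> mset_deg (end_mset G) v = degree_of G v"
  by (simp add: end_mset_def degree_of_def mset_deg_image)

lemma has_flow_image:
  assumes "finite X"
  shows "has_flow (image_mset g (mset_set X)) \<beta> \<longleftrightarrow>
    (\<exists>t h f. (\<forall>e\<in>X. g e = {t e, h e} \<and> t e \<noteq> h e \<and> cmod (f e) = 1) \<and>
       \<beta> = (\<lambda>w. \<Sum>e\<in>X. unit_flux (t e) (h e) (f e) w))"
  using assms
proof (induction X arbitrary: \<beta>)
  case empty
  then show ?case using has_flow.empty by (auto dest: has_flow_emptyD)
next
  case (insert x X)
  have m: "image_mset g (mset_set (insert x X)) = add_mset (g x) (image_mset g (mset_set X))"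
    using insert by simp
  show ?case
  proof
    assume fl: "has_flow (image_mset g (mset_set (insert x X))) \<beta>"
    obtain u v where uv: "g x = {u, v}" using has_flow_elem[OF fl, of "g x"] m by auto
    obtain c \<alpha> where c: "u \<noteq> v" "cmod c = 1" "has_flow (image_mset g (mset_set X)) \<alpha>"
      "\<beta> = (\<lambda>w. \<alpha> w + unit_flux u v c w)"
      using fl unfolding m uv has_flow_add_iff by metis
    obtain t h f where f: "\<forall>e\<in>X. g e = {t e, h e} \<and> t e \<noteq> h e \<and> cmod (f e) = 1"
      "\<alpha> = (\<lambda>w. \<Sum>e\<in>X. unit_flux (t e) (h e) (f e) w)"
      using c(3) unfolding insert.IH by (elim exE conjE)
    have s: "(\<Sum>e\<in>X. unit_flux ((t(x := u)) e) ((h(x := v)) e) ((f(x := c)) e) w)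
       = (\<Sum>e\<in>X. unit_flux (t e) (h e) (f e) w)" for w
      by (rule sum.cong) (use insert in auto)
    show "\<exists>t h f. (\<forall>e\<in>insert x X. g e = {t e, h e} \<and> t e \<noteq> h e \<and> cmod (f e) = 1) \<and>
       \<beta> = (\<lambda>w. \<Sum>e\<in>insert x X. unit_flux (t e) (h e) (f e) w)"
    proof (intro exI conjI)
      show "\<forall>e\<in>insert x X. g e = {(t(x := u)) e, (h(x := v)) e} \<and> (t(x := u)) e \<noteq> (h(x := v)) e \<and> cmod ((f(x := c)) e) = 1"
        using f c uv insert by auto
      show "\<beta> = (\<lambda>w. \<Sum>e\<in>insert x X. unit_flux ((t(x := u)) e) ((h(x := v)) e) ((f(x := c)) e) w)"
        unfolding c(4) f(2) sum.insert[OF insert.hyps(1,2)] s by (simp add: add.commute)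
    qed
  next
    assume "\<exists>t h f. (\<forall>e\<in>insert x X. g e = {t e, h e} \<and> t e \<noteq> h e \<and> cmod (f e) = 1) \<and>
       \<beta> = (\<lambda>w. \<Sum>e\<in>insert x X. unit_flux (t e) (h e) (f e) w)"
    then obtain t h f where f: "\<forall>e\<in>insert x X. g e = {t e, h e} \<and> t e \<noteq> h e \<and> cmod (f e) = 1"
      "\<beta> = (\<lambda>w. \<Sum>e\<in>insert x X. unit_flux (t e) (h e) (f e) w)" by (elim exE conjE)
    have "has_flow (image_mset g (mset_set X)) (\<lambda>w. \<Sum>e\<in>X. unit_flux (t e) (h e) (f e) w)"
      unfolding insert.IH using f(1) by (intro exI[of _ t] exI[of _ h] exI[of _ f]) auto
    from has_flow.add[OF this, of "t x" "h x" "f x"] show "has_flow (image_mset g (mset_set (insert x X))) \<beta>"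
      unfolding m f(2) sum.insert[OF insert.hyps(1,2)] using f(1) by (simp add: add.commute)
  qed
qed

section \<open>Unit vectors of the plane as complex numbers\<close>

definition to_vec :: "complex \<Rightarrow> real^2" where "to_vec z = vector [Re z, Im z]"
definition of_vec :: "real^2 \<Rightarrow> complex" where "of_vec x = Complex (x $ 1) (x $ 2)"

lemma of_to_vec: "of_vec (to_vec z) = z"
  by (simp add: of_vec_def to_vec_def)

lemma norm_of_vec: "cmod (of_vec x) = norm x"
  by (simp add: of_vec_def cmod_def norm_vec_def L2_set_def sum_2)

lemma norm_to_vec: "norm (to_vec z) = cmod z"
  by (metis norm_of_vec of_to_vec)

lemma of_vec_sum: "of_vec (sum f A) = (\<Sum>e\<in>A. of_vec (f e))"
  by (induction A rule: infinite_finite_induct) (simp_all add: of_vec_def complex_eq_iff)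

lemma of_vec_inj: "of_vec x = of_vec y \<longleftrightarrow> x = y"
  by (auto simp: of_vec_def vec_eq_iff exhaust_2 forall_2)

lemma sum_unit_flux:
  assumes "finite X"
  shows "(\<Sum>e\<in>X. unit_flux (t e) (h e) (f e) w) = (\<Sum>e\<in>{e \<in> X. t e = w}. f e) - (\<Sum>e\<in>{e \<in> X. h e = w}. f e)"
proof -
  have "(\<Sum>e\<in>X. unit_flux (t e) (h e) (f e) w)
     = (\<Sum>e\<in>X. if t e = w then f e else 0) - (\<Sum>e\<in>X. if h e = w then f e else 0)"
    unfolding sum_subtractf[symmetric] by (intro sum.cong) (auto simp: unit_flux_def)
  then show ?thesis using assms by (simp add: sum.inter_filter)
qed

text \<open>\<open>has_flow\<close> prescribes the net outflow at every element of the type; outside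
  \<open>vertices G\<close> it is zero because no edge ends there.\<close>

lemma admits_S1_flow_iff:
  assumes G: "finite_loopless_graph G"
  shows "admits_S1_flow G \<longleftrightarrow> has_flow (end_mset G) (\<lambda>_. 0)"
proof
  have fin: "finite (edges G)" using G by (simp add: finite_loopless_graph_def)
  assume "admits_S1_flow G"
  then obtain D f where f: "S1_flow G D f" unfolding admits_S1_flow_def by metis
  have D: "arcs D = edges G" "\<forall>e\<in>edges G. ends G e = {tail D e, head D e} \<and> tail D e \<noteq> head D e"
    using f G unfolding S1_flow_def orientation_of_def finite_loopless_graph_def
    by (auto simp: card_2_iff) (metis card_2_iff card_1_singleton_iff doubleton_eq_iff insert_absorb2 insert_iff)
  have u: "cmod (of_vec (f e)) = 1" if "e \<in> edges G" for e
    using f that by (simp add: norm_of_vec S1_flow_def)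
  have bal: "(\<Sum>e\<in>edges G. unit_flux (tail D e) (head D e) (of_vec (f e)) w) = 0" for w
  proof (cases "w \<in> vertices G")
    case True
    have "out_arcs D w = {e \<in> edges G. tail D e = w}" "in_arcs D w = {e \<in> edges G. head D e = w}"
      using D by (auto simp: out_arcs_def in_arcs_def)
    moreover have "sum f (out_arcs D w) = sum f (in_arcs D w)" using f True by (simp add: S1_flow_def)
    ultimately have "sum f {e \<in> edges G. tail D e = w} = sum f {e \<in> edges G. head D e = w}" by metis
    then show ?thesis unfolding sum_unit_flux[OF fin] of_vec_sum[symmetric] by simp
  next
    case False
    then have "unit_flux (tail D e) (head D e) (of_vec (f e)) w = 0" if "e \<in> edges G" for e
      using D(2) G that unfolding finite_loopless_graph_def unit_flux_def by (auto dest!: bspec)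
    then show ?thesis by simp
  qed
  show "has_flow (end_mset G) (\<lambda>_. 0)"
    unfolding end_mset_def has_flow_image[OF fin] using D u bal
    by (intro exI[of _ "tail D"] exI[of _ "head D"] exI[of _ "\<lambda>e. of_vec (f e)"]) auto
next
  have fin: "finite (edges G)" using G by (simp add: finite_loopless_graph_def)
  assume "has_flow (end_mset G) (\<lambda>_. 0)"
  then obtain t h f where f: "\<forall>e\<in>edges G. ends G e = {t e, h e} \<and> t e \<noteq> h e \<and> cmod (f e) = 1"
    "(\<lambda>_. 0) = (\<lambda>w. \<Sum>e\<in>edges G. unit_flux (t e) (h e) (f e) w)"
    unfolding end_mset_def has_flow_image[OF fin] by (elim exE conjE)
  define D where "D = \<lparr>verts = vertices G, arcs = edges G, tail = t, head = h\<rparr>"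
  have "S1_flow G D (\<lambda>e. to_vec (f e))" unfolding S1_flow_def
  proof (intro conjI ballI)
    show "orientation_of G D" using f by (auto simp: orientation_of_def D_def)
    show "to_vec (f e) \<in> sphere 0 1" if "e \<in> edges G" for e using f that by (simp add: norm_to_vec)
    fix v
    have "out_arcs D v = {e \<in> edges G. t e = v}" "in_arcs D v = {e \<in> edges G. h e = v}"
      by (auto simp: D_def out_arcs_def in_arcs_def)
    moreover have "(\<Sum>e\<in>{e \<in> edges G. t e = v}. f e) = (\<Sum>e\<in>{e \<in> edges G. h e = v}. f e)"
      using fun_cong[OF f(2), of v] unfolding sum_unit_flux[OF fin] by simp
    ultimately show "(\<Sum>e\<in>out_arcs D v. to_vec (f e)) = (\<Sum>e\<in>in_arcs D v. to_vec (f e))"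
      by (simp add: of_vec_sum of_to_vec flip: of_vec_inj)
  qed
  then show "admits_S1_flow G" unfolding admits_S1_flow_def by metis
qed

lemma pairs_end_mset: "finite_loopless_graph G \<Longrightarrow> pairs (vertices G) (end_mset G)"
  unfolding finite_loopless_graph_def pairs_def end_mset_def by (fastforce simp: card_2_iff)

lemma end_mset_subgraph:
  assumes "subgraph_of T G" "finite (edges G)"
  shows "end_mset G = end_mset T + image_mset (ends G) (mset_set (edges G - edges T))"
proof -
  have sub: "edges T \<subseteq> edges G" "finite (edges T)" using assms finite_subset by (auto simp: subgraph_of_def)
  have "mset_set (edges G) = mset_set (edges T) + mset_set (edges G - edges T)"
    using sub assms by (metis Diff_disjoint Diff_partition finite_Diff mset_set_Union)
  moreover have "image_mset (ends G) (mset_set (edges T)) = end_mset T"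
    unfolding end_mset_def using assms(1) sub by (intro image_mset_cong) (auto simp: subgraph_of_def)
  ultimately show ?thesis by (simp add: end_mset_def)
qed

section \<open>Triangle-trees, crystals and exceptional graphs\<close>

lemma triangle_two_tree:
  assumes "is_cycle 3 T"
  shows "finite (edges T) \<and> card (vertices T) = 3 \<and> (\<exists>r. two_tree r (vertices T) (end_mset T))"
proof -
  obtain c r where c: "bij_betw c {..<3} (vertices T)" "bij_betw r {..<3} (edges T)"
    "\<forall>i<3. ends T (r i) = {c i, c (Suc i mod 3)}" using assms unfolding is_cycle_def by metis
  have l3: "{..<3} = {0, 1, 2::nat}" by auto
  have V: "vertices T = {c 0, c 1, c 2}" and E: "edges T = {r 0, r 1, r 2}"
    using c(1,2) unfolding bij_betw_def l3 by auto
  have d: "c 0 \<noteq> c 1" "c 1 \<noteq> c 2" "c 2 \<noteq> c 0" "r 0 \<noteq> r 1" "r 1 \<noteq> r 2" "r 2 \<noteq> r 0"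
  proof -
    have "c i = c j \<longleftrightarrow> i = j" "r i = r j \<longleftrightarrow> i = j" if "i < 3" "j < 3" for i j
      using that inj_on_eq_iff[OF bij_betw_imp_inj_on[OF c(1)]] inj_on_eq_iff[OF bij_betw_imp_inj_on[OF c(2)]]
      by auto
    then show "c 0 \<noteq> c 1" "c 1 \<noteq> c 2" "c 2 \<noteq> c 0" "r 0 \<noteq> r 1" "r 1 \<noteq> r 2" "r 2 \<noteq> r 0" by simp_all
  qed
  have "ends T (r 0) = {c 0, c 1}" "ends T (r 1) = {c 1, c 2}" "ends T (r 2) = {c 2, c 0}"
  proof -
    have m: "Suc 0 mod 3 = 1" "Suc 1 mod 3 = 2" "Suc 2 mod 3 = 0" and
      l: "0 < (3::nat)" "1 < (3::nat)" "2 < (3::nat)" by simp_all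
    show "ends T (r 0) = {c 0, c 1}" using c(3)[rule_format, OF l(1)] unfolding m .
    show "ends T (r 1) = {c 1, c 2}" using c(3)[rule_format, OF l(2)] unfolding m .
    show "ends T (r 2) = {c 2, c 0}" using c(3)[rule_format, OF l(3)] unfolding m .
  qed
  note en = this
  have "end_mset T = glue (c 2) (c 0) (c 1) {#{c 0, c 1}#}"
  proof -
    have "mset_set {r 0, r 1, r 2} = {#r 0, r 1, r 2#}" using d(4-6) by simp
    then show ?thesis unfolding end_mset_def E by (simp add: en glue_def insert_commute add_mset_commute del: One_nat_def)
  qed
  moreover have "two_tree {c 0, c 1} (insert (c 2) {c 0, c 1}) (glue (c 2) (c 0) (c 1) {#{c 0, c 1}#})"
    using d by (intro two_tree.attach two_tree.base) auto
  moreover have "insert (c 2) {c 0, c 1} = vertices T" using V by auto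
  ultimately show ?thesis using E V d by auto
qed

lemma triangle_tree_two_tree:
  "triangle_tree T \<Longrightarrow> finite (edges T) \<and> 3 \<le> card (vertices T) \<and> (\<exists>r. two_tree r (vertices T) (end_mset T))"
proof (induction rule: triangle_tree.induct)
  case (triangle T)
  then show ?case using triangle_two_tree by fastforce
next
  case (add_vertex T e x y w e1 e2 T')
  then obtain r where r: "two_tree r (vertices T) (end_mset T)" by metis
  have fin: "finite (edges T')" using add_vertex by simp
  have diff: "edges T' - edges T = {e1, e2}" using add_vertex.hyps by auto
  have "end_mset T' = glue w x y (end_mset T)"
    using end_mset_subgraph[OF add_vertex.hyps(8) fin] add_vertex.hyps unfolding diff
    by (simp add: glue_def)
  moreover have "{x, y} \<in># end_mset T" using add_vertex by (auto simp: end_mset_def)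
  ultimately have "two_tree r (vertices T') (end_mset T')" using two_tree.attach[OF r] add_vertex.hyps by metis
  moreover have "card (vertices T) \<le> card (vertices T')"
    using add_vertex.hyps chorded_finite[OF two_tree_chorded[OF r]] by (simp add: card_insert_le)
  ultimately show ?case using fin add_vertex.IH by auto
qed

lemma triangle_path_two_tree:
  "triangle_path P \<Longrightarrow> finite (edges P) \<and> 3 \<le> card (vertices P) \<and> (\<exists>r. two_tree r (vertices P) (end_mset P))"
  using triangle_tree_two_tree triangle_tree.triangle unfolding triangle_path_def by metis

lemma odd_crystal_no_flow:
  assumes "finite_loopless_graph G" "odd_crystal G" shows "\<not> has_flow (end_mset G) (\<lambda>_. 0)"
proof -
  have fin: "finite (edges G)" using assms by (simp add: finite_loopless_graph_def)
  obtain P u v e where P: "triangle_path P" "4 \<le> card (vertices P)" "leaves P = {u, v}"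
        "subgraph_of P G" "vertices G = vertices P"
        "e \<notin> edges P" "edges G = insert e (edges P)" "ends G e = {u, v}"
    using assms(2) unfolding odd_crystal_def crystal_def by metis
  obtain r where r: "two_tree r (vertices P) (end_mset P)" using triangle_path_two_tree P by metis
  have "edges G - edges P = {e}" using P by auto
  then have E: "end_mset G = add_mset {u, v} (end_mset P)"
    using end_mset_subgraph[OF P(4) fin] P(8) by simp
  \<comment> \<open>Having four vertices excludes the triangle among the triangle-paths; the chord
    therefore joins two distinct leaves.\<close>
  have "card (leaves P) = 2" using P triangle_two_tree unfolding triangle_path_def by fastforce
  then have "u \<noteq> v" using P(3) by auto
  moreover have "u \<in> vertices P" "v \<in> vertices P" using P(3) by (auto simp: leaves_def)
  moreover have "\<forall>k\<in>vertices P. odd (mset_deg (add_mset {u, v} (end_mset P)) k)"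
    unfolding E[symmetric] degree_of_mset_deg[OF fin] using assms(2) P(5) by (simp add: odd_crystal_def)
  ultimately show ?thesis unfolding E using odd_chord_no_flow[OF r] by blast
qed

text \<open>Only the chord ends have even degree in \<open>T\<close>, and
  \<open>odd_chord_leaf\<close>, used from both sides, makes each of them a leaf. The neighbours of
  \<open>u\<close> differ from \<open>v\<close>, which gives four vertices.\<close>

lemma odd_chord_leaves:
  assumes "two_tree r V T" "u \<in> V" "v \<in> V" "u \<noteq> v" "\<forall>k\<in>V. odd (mset_deg (add_mset {u, v} T) k)"
  shows "{k \<in> V. mset_deg T k = 2} = {u, v}" "4 \<le> card V" 
proof -
  note facts = two_tree_odd_facts[OF assms]
  obtain a b e V0 T0 where 1: "V = insert u V0" "T = glue u a b T0" "u \<notin> V0" "{a, b} \<in># T0" "two_tree e V0 T0"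
    "v \<notin> {a, b}" "v \<in> V0" "mset_deg T u = 2" "card V = Suc (card V0)"
    by (rule odd_chord_leaf[OF assms])
  have odd': "\<forall>k\<in>V. odd (mset_deg (add_mset {v, u} T) k)" using assms(5) by (simp add: insert_commute)
  have v2: "mset_deg T v = 2" using odd_chord_leaf[OF assms(1,3,2) assms(4)[symmetric] odd'] by metis
  show "{k \<in> V. mset_deg T k = 2} = {u, v}"
  proof (intro equalityI subsetI)
    fix k assume "k \<in> {k \<in> V. mset_deg T k = 2}"
    then show "k \<in> {u, v}" using facts(3)[of k] by auto
  qed (use assms 1(8) v2 in auto)
  note ab = chorded_edgeD[OF two_tree_chorded[OF 1(5)] 1(4)]
  have "card {u, v, a, b} \<le> card V" using ab 1 assms chorded_finite[OF two_tree_chorded[OF assms(1)]] by (intro card_mono) auto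
  moreover have "u \<noteq> a" "u \<noteq> b" using ab(1,2) 1(3) by auto
  then have "card {u, v, a, b} = 4" using ab(3) 1(6) assms(4) by auto
  ultimately show "4 \<le> card V" by simp
qed

text \<open>A two-tree has an even degree, so some chord is present; the edge count allows only one,
  and by parity its ends are the two leaves of \<open>T\<close>.\<close>

lemma exceptional_odd_crystal:
  assumes G: "finite_loopless_graph G" and T: "spanning_triangle_tree T G" and exceptional: "exceptional (vertices G) (end_mset G)"
  shows "odd_crystal G"
proof -
  have fin: "finite (edges G)" using G by (simp add: finite_loopless_graph_def)
  have T': "triangle_tree T" "subgraph_of T G" "vertices T = vertices G"
    using T by (auto simp: spanning_triangle_tree_def)
  obtain r where r: "two_tree r (vertices G) (end_mset T)" and c3: "3 \<le> card (vertices G)" and finT: "finite (edges T)"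
    using triangle_tree_two_tree[OF T'(1)] T'(3) by auto
  define N where "N = image_mset (ends G) (mset_set (edges G - edges T))"
  have E: "end_mset G = end_mset T + N" using end_mset_subgraph[OF T'(2) fin] by (simp add: N_def)
  have odd: "\<forall>k\<in>vertices G. odd (mset_deg (end_mset G) k)" using exceptional by (simp add: exceptional_def)
  have "N \<noteq> {#}" using two_tree_some_even[OF r c3] odd E by auto
  moreover have "size N \<le> 1" using exceptional two_tree_size[OF r] E by (simp add: exceptional_def)
  ultimately have "size N = 1" by (metis One_nat_def le_SucE le_zero_eq size_eq_0_iff_empty)
  then have "card (edges G - edges T) = 1" by (simp add: N_def)
  then obtain e where e: "edges G - edges T = {e}" by (metis card_1_singletonE)
  have "e \<in> edges G" using e by auto
  then obtain u v where uv: "ends G e = {u, v}" "u \<noteq> v" "u \<in> vertices G" "v \<in> vertices G"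
    using G unfolding finite_loopless_graph_def by (metis card_2_iff insert_subset)
  have E': "end_mset G = add_mset {u, v} (end_mset T)" using E e uv by (simp add: N_def)
  note L = odd_chord_leaves[OF r uv(3,4,2) odd[unfolded E']]
  have leaves: "leaves T = {u, v}" using L(1) T'(3) degree_of_mset_deg[OF finT] by (simp add: leaves_def)
  have "triangle_path T" unfolding triangle_path_def using leaves uv(2) T'(1) by simp
  then have "crystal G" unfolding crystal_def using L(2) leaves T' e uv(1)
    by (intro exI[of _ T] exI[of _ u] exI[of _ v] exI[of _ e]) (auto simp: subgraph_of_def)
  then show ?thesis unfolding odd_crystal_def using odd degree_of_mset_deg[OF fin] by simp
qed

section \<open>Triangularly connected graphs\<close>

text \<open>Without the rim edge from \<open>c n\<close> to \<open>c 0\<close> the wheel is a fan.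
  That edge is its chord, and all degrees are odd: \<open>k\<close> at the hub and three on the
  rim.\<close>

lemma odd_wheel_no_flow:
  assumes G: "finite_loopless_graph G" and "odd_wheel G" shows "\<not> has_flow (end_mset G) (\<lambda>_. 0)"
proof -
  have fin: "finite (edges G)" using assms by (simp add: finite_loopless_graph_def)
  obtain k C h s where k: "odd k" and C: "is_cycle k C" "subgraph_of C G" "h \<notin> vertices C"
    "vertices G = insert h (vertices C)" "bij_betw s (vertices C) (edges G - edges C)"
    "\<forall>v\<in>vertices C. ends G (s v) = {h, v}"
    using assms(2) unfolding odd_wheel_def is_wheel_def by metis
  obtain c r where c: "3 \<le> k" "bij_betw c {..<k} (vertices C)" "bij_betw r {..<k} (edges C)"
    "\<forall>i<k. ends C (r i) = {c i, c (Suc i mod k)}"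
    using C(1) unfolding is_cycle_def by metis
  obtain n where n: "k = Suc n" "2 \<le> n" using c(1) by (cases k) auto
  define rs where "rs = map c [0..<Suc n]"
  have setrs: "set rs = vertices C" using c(2) unfolding rs_def bij_betw_def n(1)
    by (simp add: lessThan_atLeast0 del: upt_Suc)
  have hd: "hd rs = c 0" "last rs = c n" "rs \<noteq> []" by (simp_all add: rs_def hd_map last_map del: upt_Suc)
  have dist: "distinct (h # rs)" using c(2) C(3) setrs unfolding rs_def bij_betw_def n(1)
    by (auto simp: distinct_map lessThan_atLeast0 simp del: upt_Suc)
  have eC: "edges C = r ` {..<k}" "inj_on r {..<k}" using c(3) by (auto simp: bij_betw_def)
  have "end_mset C = image_mset (\<lambda>i. ends C (r i)) (mset_set {..<k})"
    unfolding end_mset_def eC(1) using eC(2) by (simp add: image_mset_mset_set[symmetric] multiset.map_comp o_def)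
  also have "\<dots> = image_mset (\<lambda>i. {c i, c (Suc i mod k)}) (mset_set {..<k})"
    using c(4) by (intro image_mset_cong) auto
  also have "\<dots> = add_mset {c n, c 0} (image_mset (\<lambda>i. {c i, c (Suc i mod k)}) (mset_set {..<n}))"
    unfolding n(1) by (simp add: lessThan_Suc)
  also have "image_mset (\<lambda>i. {c i, c (Suc i mod k)}) (mset_set {..<n}) = image_mset (\<lambda>i. {c i, c (Suc i)}) (mset_set {..<n})"
    unfolding n(1) by (intro image_mset_cong) auto
  finally have mC: "end_mset C = add_mset {c n, c 0} (image_mset (\<lambda>i. {c i, c (Suc i)}) (mset_set {..<n}))" .
  have eS: "edges G - edges C = s ` vertices C" "inj_on s (vertices C)" using C(5) by (auto simp: bij_betw_def)
  have eV: "vertices C = c ` {..<k}" "inj_on c {..<k}" using c(2) by (auto simp: bij_betw_def)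
  have "image_mset (ends G) (mset_set (edges G - edges C)) = image_mset (\<lambda>v. ends G (s v)) (mset_set (vertices C))"
    unfolding eS(1) using eS(2) by (simp add: image_mset_mset_set[symmetric] multiset.map_comp o_def)
  also have "\<dots> = image_mset (\<lambda>v. {h, v}) (mset_set (vertices C))"
  proof (rule image_mset_cong)
    fix v assume "v \<in># mset_set (vertices C)"
    then have "v \<in> vertices C" using eV(1) by simp
    then show "ends G (s v) = {h, v}" using C(6) by simp
  qed
  also have "\<dots> = image_mset (\<lambda>i. {h, c i}) (mset_set {..<k})"
    unfolding eV(1) using eV(2) by (simp add: image_mset_mset_set[symmetric] multiset.map_comp o_def)
  finally have E: "end_mset G = add_mset {c n, c 0} (fan h rs)"
    unfolding end_mset_subgraph[OF C(2) fin] mC rs_def fan_map_upt n(1) by simp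
  have T: "two_tree {h, last rs} (insert h (set rs)) (fan h rs)" using two_tree_fan[OF hd(3) dist] .
  have c0n: "c 0 \<noteq> c n" using inj_on_eq_iff[OF bij_betw_imp_inj_on[OF c(2)], of 0 n] n by simp
  have in': "c n \<in> set rs" "c 0 \<in> set rs" using hd by (metis last_in_set hd_in_set)+
  have "\<forall>v\<in>insert h (set rs). odd (mset_deg (add_mset {c n, c 0} (fan h rs)) v)"
  proof
    fix v assume "v \<in> insert h (set rs)"
    then consider "v = h" | "v \<in> set rs" by auto
    then show "odd (mset_deg (add_mset {c n, c 0} (fan h rs)) v)"
    proof cases
      case 1
      have "h \<notin> set rs" using dist by simp
      then have "mset_deg (fan h rs) h = length rs" "h \<noteq> c n" "h \<noteq> c 0" using mset_deg_fan_hub in' by metis+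
      then show ?thesis using k 1 by (simp add: rs_def n(1))
    next
      case 2
      then show ?thesis using mset_deg_fan_rim[OF dist 2] hd c0n by auto
    qed
  qed
  then show ?thesis unfolding E using odd_chord_no_flow[OF T] in' c0n by (metis insertCI)
qed

lemma two_tree_edge_in_triangle:
  assumes "two_tree r V T" "3 \<le> card V" "{a, b} \<in># T"
  shows "\<exists>c. c \<noteq> a \<and> c \<noteq> b \<and> {a, c} \<in># T \<and> {b, c} \<in># T"
proof -
  have ab: "a \<noteq> b" using chorded_edgeD two_tree_chorded assms by metis
  have "two_tree {a, b} V T" using two_tree_reroot assms by metis
  then show ?thesis using assms(2)
  proof (induction rule: two_tree.induct)
    case (base x y)
    then show ?case using ab by simp
  next
    case (attach V T x y w)
    show ?case
    proof (cases "3 \<le> card V")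
      case True
      then show ?thesis using attach by auto
    next
      case False
      then have "card V = 2" using chorded_card[OF two_tree_chorded[OF attach(1)]] by simp
      then have V: "V = {a, b}" "T = {#{a, b}#}" using two_tree_card2[OF attach(1)] by auto
      then have "{x, y} = {a, b}" using attach by auto
      then have "glue w x y T = glue w a b T" by (rule glue_cong)
      then show ?thesis using V attach.hyps(3) by (intro exI[of _ w]) (auto simp: insert_commute)
    qed
  qed
qed

text \<open>The ends of the edges form a set of distinct pairs, rim \<open>R\<close> and spokes
  \<open>S\<close>, so each pair determines its edge label through \<open>g\<close>. This yields the
  bijections that \<open>is_wheel\<close> asks for.\<close>

lemma fan_odd_wheel:
  assumes G: "finite_loopless_graph G" and E: "end_mset G = add_mset {hd rs, last rs} (fan c rs)"
    and rs: "distinct (c # rs)" "insert c (set rs) = vertices G" "3 \<le> length rs" "odd (length rs)"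
  shows "odd_wheel G"
proof -
  have fin: "finite (edges G)" using G by (simp add: finite_loopless_graph_def)
  obtain n where n: "length rs = Suc n" "2 \<le> n" using rs(3) by (cases "length rs") auto
  define k where "k = Suc n"
  define p where "p i = rs ! i" for i
  have inj: "inj_on p {..<k}" using rs(1) n unfolding p_def k_def by (auto simp: inj_on_def nth_eq_iff_index_eq)
  have rsp: "rs = map p [0..<Suc n]" unfolding p_def n(1)[symmetric] by (rule map_nth[symmetric])
  have set: "set rs = p ` {..<k}" unfolding rsp k_def by (auto simp: lessThan_atLeast0 simp del: upt_Suc)
  have hl: "hd rs = p 0" "last rs = p n" unfolding rsp by (simp_all add: hd_map last_map del: upt_Suc)
  define rim where "rim i = {p i, p (Suc i mod k)}" for i
  have nx: "Suc i mod k = (if i = n then 0 else Suc i)" if "i < k" for i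
    using that unfolding k_def by (auto simp: mod_Suc)
  have "image_mset rim (mset_set {..<k}) = add_mset {p n, p 0} (image_mset rim (mset_set {..<n}))"
    unfolding k_def rim_def by (simp add: lessThan_Suc)
  also have "image_mset rim (mset_set {..<n}) = image_mset (\<lambda>i. {p i, p (Suc i)}) (mset_set {..<n})"
    unfolding rim_def k_def by (intro image_mset_cong) auto
  finally have rimE: "image_mset rim (mset_set {..<k}) = add_mset {p n, p 0} (image_mset (\<lambda>i. {p i, p (Suc i)}) (mset_set {..<n}))" .
  have injrim: "inj_on rim {..<k}"
  proof (rule inj_onI)
    fix i j assume ij: "i \<in> {..<k}" "j \<in> {..<k}" "rim i = rim j"
    have lt: "Suc i mod k < k" "Suc j mod k < k" by (simp_all add: k_def)
    have P: "p a = p b \<longleftrightarrow> a = b" if "a < k" "b < k" for a b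
      using inj that by (auto simp: inj_on_def)
    have "i = j \<or> (i = Suc j mod k \<and> j = Suc i mod k)"
      using ij lt P unfolding rim_def doubleton_eq_iff by auto
    \<comment> \<open>Different indices would be successors of each other, which happens only on a
      rim of two vertices.\<close>
    then show "i = j" using ij n nx[of i] nx[of j] by (auto split: if_splits)
  qed
  have cn: "c \<notin> set rs" using rs(1) by simp
  have injsp: "inj_on (\<lambda>v. {c, v}) (set rs)" using cn by (auto simp: inj_on_def doubleton_eq_iff)
  define R where "R = rim ` {..<k}"
  define S where "S = (\<lambda>v. {c, v}) ` set rs"
  have RS: "R \<inter> S = {}"
  proof -
    have "c \<notin> rim i" if "i < k" for i
      using cn that unfolding set rim_def k_def by auto
    then show ?thesis unfolding R_def S_def by auto
  qed
  have "image_mset (\<lambda>i. {c, p i}) (mset_set {..<k}) = image_mset (\<lambda>v. {c, v}) (mset_set (set rs))"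
    unfolding set using inj by (simp add: image_mset_mset_set[symmetric] multiset.map_comp o_def)
  then have "end_mset G = image_mset rim (mset_set {..<k}) + image_mset (\<lambda>v. {c, v}) (mset_set (set rs))"
    unfolding E rimE hl by (subst rsp) (simp add: fan_map_upt k_def insert_commute del: upt_Suc)
  also have "\<dots> = mset_set R + mset_set S"
    unfolding R_def S_def using injrim injsp by (simp add: image_mset_mset_set)
  also have "\<dots> = mset_set (R \<union> S)"
    using RS by (subst mset_set_Union) (auto simp: R_def S_def)
  finally have ER: "image_mset (ends G) (mset_set (edges G)) = mset_set (R \<union> S)" unfolding end_mset_def .
  have finRS: "finite (R \<union> S)" by (auto simp: R_def S_def)
  have im: "ends G ` edges G = R \<union> S"
    using arg_cong[OF ER, of set_mset] fin finRS by simp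
  have "card (edges G) = card (R \<union> S)" using arg_cong[OF ER, of size] by simp
  then have "inj_on (ends G) (edges G)" using im fin by (intro eq_card_imp_inj_on) auto
  then have bij: "bij_betw (ends G) (edges G) (R \<union> S)" using im by (simp add: bij_betw_def)
  define g where "g = inv_into (edges G) (ends G)"
  have bg: "bij_betw g (R \<union> S) (edges G)" unfolding g_def using bij by (rule bij_betw_inv_into)
  have eg: "ends G (g x) = x" if "x \<in> R \<union> S" for x
    unfolding g_def using im that by (metis f_inv_into_f)
  define C where "C = \<lparr>vertices = set rs, edges = g ` R, ends = ends G\<rparr>"
  have gR: "bij_betw g R (g ` R)" using bg unfolding bij_betw_def by (auto intro: inj_on_subset)
  have gS: "bij_betw g S (edges G - g ` R)"
  proof -
    have i: "inj_on g (R \<union> S)" "g ` (R \<union> S) = edges G" using bg by (auto simp: bij_betw_def)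
    have "g ` S = edges G - g ` R"
    proof -
      have "g ` R \<inter> g ` S = {}" using inj_on_image_Int[OF i(1), of R S] RS by auto
      then show ?thesis using i(2) by (auto simp: image_Un)
    qed
    then show ?thesis using i(1) unfolding bij_betw_def by (auto intro: inj_on_subset)
  qed
  have "is_cycle k C" unfolding is_cycle_def
  proof (intro conjI exI allI impI)
    show "3 \<le> k" using n by (simp add: k_def)
    show "bij_betw p {..<k} (vertices C)" using inj set by (simp add: C_def bij_betw_def)
    have "bij_betw rim {..<k} R" using injrim by (simp add: R_def bij_betw_def)
    then show "bij_betw (g \<circ> rim) {..<k} (edges C)" using gR by (simp add: C_def bij_betw_trans)
    fix i assume "i < k"
    then have "rim i \<in> R \<union> S" by (simp add: R_def)
    then show "ends C ((g \<circ> rim) i) = {p i, p (Suc i mod k)}" using eg by (simp add: C_def rim_def)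
  qed
  moreover have "subgraph_of C G" unfolding subgraph_of_def using rs(2) bg by (auto simp: C_def bij_betw_def)
  moreover have "bij_betw (g \<circ> (\<lambda>v. {c, v})) (vertices C) (edges G - edges C)"
  proof -
    have "bij_betw (\<lambda>v. {c, v}) (set rs) S" using injsp by (simp add: S_def bij_betw_def)
    then show ?thesis using gS by (simp add: C_def bij_betw_trans)
  qed
  moreover have "\<forall>v\<in>vertices C. ends G ((g \<circ> (\<lambda>v. {c, v})) v) = {c, v}"
    using eg by (auto simp: C_def S_def)
  ultimately have "is_wheel k G" unfolding is_wheel_def using rs(2) cn
    by (intro exI[of _ C] exI[of _ c] exI[of _ "g \<circ> (\<lambda>v. {c, v})"]) (simp add: C_def)
  then show ?thesis unfolding odd_wheel_def using rs(4) n k_def by metis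
qed

text \<open>The chord lies in a triangle-path, hence in a triangle, so its ends have a common
  neighbour \<open>c\<close> in the two-tree, the hub of a fan. A single edge lies in no
  triangle.\<close>

lemma exceptional_odd_wheel:
  assumes G: "finite_loopless_graph G" and tc: "triangularly_connected G"
    and chorded: "chorded (vertices G) (end_mset G)" and exceptional: "exceptional (vertices G) (end_mset G)"
  shows "odd_wheel G"
proof -
  have fin: "finite (edges G)" "finite (vertices G)" using G by (auto simp: finite_loopless_graph_def)
  have path: "\<exists>c. c \<noteq> a \<and> c \<noteq> b \<and> {a, c} \<in># end_mset G \<and> {b, c} \<in># end_mset G" if e: "{a, b} \<in># end_mset G" for a b
  proof -
    obtain e where e: "e \<in> edges G" "ends G e = {a, b}" using e fin by (auto simp: end_mset_def)
    obtain P where P: "triangle_path P" "subgraph_of P G" "e \<in> edges P"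
      using tc e unfolding triangularly_connected_def by metis
    obtain r where r: "finite (edges P)" "3 \<le> card (vertices P)" "two_tree r (vertices P) (end_mset P)"
      using triangle_path_two_tree[OF P(1)] by metis
    have "ends P e = {a, b}" using P e by (simp add: subgraph_of_def)
    then have "{a, b} \<in># end_mset P" using P(3) r(1) by (force simp: end_mset_def)
    from two_tree_edge_in_triangle[OF r(3,2) this] obtain c where
      c: "c \<noteq> a" "c \<noteq> b" "{a, c} \<in># end_mset P" "{b, c} \<in># end_mset P" by metis
    then show ?thesis unfolding end_mset_subgraph[OF P(2) fin(1)] by (intro exI[of _ c]) simp
  qed
  from chorded exceptional show ?thesis
  proof (cases rule: exceptional_cases)
    case (edge a b)
    then show ?thesis using path[of a b] by (auto simp: doubleton_eq_iff)
  next
    case (tree r T a b)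
    have odd: "\<forall>k\<in>vertices G. odd (mset_deg (add_mset {a, b} T) k)" using exceptional tree(2) by (simp add: exceptional_def)
    note facts = two_tree_odd_facts[OF tree(1,3-5) odd] and L = odd_chord_leaves[OF tree(1,3-5) odd]
    have "{a, b} \<in># end_mset G" using tree(2) by simp
    from path[OF this] obtain c where c: "c \<noteq> a" "c \<noteq> b" "{a, c} \<in># end_mset G" "{b, c} \<in># end_mset G" by metis
    have cT: "{a, c} \<in># T" "{b, c} \<in># T" using c tree(2) by (auto simp: doubleton_eq_iff)
    have ab2: "mset_deg T a = 2" "mset_deg T b = 2" using L(1) by auto
    have "\<forall>k\<in>vertices G - {a, b, c}. 3 \<le> mset_deg T k"
    proof
      fix k assume k: "k \<in> vertices G - {a, b, c}"
      then have "odd (mset_deg T k)" using facts(3)[of k] by auto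
      moreover have "2 \<le> mset_deg T k" using two_tree_mdeg_ge2[OF tree(1) facts(2)] k by simp
      ultimately show "3 \<le> mset_deg T k" by (cases "mset_deg T k = 2") auto
    qed
    from two_tree_is_fan[OF tree(1) facts(2) tree(3-5) ab2 cT this] obtain rs where
      rs: "distinct (c # rs)" "insert c (set rs) = vertices G" "rs \<noteq> []" "hd rs = a" "last rs = b" "T = fan c rs"
      by metis
    have "Suc (length rs) = card (vertices G)" using rs(1,2) distinct_card[OF rs(1)] by simp
    then have "3 \<le> length rs" using L(2) by simp
    moreover have "odd (length rs)"
    proof -
      have "c \<in> vertices G" using rs(2) by auto
      then have "odd (mset_deg T c)" using facts(3)[of c] c by auto
      then show ?thesis using mset_deg_fan_hub[of c rs] rs by simp
    qed
    ultimately show ?thesis using fan_odd_wheel[OF G _ rs(1,2)] tree(2) rs by metis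
  qed
qed

text \<open>The first attached vertex outside \<open>S\<close> hangs on an edge inside
  \<open>S\<close>.\<close>

lemma two_tree_leaves_set:
  "two_tree r V T \<Longrightarrow> r \<subseteq> S \<Longrightarrow> \<not> V \<subseteq> S \<Longrightarrow>
   \<exists>w x y. w \<notin> S \<and> x \<in> S \<and> y \<in> S \<and> {x, y} \<in># T \<and> {w, x} \<in># T \<and> {w, y} \<in># T"
proof (induction rule: two_tree.induct)
  case (attach V T x y w)
  show ?case
  proof (cases "V \<subseteq> S")
    case True
    then have "w \<notin> S" "x \<in> S" "y \<in> S" using attach.prems chorded_edgeD[OF two_tree_chorded[OF attach.hyps(1)] attach.hyps(2)] by auto
    then show ?thesis using attach.hyps(2) by (intro exI[of _ w] exI[of _ x] exI[of _ y]) auto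
  next
    case False
    then show ?thesis using attach by (metis glue_mem)
  qed
qed auto

text \<open>A largest vertex set \<open>S\<close> whose induced graph is \<open>chorded\<close> is
  all of \<open>vertices G\<close>: a triangle-path from an edge inside \<open>S\<close> to an edge
  with an end outside has a triangle that leaves \<open>S\<close> by one vertex, and this vertex can
  be attached to \<open>S\<close>, its further edges into \<open>S\<close> being chords.\<close>

lemma triangularly_connected_chorded:
  assumes G: "finite_loopless_graph G" and tc: "triangularly_connected G" and ne: "edges G \<noteq> {}"
  shows "chorded (vertices G) (end_mset G)"
proof -
  have fin: "finite (edges G)" "finite (vertices G)" using G by (auto simp: finite_loopless_graph_def)
  have endsG: "\<exists>a b. ends G e = {a, b} \<and> a \<noteq> b \<and> a \<in> vertices G \<and> b \<in> vertices G" if "e \<in> edges G" for e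
    using G that unfolding finite_loopless_graph_def by (metis card_2_iff insert_subset)
  define ind where "ind S = {e \<in> edges G. ends G e \<subseteq> S}" for S
  define emS where "emS S = image_mset (ends G) (mset_set (ind S))" for S
  define good where "good S \<longleftrightarrow> S \<subseteq> vertices G \<and> chorded S (emS S)" for S
  have fi: "finite (ind S)" for S using fin by (simp add: ind_def)
  have emS_split: "emS S' = image_mset (ends G) (mset_set X) + image_mset (ends G) (mset_set (ind S' - X))"
    if "X \<subseteq> ind S'" for S' X
    unfolding emS_def using that fi
    by (metis Diff_disjoint Diff_partition finite_Diff finite_subset image_mset_union mset_set_Union)
  have rest: "pairs S (image_mset (ends G) (mset_set (ind S - X)))" for S X
  proof -
    have "\<exists>a b. ends G e = {a, b} \<and> a \<in> S \<and> b \<in> S \<and> a \<noteq> b" if e: "e \<in> ind S" for e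
    proof -
      have "e \<in> edges G" "ends G e \<subseteq> S" using e by (auto simp: ind_def)
      with endsG[OF this(1)] show ?thesis by (metis insert_subset)
    qed
    then show ?thesis unfolding pairs_def using fi by auto
  qed
  obtain e0 where e0: "e0 \<in> edges G" using ne by auto
  obtain a b where ab: "ends G e0 = {a, b}" "a \<noteq> b" "a \<in> vertices G" "b \<in> vertices G" using endsG[OF e0] by metis
  have "good {a, b}"
  proof -
    have s: "emS {a, b} = {#{a, b}#} + image_mset (ends G) (mset_set (ind {a, b} - {e0}))"
      using emS_split[of "{e0}" "{a, b}"] e0 ab by (simp add: ind_def)
    have "chorded {a, b} (emS {a, b})" unfolding s by (rule chorded_plus[OF chorded.base[OF ab(2)] rest])
    then show ?thesis using ab by (simp add: good_def)
  qed
  moreover have "\<forall>S. good S \<longrightarrow> card S < Suc (card (vertices G))"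
    by (auto simp: good_def fin card_mono less_Suc_eq_le)
  ultimately obtain S where S: "good S" and max: "\<And>S'. good S' \<Longrightarrow> card S' \<le> card S"
    using ex_has_greatest_nat[of good "{a, b}" card] by metis
  show ?thesis
  proof (cases "S = vertices G")
    case True
    then have "ind S = edges G" using G by (auto simp: ind_def finite_loopless_graph_def)
    then show ?thesis using S True by (simp add: good_def emS_def end_mset_def)
  next
    case False
    have cS: "chorded S (emS S)" and sub: "S \<subseteq> vertices G" using S by (auto simp: good_def)
    have "2 \<le> card S" using chorded_card[OF cS] .
    moreover have "2 * card S \<le> size (emS S) + 3" using chorded_size[OF cS] .
    ultimately have "emS S \<noteq> {#}" by auto
    then obtain e1 where e1: "e1 \<in> ind S" unfolding emS_def using fi by fastforce
    obtain v where v: "v \<in> vertices G" "v \<notin> S" using False sub by auto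
    obtain u where u: "u \<in> S" using \<open>2 \<le> card S\<close> by fastforce
    have "(v, u) \<in> (adjacency G)\<^sup>*" using tc u v sub unfolding triangularly_connected_def connected_graph_def by auto
    moreover have "v \<noteq> u" using u v by auto
    ultimately obtain x where "(v, x) \<in> adjacency G" by (meson converse_rtranclE)
    then obtain e2 where e2: "e2 \<in> edges G" "ends G e2 = {v, x}" unfolding adjacency_def by auto
    have e1G: "e1 \<in> edges G" "ends G e1 \<subseteq> S" using e1 by (auto simp: ind_def)
    obtain P where P: "triangle_path P" "subgraph_of P G" "e1 \<in> edges P" "e2 \<in> edges P"
      using tc e1G e2 unfolding triangularly_connected_def by metis
    obtain r where r: "finite (edges P)" "3 \<le> card (vertices P)" "two_tree r (vertices P) (end_mset P)"
      using triangle_path_two_tree[OF P(1)] by metis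
    have eP: "ends P e = ends G e" if "e \<in> edges P" for e using P(2) that by (simp add: subgraph_of_def)
    have memP: "ends G e \<in># end_mset P" if "e \<in> edges P" for e
      using that r(1) eP[OF that] by (force simp: end_mset_def)
    have "two_tree (ends G e1) (vertices P) (end_mset P)" using two_tree_reroot[OF r(3) memP[OF P(3)]] .
    moreover have "v \<in> vertices P" using memP[OF P(4)] chorded_edgeD(1)[OF two_tree_chorded[OF r(3)]] e2 by metis
    ultimately obtain w x y where wxy: "w \<notin> S" "x \<in> S" "y \<in> S" "{x, y} \<in># end_mset P" "{w, x} \<in># end_mset P" "{w, y} \<in># end_mset P"
      using two_tree_leaves_set[of "ends G e1" "vertices P" "end_mset P" S] e1G v by blast
    have lab: "\<exists>e\<in>edges G. ends G e = X" if "X \<in># end_mset P" for X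
      using that end_mset_subgraph[OF P(2) fin(1)] fin
      by (metis (no_types, lifting) end_mset_def finite_set_mset_mset_set image_iff set_image_mset union_iff)
    obtain e3 e4 e5 where e: "e3 \<in> edges G" "ends G e3 = {x, y}" "e4 \<in> edges G" "ends G e4 = {w, x}"
      "e5 \<in> edges G" "ends G e5 = {w, y}" using lab wxy by metis
    have xy: "x \<noteq> y" using chorded_edgeD(3)[OF two_tree_chorded[OF r(3)] wxy(4)] .
    have e45: "e4 \<noteq> e5" using e xy by (auto simp: doubleton_eq_iff)
    have "e3 \<in> ind S" using e(1,2) wxy(2,3) by (simp add: ind_def)
    then have "ends G e3 \<in># emS S" unfolding emS_def using fi[of S] by auto
    then have xyS: "{x, y} \<in># emS S" using e(2) by simp
    have Sw: "ind S \<subseteq> ind (insert w S)" "e4 \<in> ind (insert w S)" "e5 \<in> ind (insert w S)" "e4 \<notin> ind S" "e5 \<notin> ind S"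
      using e(3-6) wxy(1-3) unfolding ind_def by auto
    define X where "X = insert e4 (insert e5 (ind S))"
    have "image_mset (ends G) (mset_set X) = glue w x y (emS S)"
      unfolding X_def emS_def using fi[of S] Sw(4,5) e(4,6) e45 by (simp add: glue_def)
    then have s: "emS (insert w S) = glue w x y (emS S) + image_mset (ends G) (mset_set (ind (insert w S) - X))"
      using emS_split[of X "insert w S"] Sw by (simp add: X_def)
    have "chorded (insert w S) (emS (insert w S))"
      unfolding s by (rule chorded_plus[OF chorded.attach[OF cS xyS wxy(1)] rest])
    moreover have "w \<in> vertices G"
      using endsG[OF e(3)] e(4) by (metis doubleton_eq_iff)
    ultimately have "good (insert w S)" using sub by (simp add: good_def)
    from max[OF this] show ?thesis using wxy(1) finite_subset[OF sub fin(2)] by simp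
  qed
qed

theorem theorem1p7:
  fixes G :: "('v, 'e) ugraph"
  assumes "finite_loopless_graph G"
    and "bridgeless G"
  shows "(triangularly_connected G \<longrightarrow> (admits_S1_flow G \<longleftrightarrow> \<not> odd_wheel G)) \<and>
         ((\<exists>T. spanning_triangle_tree T G) \<longrightarrow> (admits_S1_flow G \<longleftrightarrow> \<not> odd_crystal G))"
proof (intro conjI impI)
  note G = assms(1)
  assume tc: "triangularly_connected G"
  show "admits_S1_flow G \<longleftrightarrow> \<not> odd_wheel G"
  proof
    assume "admits_S1_flow G"
    then show "\<not> odd_wheel G" using odd_wheel_no_flow[OF G] admits_S1_flow_iff[OF G] by metis
  next
    assume nw: "\<not> odd_wheel G"
    have "has_flow (end_mset G) (\<lambda>_. 0)"
    proof (cases "edges G = {}")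
      case True
      then show ?thesis by (simp add: end_mset_def has_flow.empty)
    next
      case False
      have "chorded (vertices G) (end_mset G)" using triangularly_connected_chorded[OF G tc False] .
      then show ?thesis using chorded_has_flow exceptional_odd_wheel[OF G tc] nw by metis
    qed
    then show "admits_S1_flow G" using admits_S1_flow_iff[OF G] by simp
  qed
next
  note G = assms(1)
  have fin: "finite (edges G)" using G by (simp add: finite_loopless_graph_def)
  assume "\<exists>T. spanning_triangle_tree T G"
  then obtain T where T: "spanning_triangle_tree T G" by metis
  show "admits_S1_flow G \<longleftrightarrow> \<not> odd_crystal G"
  proof
    assume "admits_S1_flow G"
    then show "\<not> odd_crystal G" using odd_crystal_no_flow[OF G] admits_S1_flow_iff[OF G] by metis
  next
    assume nc: "\<not> odd_crystal G"
    have T': "triangle_tree T" "subgraph_of T G" "vertices T = vertices G"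
      using T by (auto simp: spanning_triangle_tree_def)
    obtain r where "two_tree r (vertices G) (end_mset T)" using triangle_tree_two_tree[OF T'(1)] T'(3) by auto
    then have "chorded (vertices G) (end_mset G)"
      using pairs_end_mset[OF G] unfolding end_mset_subgraph[OF T'(2) fin] by (intro chorded_plus two_tree_chorded) auto
    then have "has_flow (end_mset G) (\<lambda>_. 0)" using chorded_has_flow exceptional_odd_crystal[OF G T] nc by metis
    then show "admits_S1_flow G" using admits_S1_flow_iff[OF G] by simp
  qed
qed

end
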